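(* Let $(X_i)_{i\ge 1}$ be i.i.d. real-valued random variables with $\mathbb E(X_1)=0$, $\mathbb E(X_1^2)=\sigma^2>0$, and suppose there exists $\delta>0$ such that $\mathbb E(|X_1|^{2+\delta})<\infty$. Then there exists a constant $c>0$ such that for any integer $n\ge 1$ and any $x\in\mathbb R$, $$\left|\mathbb P(\tau_x>n)-\frac{V(x)\,L\left(\frac{x}{\sigma\sqrt n}\right)}{\sigma\sqrt n}\right|\le \frac{c}{\sqrt n}\left(\frac{1}{n^{\delta/4}}+\frac{V(x)\,L\left(\frac{x}{\sigma\sqrt n}\right)}{n^{\frac{\delta}{4(3+\delta)}}}\log n\right).$$
   Context: Let $S_n=\sum_{i=1}^n X_i$ for $n\ge1$. For $x\in\mathbb R$, $\tau_x=\inf\{k\ge 1: x+S_k<0\}$ (with $\inf\emptyset=\infty$). Define $V(x)=-\mathbb E(S_{\tau_x})$ for $x\in\mathbb R$; under the stated moment assumptions it is known that $V$ is well defined, non-negative and non-decreasing, and that $V(x)=\lim_{n\to\infty}\mathbb E\big((x+S_n)\mathbf 1_{\{\tau_x>n\}}\big)$. Let $\Phi$ be the standard normal distribution function and $H(x)=2\Phi(x)-1$. Define $L(x)=H(x)/x$ for $x\neq 0$ and $L(0)=2/\sqrt{2\pi}$. The constant $c$ may depend on $\delta$ and on the law of $X_1$, but not on $n$ or $x$. *)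

theory Defs
  imports "HOL-Probability.Probability"
begin

definition walk :: "(nat \<Rightarrow> 'a \<Rightarrow> real) \<Rightarrow> nat \<Rightarrow> 'a \<Rightarrow> real" where
  "walk X n \<omega> = (\<Sum>i = 1..n. X i \<omega>)"

text \<open>\<^const>\<open>Inf\<close> on \<^typ>\<open>enat\<close> sends the empty set to \<open>\<infinity>\<close>, as required for the exit time.\<close>

definition exit_time :: "(nat \<Rightarrow> 'a \<Rightarrow> real) \<Rightarrow> real \<Rightarrow> 'a \<Rightarrow> enat" where
  "exit_time X x \<omega> = Inf (enat ` {k. 1 \<le> k \<and> x + walk X k \<omega> < 0})"

text \<open>The value on \<open>{\<tau>\<^sub>x = \<infinity>}\<close> is immaterial: for a centred walk with positive
  finite variance this event has probability zero.\<close>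

definition walk_at_exit :: "(nat \<Rightarrow> 'a \<Rightarrow> real) \<Rightarrow> real \<Rightarrow> 'a \<Rightarrow> real" where
  "walk_at_exit X x \<omega> = (case exit_time X x \<omega> of enat k \<Rightarrow> walk X k \<omega> | \<infinity> \<Rightarrow> 0)"

definition V :: "'a measure \<Rightarrow> (nat \<Rightarrow> 'a \<Rightarrow> real) \<Rightarrow> real \<Rightarrow> real" where
  "V M X x = - (\<integral>\<omega>. walk_at_exit X x \<omega> \<partial>M)"

definition H :: "real \<Rightarrow> real" where
  "H x = 2 * cdf std_normal_distribution x - 1"

definition L :: "real \<Rightarrow> real" where
  "L x = (if x = 0 then 2 / sqrt (2 * pi) else H x / x)"

end

theory Submission
  imports Defs
begin

text \<open>
  Rescale to \<open>\<sigma> = 1\<close> and let \<open>u(t, z) = H(z / \<surd>t)\<close>, the probability that Brownian motion started at \<open>z \<ge> 0\<close>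
  stays positive up to time \<open>t\<close>, extended oddly to \<open>z < 0\<close>; it solves the heat equation on the whole line.
  Lindeberg's replacement argument shows that \<open>u(h + n - k, x + S\<^sub>k)\<close> is nearly a martingale. The smoothing time
  \<open>h = n\<^bsup>1 - 2\<epsilon>\<^esup>\<close>, \<open>\<epsilon> = \<delta> / (4 (3 + \<delta>))\<close>, removes the singularity at the terminal time. Stopping at \<open>\<tau>\<^sub>x \<and> n\<close> gives
  \<open>P(\<tau>\<^sub>x > n) \<approx> u(n, x) - E(u(n - \<tau>\<^sub>x, x + S\<^bsub>\<tau>\<^esub>); \<tau>\<^sub>x \<le> n)\<close>. As \<open>u(t, z) = z L(z / \<surd>t) / \<surd>t\<close>, the overshoot term is
  close to the mean overshoot times \<open>L(x / \<surd>n) / \<surd>n\<close>, and \<open>V(x)\<close> is \<open>x\<close> plus the mean overshoot.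

  The errors are small relative to \<open>V(x) / \<surd>n\<close> because of three facts: the overshoot from \<open>z\<close> has mean
  \<open>O((1 + z)\<^bsup>1 - \<beta>\<^esup>)\<close> by an explicit superharmonic function; \<open>P(\<tau>\<^sub>x > k) = O(V(x) / \<surd>k)\<close> by positive association;
  and \<open>S\<^sub>k\<close> falls in an interval of length \<open>\<surd>h\<close> with probability \<open>O(\<surd>(h / k))\<close> by Fourier inversion. Negative starting points
  reduce to nonnegative ones by one step of the walk.
\<close>

subsection \<open>The Brownian survival probability\<close>

text \<open>The accuracy is relative: for \<open>x\<close> of order 1 the main term is of order
  \<open>1 / sqrt n\<close>, so absolute error bounds say nothing there. Each error made at time
  \<open>k\<close> is therefore weighted by the probability of having survived until
  \<open>k\<close>, and the sharp bound for that probability has to be proved before any comparison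
  with Brownian motion. From \<open>x >= sqrt n\<close> on, the main term is bounded below and
  absolute errors suffice; but the overshoot bound grows like \<open>x^(1 - bet)\<close> while
  smoothing only supplies the factor \<open>1 / sqrt h\<close>, so far out Kolmogorov's inequality
  replaces the comparison.

  For \<open>x >= 0\<close> the error comes out purely relative. The additive term
  \<open>n^(-\<delta>/4)\<close> is spent on \<open>x < 0\<close>, where V has no positive lower
  bound and a single large jump can matter, and on \<open>n = 1\<close>, where the logarithm
  vanishes. For \<open>n >= 2\<close> the logarithm enters only through a positive lower bound.

  The odd extension keeps the Taylor expansion free of any boundary effect at 0; the price is the
  negative value of \<open>u\<close> at the exit position, and this is exactly the term that builds
  the overshoot part of V.\<close>

abbreviation (input) phi :: "real \<Rightarrow> real" where "phi \<equiv> std_normal_density"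

lemma deriv_std_normal_density [derivative_intros]:
  "(f has_real_derivative f') (at x within S) \<Longrightarrow>
   ((\<lambda>x. phi (f x)) has_real_derivative (- f x * phi (f x) * f')) (at x within S)"
  unfolding std_normal_density_def
  by (auto intro!: derivative_eq_intros simp: field_simps power2_eq_square)

text \<open>Crude but explicit: \<open>1 + w^4\<close> is at most 8 times the quadratic Taylor
  polynomial of \<open>exp (w^2 / 2)\<close>. Such products occur in the derivatives of
  \<open>H\<close> in space and time.\<close>

lemma power_phi_le:
  assumes "j \<le> 4" shows "\<bar>w\<bar> ^ j * phi w \<le> 8"
proof -
  have e: "exp (w\<^sup>2/2) \<ge> 1 + w\<^sup>2/2 + (w\<^sup>2/2)\<^sup>2/2"
    using exp_lower_Taylor_quadratic[of "w\<^sup>2/2"] zero_le_power2[of w] by (metis divide_nonneg_nonneg zero_le_numeral)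
  have "\<bar>w\<bar> ^ j \<le> 1 + \<bar>w\<bar>^4"
  proof (cases "\<bar>w\<bar> \<le> 1")
    case True then show ?thesis using power_le_one[of "\<bar>w\<bar>" j] zero_le_power[of "\<bar>w\<bar>" 4]
      by linarith
  next
    case False
    then have "\<bar>w\<bar>^j \<le> \<bar>w\<bar>^4" using assms by (intro power_increasing) auto
    then show ?thesis by simp
  qed
  also have "\<dots> = 1 + w^4" by simp
  also have "\<dots> \<le> 8 * (1 + w\<^sup>2/2 + (w\<^sup>2/2)\<^sup>2/2)" by (simp add: field_simps)
  also have "\<dots> \<le> 8 * exp (w\<^sup>2/2)" using e by simp
  finally have 1: "\<bar>w\<bar> ^ j \<le> 8 * exp (w\<^sup>2/2)" .
  have 2: "1 / sqrt (2 * pi) \<le> 1" using pi_gt3 by simp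
  have "\<bar>w\<bar> ^ j * phi w = (1 / sqrt (2 * pi)) * (\<bar>w\<bar> ^ j * exp (- w\<^sup>2/2))"
    by (simp add: std_normal_density_def)
  also have "\<dots> \<le> 1 * (\<bar>w\<bar> ^ j * exp (- w\<^sup>2/2))"
    by (intro mult_right_mono 2) auto
  also have "\<dots> \<le> (8 * exp (w\<^sup>2/2)) * exp (- w\<^sup>2/2)" using 1 by (simp add: mult_right_mono)
  also have "\<dots> = 8" by (simp flip: exp_add)
  finally show ?thesis .
qed

text \<open>\<open>2 * phi\<close> is the derivative of \<open>H\<close>, so this makes
  \<open>H\<close> 1-Lipschitz and gives \<open>L <= 1\<close>.\<close>

lemma phi_le_half: "2 * phi w \<le> 1"
proof -
  have "sqrt (2*2) \<le> sqrt (2*pi)" using pi_gt3 by (intro real_sqrt_le_mono) simp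
  then have "2 \<le> sqrt (2*pi)" by simp
  moreover have "exp (- w\<^sup>2/2) \<le> 1" by simp
  ultimately have "2 / sqrt (2*pi) * exp (- w\<^sup>2/2) \<le> 1 * 1" by (intro mult_mono) auto
  then show ?thesis by (simp add: std_normal_density_def)
qed

text \<open>The left side is the modulus of the second derivative of \<open>H\<close>; the bound
  yields the remainder \<open>v^2 / 2\<close> in \<open>H_Taylor2\<close>.\<close>

lemma abs_phi_le_half: "2 * \<bar>w\<bar> * phi w \<le> 1"
proof -
  have "exp (w\<^sup>2/2) \<ge> 1 + w\<^sup>2/2" by (rule exp_ge_add_one_self)
  moreover have "1 + w\<^sup>2/2 \<ge> \<bar>w\<bar>"
    using zero_le_power2[of "\<bar>w\<bar> - 1"] zero_le_power2[of w] by (simp add: power2_diff)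
  ultimately have "\<bar>w\<bar> \<le> exp (w\<^sup>2/2)" by linarith
  then have "\<bar>w\<bar> * exp (- w\<^sup>2/2) \<le> exp (w\<^sup>2/2) * exp (- w\<^sup>2/2)" by (intro mult_right_mono) auto
  then have 1: "\<bar>w\<bar> * exp (- w\<^sup>2/2) \<le> 1" by (simp flip: exp_add)
  have "sqrt (2*2) \<le> sqrt (2*pi)" using pi_gt3 by (intro real_sqrt_le_mono) simp
  then have "2 \<le> sqrt (2*pi)" by simp
  with 1 have "2 / sqrt (2*pi) * (\<bar>w\<bar> * exp (- w\<^sup>2/2)) \<le> 1 * 1" by (intro mult_mono) auto
  then show ?thesis by (simp add: std_normal_density_def field_simps)
qed

interpretation std_normal: real_distribution std_normal_distribution
  by (rule real_dist_normal_dist)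

lemma H_diff: assumes "a \<le> b" shows "H b - H a = 2 * integral {a..b} phi"
proof (cases "a = b")
  case False
  have "cdf std_normal_distribution b - cdf std_normal_distribution a = measure std_normal_distribution {a<..b}"
    using assms False by (intro std_normal.cdf_diff_eq) auto
  also have "\<dots> = (LINT x:{a<..b}|lborel. phi x)"
  proof -
    have "(\<integral>x. indicator {a<..b} x \<partial>std_normal_distribution) = measure std_normal_distribution {a<..b}"
      by (subst Bochner_Integration.integral_indicator) simp
    moreover have "(\<integral>x. indicator {a<..b} x \<partial>std_normal_distribution) = (LINT x:{a<..b}|lborel. phi x)"
      by (subst integral_density) (auto simp: set_lebesgue_integral_def mult.commute)
    ultimately show ?thesis by metis
  qed
  also have "\<dots> = (LINT x:{a..b}|lborel. phi x)"
    unfolding set_lebesgue_integral_def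
    by (intro integral_cong_AE) (auto intro!: AE_I'[of "{a}"] simp: indicator_def null_sets_def)
  also have "\<dots> = integral {a..b} phi"
    by (intro set_borel_integral_eq_integral)
      (auto simp: set_integrable_def simp del: real_scaleR_def intro!: integrable_mult_indicator)
  finally show ?thesis by (simp add: H_def)
qed simp

lemma DERIV_H: "(H has_real_derivative 2 * phi u) (at u)"
proof -
  have c: "continuous_on {u-1..u+1} phi" by (auto simp: normal_density_def intro!: continuous_intros)
  have "((\<lambda>v. integral {u-1..v} phi) has_real_derivative phi u) (at u within {u-1..u+1})"
    by (rule integral_has_real_derivative[OF c]) auto
  then have "((\<lambda>v. H (u-1) + 2 * integral {u-1..v} phi) has_real_derivative 2 * phi u) (at u within {u-1..u+1})"
    by (auto intro!: derivative_eq_intros)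
  then have "(H has_real_derivative 2 * phi u) (at u within {u-1..u+1})"
  proof (rule has_field_derivative_transform_within[where d=1])
    fix x assume "x \<in> {u - 1..u + 1}"
    then show "H (u - 1) + 2 * integral {u - 1..x} phi = H x" using H_diff[of "u-1" x] by simp
  qed auto
  then show ?thesis by (subst (asm) at_within_interior) auto
qed

lemma DERIV_H' [derivative_intros]:
  "(f has_real_derivative f') (at x within S) \<Longrightarrow>
   ((\<lambda>x. H (f x)) has_real_derivative (2 * phi (f x) * f')) (at x within S)"
  using DERIV_chain2[of H _ f x f' S] DERIV_H by blast

lemma H_mono: "u \<le> v \<Longrightarrow> H u \<le> H v"
  by (simp add: H_def std_normal.cdf_nondecreasing)

lemma H_bounds: "H u \<le> 1" "- 1 \<le> H u"
  using std_normal.cdf_bounded_prob[of u] std_normal.cdf_nonneg[of u] by (auto simp: H_def)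

lemma H_tendsto: "(H \<longlongrightarrow> 1) at_top" "(H \<longlongrightarrow> -1) at_bot"
proof -
  have "((\<lambda>u. 2 * cdf std_normal_distribution u - 1) \<longlongrightarrow> 2 * 1 - 1) at_top"
    by (intro tendsto_intros std_normal.cdf_lim_at_top_prob)
  then show "(H \<longlongrightarrow> 1) at_top" by (simp add: H_def[abs_def])
  have "((\<lambda>u. 2 * cdf std_normal_distribution u - 1) \<longlongrightarrow> 2 * 0 - 1) at_bot"
    by (intro tendsto_intros std_normal.cdf_lim_at_bot)
  then show "(H \<longlongrightarrow> -1) at_bot" by (simp add: H_def[abs_def])
qed

text \<open>The density is even, so \<open>H u + H (- u)\<close> has derivative zero, and its limit
  at infinity is 1 - 1.\<close>

lemma H_minus: "H (- u) = - H u"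
proof -
  have d: "((\<lambda>u. H u + H (- u)) has_real_derivative 0) (at u)" for u
    by (auto intro!: derivative_eq_intros simp: std_normal_density_def)
  have c: "H u + H (-u) = H v + H (-v)" for u v
    using DERIV_isconst_all[of "\<lambda>u. H u + H (- u)"] d by blast
  have "((\<lambda>v. H v + H (-v)) \<longlongrightarrow> 1 + -1) at_top"
    by (intro tendsto_add H_tendsto filterlim_compose[OF H_tendsto(2) filterlim_uminus_at_bot_at_top])
  moreover have "(\<lambda>v. H v + H (-v)) = (\<lambda>v. H u + H (-u))" using c by blast
  ultimately have "((\<lambda>v::real. H u + H (-u)) \<longlongrightarrow> 0) at_top" by simp
  then have "H u + H (-u) = 0" using tendsto_const_iff by (metis trivial_limit_at_top_linorder)
  then show ?thesis by simp
qed

lemma H_0 [simp]: "H 0 = 0" using H_minus[of 0] by simp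

lemma H_nonneg: "0 \<le> u \<Longrightarrow> 0 \<le> H u" using H_mono[of 0 u] by simp

lemma H_Lipschitz: "\<bar>H u - H v\<bar> \<le> \<bar>u - v\<bar>"
proof -
  have "norm (H u - H v) \<le> 1 * norm (u - v)"
    by (rule field_differentiable_bound[of UNIV H "\<lambda>u. 2 * phi u"]) (use phi_le_half in \<open>auto intro: DERIV_H\<close>)
  then show ?thesis by simp
qed

text \<open>The auxiliary \<open>F\<close> vanishes at 0 and increases on the half-line because
  \<open>(u + w)^2 >= u^2 + w^2\<close> there. Its limit at infinity is the difference of the two
  sides.\<close>

lemma H_tail: assumes "0 \<le> u" shows "1 - H u \<le> exp (- u\<^sup>2/2)"
proof -
  define F where "F w = exp (-u\<^sup>2/2) * H w - (H (u + w) - H u)" for w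
  have d: "(F has_real_derivative 2 * (exp (-u\<^sup>2/2) * phi w - phi (u + w))) (at w)" for w
    unfolding F_def by (auto intro!: derivative_eq_intros simp: algebra_simps)
  have p: "exp (-u\<^sup>2/2) * phi w - phi (u + w) \<ge> 0" if "w \<ge> 0" for w
  proof -
    have "phi (u+w) \<le> (1 / sqrt (2*pi)) * exp (-u\<^sup>2/2 + - w\<^sup>2/2)"
      unfolding std_normal_density_def using assms that
      by (intro mult_left_mono) (auto simp: power2_sum field_simps)
    then show ?thesis by (simp add: std_normal_density_def exp_add[symmetric] exp_diff[symmetric] add_divide_distrib algebra_simps)
  qed
  have F0: "F w \<ge> 0" if "w \<ge> 0" for w
    using DERIV_nonneg_imp_nondecreasing[of 0 w F] that d p by (force simp: F_def)
  have "(F \<longlongrightarrow> exp (-u\<^sup>2/2) * 1 - (1 - H u)) at_top"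
    unfolding F_def
    by (intro tendsto_intros H_tendsto filterlim_compose[OF H_tendsto(1)] filterlim_tendsto_add_at_top[OF tendsto_const filterlim_ident])
  then have "0 \<le> exp (-u\<^sup>2/2) * 1 - (1 - H u)"
    by (rule tendsto_lowerbound) (auto intro!: eventually_mono[OF eventually_ge_at_top[of 0]] F0)
  then show ?thesis by simp
qed

text \<open>The derivative of \<open>H\<close> at 1, hence by concavity a lower bound for
  \<open>H u / u\<close> on (0, 1]. It converts bounds by \<open>1 / sqrt n\<close> into bounds
  relative to \<open>L (x / sqrt n) / sqrt n\<close> when \<open>x\<close> is at most
  \<open>sqrt n\<close> in modulus.\<close>

definition H_slope :: real where "H_slope = 2 * phi 1"

lemma H_slope_pos: "H_slope > 0" by (simp add: H_slope_def normal_density_pos)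

lemma H_lower: assumes "0 \<le> u" "u \<le> 1" shows "H_slope * u \<le> H u"
proof (cases "u = 0")
  case False
  then have "0 < u" using assms by simp
  from MVT2[OF this, of H "\<lambda>u. 2 * phi u"] obtain z where z: "0 < z" "z < u" "H u - H 0 = (u - 0) * (2 * phi z)"
    by (auto intro: DERIV_H)
  have "phi 1 \<le> phi z" unfolding std_normal_density_def
    using z assms by (intro mult_left_mono) (auto simp: abs_square_le_1)
  then show ?thesis using z assms by (simp add: H_slope_def)
qed simp

lemma H_Taylor2: "\<bar>H (u + v) - H u - 2 * phi u * v\<bar> \<le> v\<^sup>2 / 2"
proof -
  define df where "df m w = (if m = 0 then H (u + w) else if m = 1 then 2 * phi (u+w) else - 2 * (u+w) * phi (u+w))" for m :: nat and w
  have "\<forall>m t. m < 2 \<and> \<bar>t\<bar> \<le> \<bar>v\<bar> \<longrightarrow> DERIV (df m) t :> df (Suc m) t"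
    by (auto simp: df_def[abs_def] less_Suc_eq numeral_2_eq_2 intro!: derivative_eq_intros)
  from Maclaurin_bi_le[of df "\<lambda>w. H (u+w)" 2 v, OF _ this] obtain t where
    "H (u+v) = (\<Sum>m<2. df m 0 / fact m * v^m) + df 2 t / fact 2 * v^2"
    by (auto simp: df_def[abs_def])
  then have "H (u+v) - H u - 2 * phi u * v = - (2 * (u+t) * phi (u+t)) * (v\<^sup>2/2)"
    by (simp add: df_def numeral_2_eq_2 field_simps)
  also have "\<bar>\<dots>\<bar> = (2 * \<bar>u+t\<bar> * phi (u+t)) * (v\<^sup>2/2)" by (simp only: abs_minus_cancel abs_mult) simp
  also have "\<dots> \<le> 1 * (v\<^sup>2/2)" by (intro mult_right_mono abs_phi_le_half) auto
  finally show ?thesis by simp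
qed

lemma H_Taylor3: "\<bar>H (u + v) - H u - 2 * phi u * v + u * phi u * v\<^sup>2\<bar> \<le> 32 * \<bar>v\<bar>^3"
proof -
  define df where "df m w = (if m = 0 then H (u + w) else if m = 1 then 2 * phi (u+w)
    else if m = 2 then - 2 * (u+w) * phi (u+w) else 2 * ((u+w)\<^sup>2 - 1) * phi (u+w))" for m :: nat and w
  have "\<forall>m t. m < 3 \<and> \<bar>t\<bar> \<le> \<bar>v\<bar> \<longrightarrow> DERIV (df m) t :> df (Suc m) t"
    by (auto simp: df_def[abs_def] less_Suc_eq numeral_3_eq_3 power2_eq_square algebra_simps intro!: derivative_eq_intros)
  from Maclaurin_bi_le[of df "\<lambda>w. H (u+w)" 3 v, OF _ this] obtain t where
    "H (u+v) = (\<Sum>m<3. df m 0 / fact m * v^m) + df 3 t / fact 3 * v^3"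
    by (auto simp: df_def[abs_def])
  then have e: "H (u+v) - H u - 2 * phi u * v + u * phi u * v\<^sup>2 = (2 * ((u+t)\<^sup>2 - 1) * phi (u+t)) * (v^3/6)"
    by (simp add: df_def numeral_3_eq_3 power2_eq_square)
  have "2 * ((u+t)\<^sup>2 - 1) * phi (u+t) = 2 * (\<bar>u+t\<bar>^2 * phi (u+t) - \<bar>u+t\<bar>^0 * phi (u+t))"
    by (simp add: algebra_simps)
  then have "\<bar>(2 * ((u+t)\<^sup>2 - 1) * phi (u+t))\<bar> = 2 * \<bar>\<bar>u+t\<bar>^2 * phi (u+t) - \<bar>u+t\<bar>^0 * phi (u+t)\<bar>"
    by (simp only: abs_mult)
  also have "\<dots> \<le> 2 * (\<bar>\<bar>u+t\<bar>^2 * phi (u+t)\<bar> + \<bar>\<bar>u+t\<bar>^0 * phi (u+t)\<bar>)"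
    by (intro mult_left_mono abs_triangle_ineq4) auto
  also have "\<dots> \<le> 2 * (8 + 8)" using power_phi_le[of 2 "u+t"] power_phi_le[of 0 "u+t"] by simp
  finally have b: "\<bar>(2 * ((u+t)\<^sup>2 - 1) * phi (u+t))\<bar> \<le> 32" by simp
  have "\<bar>(2 * ((u+t)\<^sup>2 - 1) * phi (u+t)) * (v^3/6)\<bar> = \<bar>(2 * ((u+t)\<^sup>2 - 1) * phi (u+t))\<bar> * (\<bar>v\<bar>^3/6)"
    by (simp add: abs_mult power_abs)
  also have "\<dots> \<le> 32 * (\<bar>v\<bar>^3)" using b by (intro mult_mono) auto
  finally show ?thesis unfolding e .
qed

text \<open>Interpolates between the cubic remainder for small \<open>v\<close> and the quadratic
  one for large \<open>v\<close>, so that a moment of order \<open>2 + b\<close> suffices when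
  \<open>v\<close> is a rescaled step.\<close>

lemma H_Taylor_powr:
  assumes "0 < b" "b \<le> 1"
  shows "\<bar>H (u + v) - H u - 2 * phi u * v + u * phi u * v\<^sup>2\<bar> \<le> 32 * \<bar>v\<bar> powr (2 + b)"
proof (cases "\<bar>v\<bar> \<le> 1")
  case True
  show ?thesis
  proof (cases "v = 0")
    case False
    have "\<bar>v\<bar>^3 = \<bar>v\<bar> powr 3" using False by (simp add: powr_realpow flip: powr_numeral)
    also have "\<dots> \<le> \<bar>v\<bar> powr (2 + b)" using False True assms by (intro powr_mono') auto
    finally show ?thesis using H_Taylor3[of u v] by simp
  qed simp
next
  case False
  have "\<bar>H (u + v) - H u - 2 * phi u * v + u * phi u * v\<^sup>2\<bar> \<le> v\<^sup>2 / 2 + \<bar>u * phi u * v\<^sup>2\<bar>"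
    using H_Taylor2[of u v] by linarith
  also have "\<bar>u * phi u * v\<^sup>2\<bar> = (\<bar>u\<bar>^1 * phi u) * v\<^sup>2" by (simp add: abs_mult)
  also have "\<dots> \<le> 8 * v\<^sup>2" by (intro mult_right_mono power_phi_le) auto
  also have "v\<^sup>2/2 + 8 * v\<^sup>2 \<le> 32 * v\<^sup>2" by simp
  also have "v\<^sup>2 = \<bar>v\<bar> powr 2" using False by (simp add: powr_numeral)
  also have "\<dots> \<le> \<bar>v\<bar> powr (2 + b)" using False assms by (intro powr_mono) auto
  finally show ?thesis by simp
qed

text \<open>The term \<open>r * (u * phi u)\<close> is the quadratic term of
  \<open>H_Taylor3\<close> averaged over a \<open>v\<close> with mean square \<open>r\<close>. This
  is the heat equation for \<open>H (z / sqrt t)\<close>, and it makes the two terms cancel in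
  \<open>lerr_bound\<close>.\<close>

lemma H_time_Taylor:
  assumes "r > 0"
  shows "\<bar>H (u / sqrt (1 + r)) - H u + r * (u * phi u)\<bar> \<le> 16 * r\<^sup>2"
proof -
  define w where "w s = u / sqrt (1 + s)" for s
  have dw: "(w has_real_derivative (- w s / (2 * (1 + s)))) (at s)" if "s \<ge> 0" for s
    unfolding w_def using that
    by (auto intro!: derivative_eq_intros simp: field_simps)
  define df where "df m s = (if m = 0 then H (w s) else if m = 1 then - (w s * phi (w s)) / (1 + s)
    else (3 * w s - w s ^ 3) * phi (w s) / (2 * (1+s)\<^sup>2))" for m :: nat and s
  have "\<forall>m t. m < 2 \<and> 0 \<le> t \<and> t \<le> r \<longrightarrow> DERIV (df m) t :> df (Suc m) t"
  proof (intro allI impI)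
    fix m t assume "m < (2::nat) \<and> 0 \<le> t \<and> t \<le> r"
    then consider "m = 0" "0 \<le> t" | "m = 1" "0 \<le> t" by fastforce
    then show "DERIV (df m) t :> df (Suc m) t"
    proof cases
      case 1
      have "((\<lambda>s. H (w s)) has_real_derivative - (w t * phi (w t)) / (1 + t)) (at t)"
        using 1 by (auto intro!: derivative_eq_intros dw simp: divide_simps)
      with 1 show ?thesis by (simp add: df_def[abs_def])
    next
      case 2
      have "((\<lambda>s. - (w s * phi (w s)) / (1 + s)) has_real_derivative
         ((3 * w t - w t ^ 3) * phi (w t) / (2 * (1+t)\<^sup>2))) (at t)"
        using 2 by (auto intro!: derivative_eq_intros dw)
           (simp add: divide_simps power2_eq_square power3_eq_cube, simp add: algebra_simps)
      with 2 show ?thesis by (simp add: df_def[abs_def])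
    qed
  qed
  from Maclaurin2[of r df "\<lambda>s. H (w s)" 2, OF assms _ this] obtain t where t: "0 < t"
    "H (w r) = (\<Sum>m<2. df m 0 / fact m * r^m) + df 2 t / fact 2 * r^2"
    by (auto simp: df_def[abs_def])
  have w0: "w 0 = u" by (simp add: w_def)
  have e: "H (w r) - H u + r * (u * phi u) = df 2 t / 2 * r\<^sup>2"
    using t(2) by (simp add: df_def w0 numeral_2_eq_2)
  have "\<bar>(3 * w t - w t ^ 3) * phi (w t)\<bar> = \<bar>3 * (w t * phi (w t)) - w t ^ 3 * phi (w t)\<bar>" by (simp add: algebra_simps)
  also have "\<dots> \<le> 3 * \<bar>w t * phi (w t)\<bar> + \<bar>w t ^ 3 * phi (w t)\<bar>" by linarith
  also have "\<dots> \<le> 3 * 8 + 8" using power_phi_le[of 1 "w t"] power_phi_le[of 3 "w t"]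
    by (simp add: abs_mult power_abs)
  finally have 1: "\<bar>(3 * w t - w t ^ 3) * phi (w t)\<bar> \<le> 32" by simp
  have 2: "1 \<le> (1+t)\<^sup>2" using t by (simp add: one_le_power)
  have "\<bar>df 2 t\<bar> = \<bar>(3 * w t - w t ^ 3) * phi (w t)\<bar> / (2 * (1+t)\<^sup>2)"
    by (simp add: df_def)
  also have "\<dots> \<le> 32 / (2 * 1)" using 1 2 by (intro frac_le) auto
  finally have "\<bar>df 2 t\<bar> \<le> 16" by simp
  then have "\<bar>df 2 t / 2 * r\<^sup>2\<bar> \<le> 16 * r\<^sup>2" unfolding abs_mult by (intro mult_mono) auto
  then show ?thesis using e by (simp add: w_def)
qed

section \<open>Bounds and Lipschitz continuity of the ratio \<open>L\<close>\<close>

lemma L_mult: "L u * u = H u" by (simp add: L_def)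

lemma L_minus: "L (- u) = L u" by (simp add: L_def H_minus)

lemma L_abs: "L \<bar>u\<bar> = L u" using L_minus[of u] by (simp add: abs_if)

lemma L_0: "L 0 = 2 * phi 0" by (simp add: L_def std_normal_density_def)

lemma L_nonneg: "0 \<le> L u"
proof -
  have "0 \<le> L \<bar>u\<bar>" unfolding L_def using H_nonneg[of "\<bar>u\<bar>"] by simp
  then show ?thesis by (simp add: L_abs)
qed

lemma L_le_1: "L u \<le> 1"
proof (cases "u = 0")
  case True then show ?thesis using phi_le_half[of 0] by (simp add: L_0)
next
  case False
  have "L \<bar>u\<bar> = H \<bar>u\<bar> / \<bar>u\<bar>" using False by (simp add: L_def)
  also have "\<dots> \<le> 1" using H_Lipschitz[of "\<bar>u\<bar>" 0] False H_nonneg[of "\<bar>u\<bar>"] by simp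
  finally show ?thesis by (simp add: L_abs)
qed

lemma L_abs_mult_le_1: "L u * \<bar>u\<bar> \<le> 1"
  using L_mult[of "\<bar>u\<bar>"] H_bounds(1)[of "\<bar>u\<bar>"] by (simp add: L_abs)

lemma L_lower: "\<bar>u\<bar> \<le> 1 \<Longrightarrow> H_slope \<le> L u"
proof (cases "u = 0")
  case True
  have "phi 1 \<le> phi 0" unfolding std_normal_density_def by (intro mult_left_mono) auto
  then show ?thesis using True by (simp add: L_0 H_slope_def)
next
  case False
  assume "\<bar>u\<bar> \<le> 1"
  then have "H_slope \<le> H \<bar>u\<bar> / \<bar>u\<bar>" using False H_lower[of "\<bar>u\<bar>"] by (simp add: field_simps)
  also have "\<dots> = L \<bar>u\<bar>" using False by (simp add: L_def)
  finally show ?thesis by (simp add: L_abs)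
qed

lemma L_Lipschitz_0: "\<bar>L u - L 0\<bar> \<le> \<bar>u\<bar>"
proof (cases "u = 0")
  case False
  have "\<bar>H u - 2 * phi 0 * u\<bar> \<le> u\<^sup>2 / 2" using H_Taylor2[of 0 u] by simp
  also have "H u - 2 * phi 0 * u = (L u - L 0) * u" using L_mult[of u] by (simp add: algebra_simps L_0)
  finally have "\<bar>L u - L 0\<bar> * \<bar>u\<bar> \<le> \<bar>u\<bar>/2 * \<bar>u\<bar>" by (simp add: abs_mult power2_eq_square)
  then have "\<bar>L u - L 0\<bar> \<le> \<bar>u\<bar>/2" using False by (simp only: mult_le_cancel_right)
  then show ?thesis using abs_ge_zero[of u] by linarith
qed simp

lemma L_Lipschitz_pos: assumes "0 < u" "u \<le> v" shows "\<bar>L v - L u\<bar> \<le> v - u"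
proof -
  have d: "(L has_real_derivative (2 * phi w * w - H w) / w\<^sup>2) (at w)" if "w > 0" for w
  proof -
    have "((\<lambda>w. H w / w) has_real_derivative (2 * phi w * w - H w) / w\<^sup>2) (at w)"
      using that by (auto intro!: derivative_eq_intros simp: power2_eq_square)
    then show ?thesis
      by (rule has_field_derivative_transform_within_open[where S="{0<..}"]) (use that in \<open>auto simp: L_def\<close>)
  qed
  have b: "\<bar>(2 * phi w * w - H w) / w\<^sup>2\<bar> \<le> 1" if "w > 0" for w
  proof -
    \<comment> \<open>A Taylor step from \<open>w\<close> by \<open>-w\<close> lands on
      \<open>H 0 = 0\<close>. So the numerator of the derivative of \<open>L\<close> is itself a
      remainder of size \<open>w^2 / 2\<close>, uniformly down to 0.\<close>
    have "\<bar>H (w + -w) - H w - 2 * phi w * (-w)\<bar> \<le> (-w)\<^sup>2/2" by (rule H_Taylor2)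
    then have "\<bar>2 * phi w * w - H w\<bar> \<le> w\<^sup>2/2" by (simp only: add.right_inverse H_0) (simp add: algebra_simps)
    also have "\<dots> \<le> 1 * w\<^sup>2" by simp
    finally have "\<bar>2 * phi w * w - H w\<bar> \<le> 1 * w\<^sup>2" .
    then show ?thesis using that unfolding abs_divide by (subst pos_divide_le_eq) auto
  qed
  have "norm (L v - L u) \<le> 1 * norm (v - u)"
  proof (rule field_differentiable_bound[of "{u..v}" L "\<lambda>w. (2 * phi w * w - H w) / w\<^sup>2"])
    fix w assume "w \<in> {u..v}"
    then have "w > 0" using assms by simp
    from d[OF this] b[OF this]
    show "(L has_real_derivative (2 * phi w * w - H w) / w\<^sup>2) (at w within {u..v})"
      "norm ((2 * phi w * w - H w) / w\<^sup>2) \<le> 1"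
      by (auto intro: has_field_derivative_at_within simp del: times_divide_eq_left)
  qed (use assms in auto)
  then show ?thesis using assms by simp
qed

lemma L_Lipschitz: "\<bar>L u - L v\<bar> \<le> \<bar>u - v\<bar>"
proof -
  have *: "\<bar>L b - L a\<bar> \<le> b - a" if "0 \<le> a" "a \<le> b" for a b
    using L_Lipschitz_pos[of a b] L_Lipschitz_0[of b] that by (cases "a = 0") auto
  have "\<bar>(L \<bar>u\<bar>) - (L \<bar>v\<bar>)\<bar> \<le> \<bar>\<bar>u\<bar> - \<bar>v\<bar>\<bar>"
    using *[of "\<bar>u\<bar>" "\<bar>v\<bar>"] *[of "\<bar>v\<bar>" "\<bar>u\<bar>"] by (cases "\<bar>u\<bar> \<le> \<bar>v\<bar>") (auto simp: abs_minus_commute)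
  then show ?thesis unfolding L_abs using abs_triangle_ineq3[of u v] by (rule order_trans)
qed

subsection \<open>Killed walk operators\<close>

text \<open>A first moment of the step law makes all these functions integrable, and the one-step
  operators preserve the class. Integrability and measurability thus reduce to closure
  rules.\<close>

definition lin_growth :: "(real \<Rightarrow> real) \<Rightarrow> bool" where
  "lin_growth f \<longleftrightarrow> f \<in> borel_measurable borel \<and> (\<exists>C. \<forall>z. \<bar>f z\<bar> \<le> C * (1 + \<bar>z\<bar>))"

lemma lin_meas [measurable_dest]: "lin_growth f \<Longrightarrow> f \<in> borel_measurable borel"
  by (simp add: lin_growth_def)

lemma lin_growthE: assumes "lin_growth f" obtains C where "C \<ge> 0" "\<And>z. \<bar>f z\<bar> \<le> C * (1 + \<bar>z\<bar>)"
proof -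
  obtain C where C: "\<And>z. \<bar>f z\<bar> \<le> C * (1 + \<bar>z\<bar>)" using assms by (auto simp: lin_growth_def)
  from C[of 0] have "C \<ge> 0" by simp
  with C that show ?thesis by blast
qed

lemma lin_growthI: "f \<in> borel_measurable borel \<Longrightarrow> (\<And>z. \<bar>f z\<bar> \<le> C * (1 + \<bar>z\<bar>)) \<Longrightarrow> lin_growth f"
  by (auto simp: lin_growth_def)

lemma lin_bdd: "f \<in> borel_measurable borel \<Longrightarrow> (\<And>z. \<bar>f z\<bar> \<le> C) \<Longrightarrow> lin_growth f"
proof (rule lin_growthI[where C=C])
  fix z assume b: "(\<And>z. \<bar>f z\<bar> \<le> C)"
  from b[of z] have "C \<ge> 0" by linarith
  then have "C * 1 \<le> C * (1 + \<bar>z\<bar>)" by (intro mult_left_mono) auto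
  with b[of z] show "\<bar>f z\<bar> \<le> C * (1 + \<bar>z\<bar>)" by linarith
qed

lemma lin_const [simp, intro]: "lin_growth (\<lambda>_. c)"
  by (rule lin_bdd[where C="\<bar>c\<bar>"]) auto

lemma lin_id [simp, intro]: "lin_growth (\<lambda>z. z)"
  by (rule lin_growthI[where C=1]) auto

lemma lin_add [intro]: assumes "lin_growth f" "lin_growth g" shows "lin_growth (\<lambda>z. f z + g z)"
proof -
  obtain C where C: "\<And>z. \<bar>f z\<bar> \<le> C * (1 + \<bar>z\<bar>)" using lin_growthE assms(1) by metis
  obtain D where D: "\<And>z. \<bar>g z\<bar> \<le> D * (1 + \<bar>z\<bar>)" using lin_growthE assms(2) by metis
  show ?thesis
  proof (rule lin_growthI[where C="C+D"])
    show "(\<lambda>z. f z + g z) \<in> borel_measurable borel" using assms by measurable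
    fix z show "\<bar>f z + g z\<bar> \<le> (C+D) * (1 + \<bar>z\<bar>)" using C[of z] D[of z] by (simp add: algebra_simps)
  qed
qed

lemma lin_dom: assumes "lin_growth g" "f \<in> borel_measurable borel" "\<And>z. \<bar>f z\<bar> \<le> \<bar>g z\<bar>" shows "lin_growth f"
proof -
  obtain C where C: "\<And>z. \<bar>g z\<bar> \<le> C * (1 + \<bar>z\<bar>)" using lin_growthE assms(1) by metis
  show ?thesis by (rule lin_growthI[where C=C]) (use C assms order_trans in blast)+
qed

lemma lin_cmult [intro]: assumes "lin_growth f" shows "lin_growth (\<lambda>z. c * f z)"
proof -
  obtain C where C: "\<And>z. \<bar>f z\<bar> \<le> C * (1 + \<bar>z\<bar>)" using lin_growthE assms(1) by metis
  show ?thesis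
  proof (rule lin_growthI[where C="\<bar>c\<bar> * C"])
    show "(\<lambda>z. c * f z) \<in> borel_measurable borel" using assms by measurable
    fix z show "\<bar>c * f z\<bar> \<le> \<bar>c\<bar> * C * (1 + \<bar>z\<bar>)"
      using mult_left_mono[OF C[of z], of "\<bar>c\<bar>"] by (simp add: abs_mult mult.assoc)
  qed
qed

lemma lin_multc [intro]: "lin_growth f \<Longrightarrow> lin_growth (\<lambda>z. f z * c)"
  using lin_cmult[of f c] by (simp add: mult.commute)

lemma lin_minus [intro]: "lin_growth f \<Longrightarrow> lin_growth (\<lambda>z. - f z)"
  using lin_cmult[of f "-1"] by simp

lemma lin_diff [intro]: "lin_growth f \<Longrightarrow> lin_growth g \<Longrightarrow> lin_growth (\<lambda>z. f z - g z)"
  using lin_add[OF _ lin_minus, of f g] by simp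

lemma lin_sum [intro]: "(\<And>i. i \<in> I \<Longrightarrow> lin_growth (f i)) \<Longrightarrow> lin_growth (\<lambda>z. \<Sum>i\<in>I. f i z)"
  by (induction I rule: infinite_finite_induct) auto

lemma lin_abs [intro]: "lin_growth f \<Longrightarrow> lin_growth (\<lambda>z. \<bar>f z\<bar>)"
  by (rule lin_dom[of f]) auto

lemma lin_ind [intro]: "lin_growth f \<Longrightarrow> S \<in> sets borel \<Longrightarrow> lin_growth (\<lambda>z. indicator S z * f z)"
  by (rule lin_dom[of f]) (auto simp: indicator_def)

lemma lin_max_id [simp, intro]: "lin_growth (\<lambda>z. max z 0)" "lin_growth (\<lambda>z. max 0 (-z))"
  by (rule lin_dom[of "\<lambda>z. z"]; auto)+

locale centered_law = real_distribution M for M :: "real measure" +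
  assumes int1: "integrable M (\<lambda>x. x)" and mean0: "(\<integral>x. x \<partial>M) = 0"
begin

text \<open>With \<open>\<tau>\<close> the exit time from \<open>z + S\<^sub>k \<ge> 0\<close>: \<open>(Q ^^ n) f z = E(f(z + S\<^sub>n); \<tau> > n)\<close>, \<open>p n z = P(\<tau> > n)\<close>,
  \<open>G\<close> is the mean overshoot in one step and \<open>e n z\<close> the mean overshoot on \<open>\<tau> \<le> n\<close>.\<close>

definition T :: "(real \<Rightarrow> real) \<Rightarrow> real \<Rightarrow> real" where
  "T f z = (\<integral>y. f (z + y) \<partial>M)"

definition Q :: "(real \<Rightarrow> real) \<Rightarrow> real \<Rightarrow> real" where
  "Q f = T (\<lambda>y. indicator {0..} y * f y)"

abbreviation p :: "nat \<Rightarrow> real \<Rightarrow> real" where "p n \<equiv> (Q ^^ n) (\<lambda>_. 1)"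

definition G :: "real \<Rightarrow> real" where "G = T (\<lambda>z. max 0 (- z))"

definition e :: "nat \<Rightarrow> real \<Rightarrow> real" where "e n x = (\<Sum>k<n. (Q ^^ k) G x)"

lemma int_abs [simp]: "integrable M (\<lambda>x. \<bar>x\<bar>)" using int1 by simp

lemma borel_M [measurable_cong]: "sets M = sets borel" by simp

lemma lin_integrable: assumes "lin_growth f" shows "integrable M (\<lambda>y. f (z + y))"
proof -
  obtain C where C: "C \<ge> 0" "\<And>z. \<bar>f z\<bar> \<le> C * (1 + \<bar>z\<bar>)" using lin_growthE assms(1) by metis
  show ?thesis
  proof (rule Bochner_Integration.integrable_bound)
    show "integrable M (\<lambda>y. C * (1 + \<bar>z\<bar> + \<bar>y\<bar>))" by simp
    have [measurable]: "f \<in> borel_measurable borel" using assms by (rule lin_meas)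
    show "(\<lambda>y. f (z + y)) \<in> borel_measurable M" by measurable
    have "\<bar>f (z+y)\<bar> \<le> C * (1 + \<bar>z\<bar> + \<bar>y\<bar>)" for y
      using C(2)[of "z+y"] mult_left_mono[of "1 + \<bar>z+y\<bar>" "1 + \<bar>z\<bar> + \<bar>y\<bar>" C] C(1)
      by linarith
    then show "AE y in M. norm (f (z + y)) \<le> norm (C * (1 + \<bar>z\<bar> + \<bar>y\<bar>))"
      by (auto intro!: AE_I2 order_trans[OF _ abs_ge_self])
  qed
qed

lemma lin_T [simp, intro]: assumes "lin_growth f" shows "lin_growth (T f)"
proof -
  obtain C where C: "C \<ge> 0" "\<And>z. \<bar>f z\<bar> \<le> C * (1 + \<bar>z\<bar>)" using lin_growthE assms(1) by metis
  show ?thesis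
  proof (rule lin_growthI[where C="C * (1 + (\<integral>y. \<bar>y\<bar> \<partial>M))"])
    have [measurable]: "f \<in> borel_measurable borel" using assms by (rule lin_meas)
    show "T f \<in> borel_measurable borel"
      unfolding T_def[abs_def] by measurable
    fix z
    have "\<bar>T f z\<bar> \<le> (\<integral>y. C * (1 + \<bar>z\<bar> + \<bar>y\<bar>) \<partial>M)"
      unfolding T_def real_norm_def[symmetric]
    proof (rule order_trans[OF integral_norm_bound], intro integral_mono)
      show "integrable M (\<lambda>y. norm (f (z + y)))" by (intro integrable_norm lin_integrable assms)
      show "norm (f (z+y)) \<le> C * (1 + norm z + norm y)" for y
      proof -
        have "C * (1 + \<bar>z+y\<bar>) \<le> C * (1 + \<bar>z\<bar> + \<bar>y\<bar>)"
          using C(1) abs_triangle_ineq[of z y] by (intro mult_left_mono) auto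
        then show ?thesis using C(2)[of "z+y"] by simp
      qed
    qed simp
    also have "\<dots> = C * (1 + \<bar>z\<bar> + (\<integral>y. \<bar>y\<bar> \<partial>M))" using prob_space by simp
    also have "\<dots> \<le> C * ((1 + (\<integral>y. \<bar>y\<bar> \<partial>M)) * (1 + \<bar>z\<bar>))"
      using C(1) by (intro mult_left_mono) (auto simp: algebra_simps)
    finally show "\<bar>T f z\<bar> \<le> C * (1 + (\<integral>y. \<bar>y\<bar> \<partial>M)) * (1 + \<bar>z\<bar>)" by (simp add: mult.assoc)
  qed
qed

lemma T_add: "lin_growth f \<Longrightarrow> lin_growth g \<Longrightarrow> T (\<lambda>z. f z + g z) x = T f x + T g x"
  unfolding T_def by (intro Bochner_Integration.integral_add lin_integrable)

lemma T_cmult: "T (\<lambda>z. c * f z) x = c * T f x"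
  unfolding T_def by simp

lemma T_const: "T (\<lambda>z. c) x = c"
  unfolding T_def using prob_space by simp

lemma T_mono: "lin_growth f \<Longrightarrow> lin_growth g \<Longrightarrow> (\<And>z. f z \<le> g z) \<Longrightarrow> T f x \<le> T g x"
  unfolding T_def by (intro integral_mono lin_integrable)

lemma T_id: "T (\<lambda>z. z) x = x"
  unfolding T_def using int1 mean0 prob_space by simp

lemma lin_Q [simp, intro]: "lin_growth f \<Longrightarrow> lin_growth (Q f)"
  unfolding Q_def by (intro lin_T lin_ind) auto

lemma Q_add: "lin_growth f \<Longrightarrow> lin_growth g \<Longrightarrow> Q (\<lambda>z. f z + g z) = (\<lambda>x. Q f x + Q g x)"
  unfolding Q_def by (simp add: distrib_left T_add lin_ind fun_eq_iff)

lemma Q_cmult: "Q (\<lambda>z. c * f z) = (\<lambda>x. c * Q f x)"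
  unfolding Q_def by (subst T_cmult[symmetric]) (simp add: ac_simps)

lemma Q_mono: "lin_growth f \<Longrightarrow> lin_growth g \<Longrightarrow> (\<And>z. z \<ge> 0 \<Longrightarrow> f z \<le> g z) \<Longrightarrow> Q f x \<le> Q g x"
  unfolding Q_def by (intro T_mono lin_ind) (auto simp: indicator_def)

lemma Q_le_T: "lin_growth f \<Longrightarrow> (\<And>z. f z \<ge> 0) \<Longrightarrow> Q f x \<le> T f x"
  unfolding Q_def by (intro T_mono lin_ind) (auto simp: indicator_def)

lemma lin_Qn [simp, intro]: "lin_growth f \<Longrightarrow> lin_growth ((Q ^^ n) f)"
  by (induction n) auto

lemma lin_Tn [simp, intro]: "lin_growth f \<Longrightarrow> lin_growth ((T ^^ n) f)"
  by (induction n) auto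

lemma Qn_add: "lin_growth f \<Longrightarrow> lin_growth g \<Longrightarrow> (Q ^^ n) (\<lambda>z. f z + g z) = (\<lambda>x. (Q ^^ n) f x + (Q ^^ n) g x)"
  by (induction n) (simp_all add: Q_add)

lemma Qn_cmult: "(Q ^^ n) (\<lambda>z. c * f z) = (\<lambda>x. c * (Q ^^ n) f x)"
  by (induction n) (simp_all add: Q_cmult)

lemma Qn_minus: "(Q ^^ n) (\<lambda>z. - f z) = (\<lambda>x. - (Q ^^ n) f x)"
  using Qn_cmult[of n "-1" f] by simp

lemma Qn_diff: "lin_growth f \<Longrightarrow> lin_growth g \<Longrightarrow> (Q ^^ n) (\<lambda>z. f z - g z) = (\<lambda>x. (Q ^^ n) f x - (Q ^^ n) g x)"
  using Qn_add[of f "\<lambda>z. - g z" n] by (simp add: Qn_minus lin_minus)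

lemma Qn_0: "(Q ^^ n) (\<lambda>_. 0) = (\<lambda>_. 0)"
  using Qn_cmult[of n 0 "\<lambda>_. 0"] by simp

lemma Qn_sum: "(\<And>i. i \<in> I \<Longrightarrow> lin_growth (f i)) \<Longrightarrow>
    (Q ^^ n) (\<lambda>z. \<Sum>i\<in>I. f i z) = (\<lambda>x. \<Sum>i\<in>I. (Q ^^ n) (f i) x)"
  by (induction I rule: infinite_finite_induct) (simp_all add: Qn_0 Qn_add lin_sum)

text \<open>\<open>Q\<close> reads its argument on the half-line only, so the comparison is asked
  for there. The start must lie there too because \<open>n = 0\<close> compares \<open>f x\<close>
  with \<open>g x\<close>.\<close>

lemma Qn_mono: "lin_growth f \<Longrightarrow> lin_growth g \<Longrightarrow> (\<And>z. z \<ge> 0 \<Longrightarrow> f z \<le> g z) \<Longrightarrow> x \<ge> 0 \<Longrightarrow>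
    (Q ^^ n) f x \<le> (Q ^^ n) g x"
proof (induction n arbitrary: x)
  case (Suc n)
  have "Q ((Q ^^ n) f) x \<le> Q ((Q ^^ n) g) x" using Suc by (intro Q_mono) auto
  then show ?case by simp
qed simp

lemma Qn_nonneg: "lin_growth f \<Longrightarrow> (\<And>z. z \<ge> 0 \<Longrightarrow> 0 \<le> f z) \<Longrightarrow> x \<ge> 0 \<Longrightarrow> 0 \<le> (Q ^^ n) f x"
  using Qn_mono[of "\<lambda>_. 0" f x n] by (simp add: Qn_0)

lemma Q_nonneg: "lin_growth f \<Longrightarrow> (\<And>z. z \<ge> 0 \<Longrightarrow> 0 \<le> f z) \<Longrightarrow> 0 \<le> Q f x"
  using Q_mono[of "\<lambda>_. 0" f x] Qn_0[of 1] by simp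

lemma Qn_abs: assumes "lin_growth f" "lin_growth g" "\<And>z. z \<ge> 0 \<Longrightarrow> \<bar>f z\<bar> \<le> g z" "x \<ge> 0"
  shows "\<bar>(Q ^^ n) f x\<bar> \<le> (Q ^^ n) g x"
proof -
  have "(Q ^^ n) f x \<le> (Q ^^ n) g x" "(Q ^^ n) (\<lambda>z. - f z) x \<le> (Q ^^ n) g x"
    using assms by (intro Qn_mono lin_minus; force)+
  then show ?thesis by (simp add: Qn_minus)
qed

lemma Qn_const: "(Q ^^ n) (\<lambda>_. c) x = c * p n x"
  using Qn_cmult[of n c "\<lambda>_. 1"] by simp

lemma Qn_Suc: "(Q ^^ Suc n) f = (Q ^^ n) (Q f)"
  by (simp add: funpow_swap1)

lemma Qn_plus: "(Q ^^ (m + n)) f = (Q ^^ m) ((Q ^^ n) f)"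
  by (simp add: funpow_add)

lemma p_nonneg: "x \<ge> 0 \<Longrightarrow> 0 \<le> p n x"
  by (rule Qn_nonneg) auto

lemma p_le_1: "p n x \<le> 1"
proof (induction n arbitrary: x)
  case (Suc n)
  have "Q (p n) x \<le> Q (\<lambda>_. 1) x" using Suc by (intro Q_mono) auto
  also have "\<dots> \<le> T (\<lambda>_. 1) x" by (intro Q_le_T) auto
  finally show ?case by (simp add: T_const)
qed simp

lemma p_ge_0: "0 \<le> p n x"
  by (cases n) (auto intro!: Q_nonneg p_nonneg)

lemma lin_G [simp, intro]: "lin_growth G" unfolding G_def by auto

lemma G_nonneg: "0 \<le> G z" unfolding G_def T_def by (intro Bochner_Integration.integral_nonneg) auto

lemma lin_e [simp, intro]: "lin_growth (e n)" unfolding e_def[abs_def] by auto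

lemma e_0 [simp]: "e 0 x = 0" by (simp add: e_def)

lemma e_Suc: "e (Suc n) x = Q (e n) x + G x"
proof -
  have "Q (e n) x = (\<Sum>k<n. Q ((Q ^^ k) G) x)"
    using Qn_sum[of "{..<n}" "\<lambda>k. (Q ^^ k) G" 1] unfolding e_def[abs_def] by (simp add: fun_eq_iff)
  then show ?thesis by (simp add: e_def sum.lessThan_Suc_shift del: sum.lessThan_Suc)
qed

text \<open>Markov property at time \<open>m\<close>: both sides are the mean overshoot of the exits
  in the steps \<open>m + 1\<close> to \<open>m + n\<close>.\<close>

lemma Qn_e: "(Q ^^ m) (e n) x = e (m + n) x - e m x"
proof -
  have "(Q ^^ m) (e n) x = (\<Sum>k<n. (Q ^^ (m + k)) G x)"
    unfolding e_def[abs_def] by (subst Qn_sum) (auto simp: Qn_plus)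
  also have "\<dots> = (\<Sum>k\<in>{m..<m+n}. (Q ^^ k) G x)"
    by (rule sum.reindex_bij_witness[of _ "\<lambda>k. k - m" "\<lambda>k. m + k"]) auto
  also have "\<dots> = e (m + n) x - e m x"
    unfolding e_def using sum.atLeastLessThan_concat[of 0 m "m+n" "\<lambda>k. (Q ^^ k) G x"]
    by (simp add: atLeast0LessThan)
  finally show ?thesis .
qed

lemma QnG_nonneg: "0 \<le> (Q ^^ n) G x"
  by (cases n) (auto intro!: Q_nonneg Qn_nonneg simp: G_nonneg)

lemma e_nonneg: "0 \<le> e n x" unfolding e_def by (intro sum_nonneg QnG_nonneg)

lemma e_mono: "m \<le> n \<Longrightarrow> e m x \<le> e n x"
  unfolding e_def by (intro sum_mono2 QnG_nonneg) auto

lemma Q_id: "Q (\<lambda>z. z) x = x + G x"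
proof -
  have "Q (\<lambda>z. z) x = T (\<lambda>z. z + max 0 (-z)) x"
    unfolding Q_def by (intro arg_cong2[where f=T] ext) (auto simp: indicator_def)
  also have "\<dots> = x + G x" by (subst T_add) (auto simp: T_id G_def)
  finally show ?thesis .
qed

text \<open>Optional stopping in operator form. A step is centred, and killing replaces a negative
  position by 0, which raises the mean by the overshoot.\<close>

lemma Qn_id: "(Q ^^ n) (\<lambda>z. z) x = x + e n x"
proof (induction n arbitrary: x)
  case (Suc n)
  have "(Q ^^ Suc n) (\<lambda>z. z) x = Q (\<lambda>z. z + e n z) x" by (simp add: Suc.IH[abs_def])
  also have "\<dots> = x + G x + Q (e n) x" by (subst Q_add) (auto simp: Q_id)
  finally show ?case by (simp add: e_Suc)
qed simp

end

subsection \<open>Positive association and the mean overshoot\<close>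

context centered_law
begin

lemma prob_UNIV [simp]: "prob UNIV = 1"
  using prob_space by simp

lemma integrable_ind [simp]: "integrable M (\<lambda>y. indicator {..a} y :: real)"
  by (rule integrable_const_bound[where B=1]) auto

text \<open>As \<open>a\<close> and \<open>b\<close> increase together,
  \<open>(a y - A) * (b y - T b z)\<close> is nonnegative for a suitable constant \<open>A\<close>.
  Integration removes \<open>A\<close>, since \<open>b - T b z\<close> has mean zero.\<close>

lemma Chebyshev_association:
  assumes "lin_growth b" "mono b" "mono a" "a \<in> borel_measurable borel" and a01: "\<And>y. 0 \<le> a y \<and> a y \<le> 1"
  shows "T a z * T b z \<le> T (\<lambda>y. a y * b y) z"
proof -
  define c where "c = T b z"
  define S where "S = {a y | y. b y > c}"
  have la: "lin_growth a" by (rule lin_bdd[where C=1]) (use assms in auto)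
  have lab: "lin_growth (\<lambda>y. a y * b y)"
  proof (rule lin_dom[OF \<open>lin_growth b\<close>])
    show "\<bar>a y * b y\<bar> \<le> \<bar>b y\<bar>" for y
      unfolding abs_mult using a01[of y] mult_right_mono[of "\<bar>a y\<bar>" 1 "\<bar>b y\<bar>"] by auto
    show "(\<lambda>y. a y * b y) \<in> borel_measurable borel"
      using assms(4) lin_meas[OF assms(1)] by simp
  qed
  \<comment> \<open>Any value separating \<open>a\<close> where \<open>b\<close> is above its mean
    from \<open>a\<close> where it is not. If \<open>b\<close> never exceeds its mean, the upper
    bound 1 of \<open>a\<close> serves.\<close>
  define A where "A = (if S = {} then 1 else Inf S)"
  have bdd: "bdd_below S" unfolding S_def using a01 by (auto intro: bdd_belowI[of _ 0])
  have key: "a y * (b y - c) \<ge> A * (b y - c)" for y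
  proof (cases "b y > c")
    case True
    then have "a y \<in> S" by (auto simp: S_def)
    then have "A \<le> a y" unfolding A_def using bdd by (auto intro: cInf_lower)
    then show ?thesis using True by (intro mult_right_mono) auto
  next
    case False
    have "a y \<le> A"
    proof (cases "S = {}")
      case True then show ?thesis using a01 by (simp add: A_def)
    next
      case ne: False
      have "a y \<le> v" if "v \<in> S" for v
      proof -
        from that obtain y' where y': "v = a y'" "b y' > c" by (auto simp: S_def)
        then have "y \<le> y'" using False \<open>mono b\<close> by (meson linorder_le_cases monoD not_le order_trans)
        then show ?thesis using y' \<open>mono a\<close> by (auto dest: monoD)
      qed
      then show ?thesis using ne by (simp add: A_def cInf_greatest)
    qed
    then show ?thesis using False by (intro mult_right_mono_neg) auto
  qed
  have "T (\<lambda>y. A * (b y - c)) z \<le> T (\<lambda>y. a y * (b y - c)) z"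
  proof (rule T_mono)
    show "lin_growth (\<lambda>y. a y * (b y - c))" using lin_diff[OF lab lin_multc[OF la, of c]] by (simp add: algebra_simps)
      show "lin_growth (\<lambda>y. A * (b y - c))" by (intro lin_cmult lin_diff lin_const assms(1))
  qed (rule key)
  moreover have "T (\<lambda>y. A * (b y - c)) z = A * (T b z - c)"
    using T_add[OF \<open>lin_growth b\<close> lin_const[of "-c"], of z] by (simp add: T_cmult T_const)
  moreover have "T (\<lambda>y. a y * (b y - c)) z = T (\<lambda>y. a y * b y) z - T a z * c"
    using T_add[OF lab lin_multc[OF la, of "-c"], of z] T_cmult[of "-c" a z] by (simp add: algebra_simps)
  ultimately show ?thesis by (simp add: c_def)
qed

lemma mono_T: "lin_growth f \<Longrightarrow> mono f \<Longrightarrow> mono (T f)"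
  by (rule monoI, unfold T_def, rule integral_mono) (auto intro: lin_integrable monoD)

text \<open>Nonnegativity makes the cut at 0 a jump upwards, so the truncated function is still
  increasing.\<close>

lemma mono_Q: "lin_growth f \<Longrightarrow> mono f \<Longrightarrow> (\<And>z. 0 \<le> f z) \<Longrightarrow> mono (Q f)"
  unfolding Q_def by (intro mono_T lin_ind monoI) (auto dest: monoD simp: indicator_def)

lemma mono_p: "mono (p n)"
  proof (induction n)
  case (Suc n)
  then show ?case using mono_Q[of "p n"] p_ge_0 by simp
qed (simp add: mono_def)

lemma mono_Tn: "lin_growth f \<Longrightarrow> mono f \<Longrightarrow> mono ((T ^^ n) f)"
  by (induction n) (auto intro!: mono_T)

text \<open>An FKG inequality: staying nonnegative and ending high are positively correlated.\<close>

lemma Qn_association: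
  assumes "lin_growth f" "mono f"
  shows "p n x * (T ^^ n) f x \<le> (Q ^^ n) f x"
proof (induction n arbitrary: x)
  case (Suc n)
  \<comment> \<open>Seen from the first position \<open>y\<close>: \<open>a\<close> is the
    probability that \<open>y\<close> and the next \<open>n\<close> positions are nonnegative, and
    \<open>b\<close> is the free expectation after \<open>n\<close> more steps. Both increase in
    \<open>y\<close>.\<close>
  define a where "a y = indicator {0..} y * p n y" for y :: real
  define b where "b = (T ^^ n) f"
  have l: "lin_growth b" unfolding b_def using assms by auto
  have "mono a"
  proof (rule monoI)
    fix u v :: real assume "u \<le> v"
    then show "a u \<le> a v" unfolding a_def using monoD[OF mono_p, of u v n] p_ge_0 by (auto simp: indicator_def)
  qed
  have "T a x * T b x \<le> T (\<lambda>y. a y * b y) x"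
  proof (rule Chebyshev_association[OF l _ \<open>mono a\<close>])
    show "mono b" unfolding b_def by (intro mono_Tn assms)
    show "a \<in> borel_measurable borel" unfolding a_def[abs_def] by (intro lin_meas lin_ind) auto
    show "0 \<le> a y \<and> a y \<le> 1" for y using p_ge_0[of n y] p_le_1[of n y] by (auto simp: a_def indicator_def)
  qed
  also have "T a x = p (Suc n) x" by (simp add: a_def[abs_def] Q_def)
  also have "T b x = (T ^^ Suc n) f x" by (simp add: b_def)
  also have "T (\<lambda>y. a y * b y) x = Q (\<lambda>y. p n y * b y) x" unfolding Q_def a_def by (simp add: mult.assoc)
  also have "\<dots> \<le> Q ((Q ^^ n) f) x"
  proof (rule Q_mono)
    show "lin_growth (\<lambda>y. p n y * b y)"
    proof (rule lin_dom[OF l])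
      show "\<bar>p n y * b y\<bar> \<le> \<bar>b y\<bar>" for y
        unfolding abs_mult using p_ge_0[of n y] p_le_1[of n y] mult_right_mono[of "\<bar>p n y\<bar>" 1 "\<bar>b y\<bar>"] by auto
      have "p n \<in> borel_measurable borel" "b \<in> borel_measurable borel" using l lin_Qn[OF lin_const] lin_meas by blast+
      then show "(\<lambda>y. p n y * b y) \<in> borel_measurable borel" by simp
    qed
  next
    fix z :: real assume "0 \<le> z"
    then show "p n z * b z \<le> (Q ^^ n) f z" using Suc.IH[of z] by (auto simp: b_def)
  qed (use assms in auto)
  finally show ?case by simp
qed simp

end

section \<open>Exponents, non-degeneracy of the step law and the one-step overshoot\<close>

locale walk_law = centered_law +
  fixes \<delta> :: real
  assumes int2: "integrable M (\<lambda>x. x\<^sup>2)" and var1: "(\<integral>x. x\<^sup>2 \<partial>M) = 1"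
    and delta_pos: "\<delta> > 0" and int_delta: "integrable M (\<lambda>x. \<bar>x\<bar> powr (2 + \<delta>))"
begin

text \<open>The relative rate of the theorem. The smoothing time, the cut-off for jumps and the
  ranges of starting points are powers of \<open>n\<close> with exponents affine in it.\<close>

definition eps :: real where "eps = \<delta> / (4 * (3 + \<delta>))"
text \<open>The exponent \<open>\<beta> \<le> \<delta>\<close> in the overshoot and Lindeberg bounds; \<open>\<beta> (1 + \<epsilon>) = 5 \<epsilon>\<close> makes the overshoot error exactly \<open>n\<^bsup>-\<epsilon>\<^esup>\<close>
  at the end \<open>x = n\<^bsup>(1 + \<epsilon>) / 2\<^esup>\<close> of the range where the heat kernel comparison is needed.\<close>

definition bet :: real where "bet = 5 * eps / (1 + eps)"

lemma eps_pos: "0 < eps" and eps_lt: "eps < 1/4"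
  using delta_pos by (auto simp: eps_def field_simps)

lemma bet_eps: "bet * (1 + eps) = 5 * eps" using eps_pos by (simp add: bet_def)

text \<open>\<open>4 * eps <= bet\<close> makes the decay exponent \<open>bet / 2\<close> of the
  overshoot tail at least twice the target rate, which later pays for a factor \<open>n^eps\<close>
  lost through smoothing. \<open>bet <= \<delta>\<close> keeps the moment of order
  \<open>2 + bet\<close> finite.\<close>

lemma bet_pos: "0 < bet" and bet_lt_1: "bet < 1" and bet_ge: "4 * eps \<le> bet" and bet_le: "bet \<le> \<delta>"
proof -
  show "0 < bet" using eps_pos by (simp add: bet_def)
  show "bet < 1" using eps_pos eps_lt by (simp add: bet_def field_simps)
  show "4 * eps \<le> bet" using eps_pos eps_lt
    by (simp add: bet_def field_simps)
  have "bet \<le> 5 * eps" using eps_pos by (simp add: bet_def field_simps)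
  also have "\<dots> \<le> \<delta>" using delta_pos by (simp add: eps_def field_simps)
  finally show "bet \<le> \<delta>" .
qed

lemma int_bet: "integrable M (\<lambda>x. \<bar>x\<bar> powr (2 + bet))"
proof (rule Bochner_Integration.integrable_bound)
  show "integrable M (\<lambda>x. 1 + \<bar>x\<bar> powr (2 + \<delta>))" using int_delta by simp
  have "\<bar>x\<bar> powr (2 + bet) \<le> 1 + \<bar>x\<bar> powr (2 + \<delta>)" for x :: real
  proof (cases "\<bar>x\<bar> \<le> 1")
    case True
    then have "\<bar>x\<bar> powr (2 + bet) \<le> 1" using bet_pos by (intro powr_le1) auto
    then show ?thesis using powr_ge_zero[of "\<bar>x\<bar>" "2+\<delta>"] by linarith
  next
    case False
    then have "\<bar>x\<bar> powr (2 + bet) \<le> \<bar>x\<bar> powr (2 + \<delta>)" using bet_le by (intro powr_mono) auto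
    then show ?thesis by linarith
  qed
  then show "AE x in M. norm (\<bar>x\<bar> powr (2 + bet)) \<le> norm (1 + \<bar>x\<bar> powr (2 + \<delta>))"
    by (auto intro!: AE_I2 simp: abs_of_nonneg add_nonneg_nonneg)
qed simp

definition mbet :: real where "mbet = (\<integral>x. \<bar>x\<bar> powr (2 + bet) \<partial>M)"

lemma mbet_nonneg: "0 \<le> mbet" unfolding mbet_def by (intro Bochner_Integration.integral_nonneg) auto

lemma not_AE_nonpos: "\<not> (AE x in M. x \<le> 0)"
proof
  assume a: "AE x in M. x \<le> 0"
  then have "AE x in M. 0 \<le> - x" by simp
  moreover have "(\<integral>x. - x \<partial>M) = 0" "integrable M (\<lambda>x. - x)" using mean0 int1 by auto
  ultimately have "AE x in M. - x = 0" using integral_nonneg_eq_0_iff_AE[of M "\<lambda>x. - x"] by simp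
  then have "AE x in M. x\<^sup>2 = 0" by simp
  then have "(\<integral>x. x\<^sup>2 \<partial>M) = 0" using integral_cong_AE[of "\<lambda>x. x\<^sup>2" M "\<lambda>x. 0"] by simp
  with var1 show False by simp
qed

lemma not_AE_nonneg: "\<not> (AE x in M. x \<ge> 0)"
proof
  assume a: "AE x in M. 0 \<le> x"
  then have "AE x in M. x = 0" using integral_nonneg_eq_0_iff_AE[OF int1] mean0 by simp
  then have "AE x in M. x\<^sup>2 = 0" by simp
  then have "(\<integral>x. x\<^sup>2 \<partial>M) = 0" using integral_cong_AE[of "\<lambda>x. x\<^sup>2" M "\<lambda>x. 0"] by simp
  with var1 show False by simp
qed

lemma int2_ind: "integrable M (\<lambda>y. indicator {0..R} y * y\<^sup>2)"
  by (rule Bochner_Integration.integrable_bound[OF int2]) (auto simp: indicator_def)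

text \<open>Only upward jumps are counted because \<open>powr_concave_bound\<close> records a gain
  only for increments in [0, 1]. If all these moments vanished, the law would live on the negative
  half-line, against centring and unit variance.\<close>

lemma second_moment_pos_part:
  obtains R0 k0 where "R0 \<ge> 1" "k0 > 0" "\<And>R. R \<ge> R0 \<Longrightarrow> k0 \<le> (\<integral>y. indicator {0..R} y * y\<^sup>2 \<partial>M)"
proof -
  define K where "K R = (\<integral>y. indicator {0..R} y * y\<^sup>2 \<partial>M)" for R
  have K0: "0 \<le> K R" for R unfolding K_def by (intro Bochner_Integration.integral_nonneg) auto
  have "\<exists>n::nat. K (real n) > 0"
  proof (rule ccontr)
    assume "\<not> ?thesis"
    then have "K (real n) = 0" for n using K0[of "real n"] by (metis order_le_less)
    then have "AE y in M. indicator {0..real n} y * y\<^sup>2 = 0" for n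
      using integral_nonneg_eq_0_iff_AE[OF int2_ind, of "real n"] unfolding K_def by auto
    then have "AE y in M. \<forall>n. indicator {0..real n} y * y\<^sup>2 = 0" unfolding AE_all_countable by blast
    then have "AE y in M. y \<le> 0"
    proof eventually_elim
      case (elim y)
      obtain n :: nat where "y \<le> real n" using real_arch_simple by blast
      with elim[rule_format, of n] show ?case by (auto simp: indicator_def split: if_splits)
    qed
    with not_AE_nonpos show False by simp
  qed
  then obtain n where n: "K (real n) > 0" by blast
  have "K (real n) \<le> K R" if "real n \<le> R" for R
    unfolding K_def using that by (intro integral_mono int2_ind) (auto simp: indicator_def)
  then show ?thesis by (intro that[of "max 1 (real n)" "K (real n)"]) (use n K_def in auto)
qed

text \<open>From below \<open>R\<close>, a fixed number of consecutive downward jumps of size at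
  least \<open>b\<close> forces an exit. Their joint probability is a power of the mass of the jumps
  \<open><= -b\<close>, which is positive for suitable \<open>b\<close>.\<close>

lemma exit_positive:
  obtains N \<alpha> where "\<alpha> > 0" "\<And>z. z < R \<Longrightarrow> p N z \<le> 1 - \<alpha>"
proof -
  have "\<exists>n::nat. \<not> (AE y in M. y > - (1 / real (Suc n)))"
  proof (rule ccontr)
    assume "\<not> ?thesis"
    then have "AE y in M. \<forall>n::nat. y > - (1 / real (Suc n))" by (simp add: AE_all_countable)
    then have "AE y in M. y \<ge> 0"
    proof eventually_elim
      case (elim y)
      show ?case
      proof (rule ccontr)
        assume "\<not> 0 \<le> y"
        then obtain n where "inverse (real (Suc n)) < - y" using reals_Archimedean[of "-y"] by auto
        with elim[rule_format, of n] show False by (simp add: field_simps)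
      qed
    qed
    with not_AE_nonneg show False by simp
  qed
  then obtain n where n: "\<not> (AE y in M. y > - (1 / real (Suc n)))" by blast
  define b where "b = 1 / real (Suc n)"
  have b: "b > 0" by (simp add: b_def)
  define \<alpha> where "\<alpha> = prob {..-b}"
  have \<alpha>: "\<alpha> > 0"
  proof (rule ccontr)
    assume "\<not> \<alpha> > 0"
    then have "prob {..-b} = 0" unfolding \<alpha>_def using measure_nonneg[of M "{..-b}"] by linarith
    then have "AE y in M. y \<notin> {..-b}" by (subst (asm) prob_eq_0) auto
    then show False using n by (simp add: b_def not_le)
  qed
  have "p (Suc j) z \<le> 1 - \<alpha> ^ Suc j" if "z < real (Suc j) * b" for j z
    using that
  proof (induction j arbitrary: z)
    case 0
    have "p 1 z \<le> T (\<lambda>y. 1 - indicator {..<0} y) z"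
      unfolding Q_def by (simp, intro T_mono lin_diff lin_bdd[where C=1]) (auto simp: indicator_def)
    also have "\<dots> \<le> (\<integral>y. 1 - indicator {..-b} y \<partial>M)"
      unfolding T_def using 0
      by (intro integral_mono lin_integrable[of "\<lambda>y. 1 - indicator {..<0} y"] Bochner_Integration.integrable_diff
          integrable_ind lin_bdd[where C=1]) (auto simp: indicator_def)
    also have "\<dots> = 1 - \<alpha>" by (subst Bochner_Integration.integral_diff) (auto simp: \<alpha>_def)
    finally show ?case by simp
  next
    case (Suc j)
    have i: "integrable M (indicator {..-b} :: real \<Rightarrow> real)" by (intro integrable_real_indicator) (auto simp: emeasure_eq_measure)
    have "p (Suc (Suc j)) z = T (\<lambda>y. indicator {0..} y * p (Suc j) y) z" by (simp add: Q_def)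
    also have "\<dots> \<le> (\<integral>y. 1 - \<alpha> ^ Suc j * indicator {..-b} y \<partial>M)"
      unfolding T_def
    proof (intro integral_mono)
      show "integrable M (\<lambda>y. indicator {0..} (z + y) * p (Suc j) (z + y))"
        by (rule lin_integrable[of "\<lambda>y. indicator {0..} y * p (Suc j) y"]) (auto intro!: lin_ind)
      show "indicator {0..} (z+y) * p (Suc j) (z + y) \<le> 1 - \<alpha> ^ Suc j * indicator {..-b} y" for y
      proof (cases "y \<le> -b")
        case True
        then have "z + y < real (Suc j) * b" using Suc.prems by (simp add: algebra_simps)
        from Suc.IH[OF this] p_ge_0[of "Suc j" "z+y"] True show ?thesis by (auto simp: indicator_def)
      next
        case False
        then show ?thesis using p_le_1[of "Suc j" "z+y"] by (auto simp: indicator_def)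
      qed
    qed (use i in auto)
    also have "\<dots> = 1 - \<alpha> ^ Suc (Suc j)"
      using i by (subst Bochner_Integration.integral_diff) (auto simp: \<alpha>_def prob_space)
    finally show ?case .
  qed
  moreover obtain N :: nat where "R < real N * b" using b reals_Archimedean3 by blast
  moreover have "real N * b \<le> real (Suc N) * b" using b by (intro mult_right_mono) auto
  ultimately have "p (Suc N) z \<le> 1 - \<alpha> ^ Suc N" if "z < R" for z
    using that by force
  then show ?thesis using \<alpha> that[of "\<alpha> ^ Suc N" "Suc N"] by simp
qed

text \<open>An exit from \<open>z\<close> needs a jump \<open>y\<close> with modulus above
  \<open>z\<close>, so the overshoot, at most the modulus of \<open>y\<close>, may be multiplied by
  that modulus over \<open>z\<close> to the power \<open>1 + bet\<close>.\<close>

lemma G_decay: assumes "z > 0" shows "G z \<le> mbet * z powr (- 1 - bet)"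
proof -
  have "max 0 (- (z + y)) \<le> \<bar>y\<bar> powr (2 + bet) * z powr (- 1 - bet)" for y
  proof (cases "z + y < 0")
    case True
    then have y: "\<bar>y\<bar> > z" using assms by auto
    have "1 \<le> (\<bar>y\<bar> / z) powr (1 + bet)" using y assms bet_pos by (intro ge_one_powr_ge_zero) auto
    then have "\<bar>y\<bar> * 1 \<le> \<bar>y\<bar> * (\<bar>y\<bar> / z) powr (1 + bet)" by (intro mult_left_mono) auto
    also have "\<dots> = \<bar>y\<bar> powr (2 + bet) * z powr (- 1 - bet)"
      using y assms by (simp add: powr_divide powr_add powr_minus powr_diff field_simps power2_eq_square)
    finally show ?thesis using assms y by (auto simp: max_def)
  qed simp
  then have "G z \<le> (\<integral>y. \<bar>y\<bar> powr (2 + bet) * z powr (- 1 - bet) \<partial>M)"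
    unfolding G_def T_def by (intro integral_mono lin_integrable[of "\<lambda>z. max 0 (-z)"]) (use int_bet in auto)
  then show ?thesis by (simp add: mbet_def)
qed

lemma G_le: assumes "z \<ge> 0" shows "G z \<le> (\<integral>y. \<bar>y\<bar> \<partial>M)"
  unfolding G_def T_def using assms by (intro integral_mono lin_integrable[of "\<lambda>z. max 0 (-z)"]) auto

end

text \<open>The tangent bound at 0 (Young) holds for all \<open>v > -1\<close>. The quadratic gain
  on [0, 1], obtained by applying Young once more to the derivative, is what beats the overshoot far
  from the origin.\<close>

lemma powr_concave_bound:
  fixes s v :: real
  assumes s: "0 < s" "s < 1" and v: "-1 < v"
  shows "(1 + v) powr s \<le> 1 + s * v - s * (1 - s) / 4 * (indicator {0..1} v * v\<^sup>2)"
proof (cases "v \<in> {0..1}")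
  case False
  then show ?thesis using Youngs_inequality_0[of s "1 - s" "1 + v" 1] s v by (simp add: algebra_simps)
next
  case True
  define f where "f v = 1 + s * v - s * (1 - s) / 4 * v\<^sup>2 - (1 + v) powr s" for v
  have d: "(f has_real_derivative s - s * (1 - s) / 2 * t - s * (1 + t) powr (s - 1)) (at t)" if "t \<ge> 0" for t
    unfolding f_def using that by (auto intro!: derivative_eq_intros simp: powr_diff field_simps)
  have "f 0 \<le> f v"
  proof (rule DERIV_nonneg_imp_nondecreasing[where f=f and a=0 and b=v])
    fix t assume t: "0 \<le> t" "t \<le> v"
    have "(1 + t) powr (s - 1) = (1 / (1 + t)) powr (1 - s) * 1 powr s" using t by (simp add: powr_divide powr_diff field_simps)
    also have "\<dots> \<le> (1 - s) * (1 / (1 + t)) + s * 1" using s t by (intro Youngs_inequality_0) auto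
    also have "\<dots> = 1 - (1 - s) * (t / (1 + t))" using t by (simp add: field_simps)
    also have "\<dots> \<le> 1 - (1 - s) * (t / 2)"
      using s t True by (intro diff_left_mono mult_left_mono divide_left_mono) auto
    finally have "s * (1 + t) powr (s - 1) \<le> s * (1 - (1 - s) * (t / 2))" using s by (intro mult_left_mono) auto
    then have "0 \<le> s - s * (1 - s) / 2 * t - s * (1 + t) powr (s - 1)" by (simp add: algebra_simps)
    then show "\<exists>y. (f has_real_derivative y) (at t) \<and> 0 \<le> y" using d[OF t(1)] by blast
  qed (use True in auto)
  then show ?thesis using True by (simp add: f_def)
qed

context walk_law
begin

text \<open>The shift \<open>R\<close> keeps the power away from its singularity and turns jumps
  \<open>y\<close> in [0, R] into relative increments \<open>y / (z + R)\<close> in [0, 1], where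
  concavity gains.\<close>

lemma Q_powr_le:
  assumes s: "0 < s" "s < 1" and R: "R \<ge> 1" and z: "z \<ge> 0"
  shows "Q (\<lambda>z. (\<bar>z\<bar> + R) powr s) z \<le> (z + R) powr s + s * (z + R) powr (s - 1) * G z
    - s * (1 - s) / 4 * (z + R) powr (s - 2) * (\<integral>y. indicator {0..R} y * y\<^sup>2 \<partial>M)"
proof -
  define w where "w = z + R"
  have w: "w > 0" "w \<ge> R" "w \<ge> 1" "z \<le> w" using R z by (auto simp: w_def)
  define c where "c = s * (1 - s) / 4"
  have c: "c > 0" using s by (simp add: c_def)
  have pt: "indicator {0..} (z + y) * (\<bar>z + y\<bar> + R) powr s \<le> w powr s + s * w powr (s - 1) * y
     + s * w powr (s - 1) * max 0 (- (z + y)) - c * w powr (s - 2) * (indicator {0..R} y * y\<^sup>2)" for y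
  proof (cases "z + y \<ge> 0")
    case True
    define v where "v = y / w"
    have y: "y = v * w" using w by (simp add: v_def)
    have "0 < w + y" using True R by (simp add: w_def)
    then have v: "-1 < v" using w by (simp add: v_def field_simps)
    have "(\<bar>z + y\<bar> + R) = w * (1 + v)" using True by (simp add: y algebra_simps w_def[symmetric]) (simp add: w_def)
    then have "(\<bar>z + y\<bar> + R) powr s = w powr s * (1 + v) powr s" using w v by (simp add: powr_mult)
    also have "\<dots> \<le> w powr s * (1 + s * v - c * (indicator {0..1} v * v\<^sup>2))"
      unfolding c_def using powr_concave_bound[OF s v] by (intro mult_left_mono) auto
    also have "\<dots> = w powr s + s * w powr (s - 1) * y - c * w powr (s - 2) * (indicator {0..1} v * y\<^sup>2)"
      using w by (simp add: y powr_diff field_simps power2_eq_square)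
    also have "\<dots> \<le> w powr s + s * w powr (s - 1) * y - c * w powr (s - 2) * (indicator {0..R} y * y\<^sup>2)"
      using c w by (intro diff_left_mono mult_left_mono) (auto simp: indicator_def v_def field_simps)
    finally show ?thesis using True by simp
  next
    case False
    then have "y < 0" using z by simp
    \<comment> \<open>After an exit the left side is 0. The overshoot term completes the linear term
      to \<open>- s * w powr (s - 1) * z\<close>, which \<open>w powr s\<close> outweighs.\<close>
    have "s * w powr (s - 1) * z \<le> 1 * w powr (s - 1) * w" using s w z by (intro mult_mono) auto
    also have "\<dots> = w powr s" using w by (simp add: powr_diff)
    finally show ?thesis using False \<open>y < 0\<close> by (simp add: indicator_def max_def algebra_simps)
  qed
  have lin1: "lin_growth (\<lambda>z. (\<bar>z\<bar> + R) powr s)"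
  proof (rule lin_growthI[where C=R])
    fix z :: real
    have "(\<bar>z\<bar> + R) powr s \<le> (\<bar>z\<bar> + R) powr 1" using R s by (intro powr_mono) auto
    also have "\<dots> = \<bar>z\<bar> + R" using R by simp
    also have "\<dots> \<le> R * (1 + \<bar>z\<bar>)" using R mult_right_mono[of 1 R "\<bar>z\<bar>"] by (simp add: algebra_simps)
    finally show "\<bar>(\<bar>z\<bar> + R) powr s\<bar> \<le> R * (1 + \<bar>z\<bar>)" by simp
  qed simp
  have i1: "integrable M (\<lambda>y. max 0 (- (z + y)))" by (rule lin_integrable[of "\<lambda>z. max 0 (-z)"]) simp
  have "Q (\<lambda>z. (\<bar>z\<bar> + R) powr s) z \<le> (\<integral>y. w powr s + s * w powr (s - 1) * y
     + s * w powr (s - 1) * max 0 (- (z + y)) - c * w powr (s - 2) * (indicator {0..R} y * y\<^sup>2) \<partial>M)"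
    unfolding Q_def T_def
    by (intro integral_mono pt lin_integrable[of "\<lambda>y. indicator {0..} y * (\<bar>y\<bar> + R) powr s"] lin_ind lin1)
       (use i1 int1 int2_ind in auto)
  also have "\<dots> = w powr s + s * w powr (s - 1) * G z - c * w powr (s - 2) * (\<integral>y. indicator {0..R} y * y\<^sup>2 \<partial>M)"
    using i1 int1 int2_ind mean0 by (simp add: G_def T_def prob_space)
  finally show ?thesis by (simp add: w_def c_def)
qed


text \<open>A superharmonic function of the form \<open>A (z + R)\<^sup>s + B (p\<^sub>0 + \<dots> + p\<^bsub>N-1\<^esub>)\<close> dominates
  the mean overshoot: the power pays for it far from the origin, the Green-type sum near it.\<close>

lemma e_bound: "\<exists>C>0. \<forall>n. \<forall>x\<ge>0. e n x \<le> C * (1 + x) powr (1 - bet)"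
proof -
  define s where "s = 1 - bet"
  have s: "0 < s" "s < 1" using bet_pos bet_lt_1 by (auto simp: s_def)
  obtain R0 k0 where R0: "R0 \<ge> 1" and k0: "k0 > 0" and k0': "\<And>R. R \<ge> R0 \<Longrightarrow> k0 \<le> (\<integral>y. indicator {0..R} y * y\<^sup>2 \<partial>M)"
    using second_moment_pos_part by blast
  define d where "d = s * (1 - s) / 4 * k0"
  have d: "d > 0" using s k0 by (simp add: d_def)
  \<comment> \<open>The overshoot feeds back through the slope of the power; for large
    \<open>R\<close> this consumes at most half of the concavity gain \<open>d\<close>.\<close>
  have "((\<lambda>R. 4 * mbet * s * R powr (s - 1)) \<longlongrightarrow> 4 * mbet * s * 0) at_top"
    by (intro tendsto_mult tendsto_const tendsto_neg_powr) (use s in \<open>auto simp: filterlim_ident\<close>)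
  then have "eventually (\<lambda>R. 4 * mbet * s * R powr (s - 1) < d / 2) at_top"
    using d by (intro order_tendstoD(2)) auto
  then have "eventually (\<lambda>R. 4 * mbet * s * R powr (s - 1) < d / 2 \<and> R0 \<le> R) at_top"
    using eventually_ge_at_top by (rule eventually_conj)
  then obtain R where R: "4 * mbet * s * R powr (s - 1) \<le> d / 2" "R0 \<le> R"
    unfolding eventually_at_top_linorder by (meson less_imp_le order_refl)
  have R1: "1 \<le> R" using R R0 by simp
  \<comment> \<open>The other half of the gain, \<open>A * d / 2 = 4 * mbet\<close>, pays for
    \<open>G\<close> itself far from the origin.\<close>
  define A where "A = 8 * mbet / d"
  have A: "A \<ge> 0" using d mbet_nonneg by (simp add: A_def)
  obtain N \<alpha> where \<alpha>: "\<alpha> > 0" "\<And>z. z < R \<Longrightarrow> p N z \<le> 1 - \<alpha>" using exit_positive by metis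
  define E where "E = (\<integral>y. \<bar>y\<bar> \<partial>M)"
  have E: "E \<ge> 0" unfolding E_def by (intro Bochner_Integration.integral_nonneg) auto
  \<comment> \<open>Below \<open>R\<close> one application of \<open>Q\<close> lowers
    \<open>\<rho>\<close> by at least \<open>\<alpha>\<close>, so this multiple pays there for
    \<open>G <= E\<close> and its feedback.\<close>
  define B where "B = (1 + A * s) * E / \<alpha>"
  have B: "B \<ge> 0" using A s E \<alpha> by (simp add: B_def)
  define f where "f z = (\<bar>z\<bar> + R) powr s" for z
  define \<rho> where "\<rho> z = (\<Sum>j<N. p j z)" for z
  define U where "U z = A * f z + B * \<rho> z" for z
  have lf: "lin_growth f"
  proof (rule lin_growthI[where C=R])
    fix z :: real
    have "(\<bar>z\<bar> + R) powr s \<le> (\<bar>z\<bar> + R) powr 1" using R1 s by (intro powr_mono) auto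
    also have "\<dots> = \<bar>z\<bar> + R" using R1 by simp
    also have "\<dots> \<le> R * (1 + \<bar>z\<bar>)" using R1 mult_right_mono[of 1 R "\<bar>z\<bar>"] by (simp add: algebra_simps)
    finally show "\<bar>f z\<bar> \<le> R * (1 + \<bar>z\<bar>)" by (simp add: f_def)
  qed (simp add: f_def[abs_def])
  have l\<rho>: "lin_growth \<rho>" unfolding \<rho>_def[abs_def] by auto
  have lU: "lin_growth U" unfolding U_def[abs_def] by (intro lin_add lin_cmult lf l\<rho>)
  have Q\<rho>: "Q \<rho> z = \<rho> z - 1 + p N z" for z
  proof -
    have "Q \<rho> z = (\<Sum>j<N. p (Suc j) z)"
      using Qn_sum[of "{..<N}" p 1] by (simp add: \<rho>_def[abs_def] fun_eq_iff)
    then show ?thesis using sum_lessThan_telescope[of "\<lambda>j. p j z" N] by (simp add: \<rho>_def sum_subtractf)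
  qed
  have step: "Q U z + G z \<le> U z" if z: "z \<ge> 0" for z
  proof -
    define w where "w = z + R"
    have w: "w \<ge> R" "w \<ge> 1" using z R1 by (auto simp: w_def)
    have K: "k0 \<le> (\<integral>y. indicator {0..R} y * y\<^sup>2 \<partial>M)" by (rule k0') (rule R)
    have "Q f z \<le> w powr s + s * w powr (s - 1) * G z
        - s * (1 - s) / 4 * w powr (s - 2) * (\<integral>y. indicator {0..R} y * y\<^sup>2 \<partial>M)"
      unfolding f_def[abs_def] w_def by (rule Q_powr_le[OF s R1 z])
    also have "\<dots> \<le> w powr s + s * w powr (s - 1) * G z - s * (1 - s) / 4 * w powr (s - 2) * k0"
      using s K by (intro diff_left_mono mult_left_mono) auto
    also have "\<dots> = f z + s * w powr (s - 1) * G z - d * w powr (s - 2)"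
      using z by (simp add: f_def d_def w_def)
    finally have "A * Q f z \<le> A * (f z + s * w powr (s - 1) * G z - d * w powr (s - 2))"
      using A by (intro mult_left_mono)
    then have 1: "Q U z + G z \<le> U z + ((1 + A * s * w powr (s - 1)) * G z - A * d * w powr (s - 2)) - B * (1 - p N z)"
      unfolding U_def[abs_def] using lf l\<rho> by (simp add: Q_add lin_cmult Q_cmult Q\<rho> algebra_simps)
    have "(1 + A * s * w powr (s - 1)) * G z - A * d * w powr (s - 2) \<le> B * (1 - p N z)"
    proof (cases "z < R")
      case True
      have "w powr (s - 1) \<le> w powr 0" using s w by (intro powr_mono) auto
      then have "w powr (s - 1) \<le> 1" using w by simp
      then have "A * s * w powr (s - 1) \<le> A * s * 1" using A s by (intro mult_left_mono) auto
      then have "(1 + A * s * w powr (s - 1)) * G z \<le> (1 + A * s) * E"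
        using G_le[OF z] G_nonneg[of z] A s by (intro mult_mono) (auto simp: E_def)
      also have "\<dots> = B * \<alpha>" using \<alpha> by (simp add: B_def)
      also have "\<dots> \<le> B * (1 - p N z)" using \<alpha>(2)[OF True] B by (intro mult_left_mono) auto
      finally show ?thesis using mult_nonneg_nonneg[OF mult_nonneg_nonneg[OF A less_imp_le[OF d]] powr_ge_zero[of w "s - 2"]] by linarith
    next
      case False
      then have z0: "z > 0" "w / 2 \<le> z" using R1 by (auto simp: w_def)
      have "G z \<le> mbet * z powr (s - 2)" using G_decay[OF z0(1)] by (simp add: s_def)
      also have "z powr (s - 2) \<le> (w / 2) powr (s - 2)" using z0 s w by (intro powr_mono2') auto
      also have "(w / 2) powr (s - 2) = 2 powr (2 - s) * w powr (s - 2)"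
        using w by (simp add: powr_divide powr_diff field_simps)
      also have "2 powr (2 - s) \<le> (2::real) powr 2" using s by (intro powr_mono) auto
      also have "(2::real) powr 2 = 4" by simp
      finally have G: "G z \<le> 4 * mbet * w powr (s - 2)" using mbet_nonneg by (simp add: mult_left_mono mult_right_mono algebra_simps)
      have "w powr (s - 1) \<le> R powr (s - 1)" using s w R1 by (intro powr_mono2') auto
      then have "(1 + A * s * w powr (s - 1)) * (4 * mbet) \<le> (1 + A * s * R powr (s - 1)) * (4 * mbet)"
        using A s mbet_nonneg by (intro mult_right_mono add_left_mono mult_left_mono) auto
      also have "\<dots> = 4 * mbet + A * (4 * mbet * s * R powr (s - 1))" by (simp add: algebra_simps)
      also have "\<dots> \<le> 4 * mbet + A * (d / 2)" using R A by (intro add_left_mono mult_left_mono) auto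
      also have "\<dots> = A * d" using d by (simp add: A_def)
      finally have 2: "(1 + A * s * w powr (s - 1)) * (4 * mbet) \<le> A * d" .
      have "(1 + A * s * w powr (s - 1)) * G z \<le> (1 + A * s * w powr (s - 1)) * (4 * mbet * w powr (s - 2))"
        using A s G by (intro mult_left_mono) auto
      also have "\<dots> = (1 + A * s * w powr (s - 1)) * (4 * mbet) * w powr (s - 2)" by simp
      also have "\<dots> \<le> A * d * w powr (s - 2)" using 2 by (intro mult_right_mono) auto
      finally show ?thesis using mult_nonneg_nonneg[OF B, of "1 - p N z"] p_le_1[of N z] by simp
    qed
    with 1 show ?thesis by linarith
  qed
  have eU: "e n z \<le> U z" if "z \<ge> 0" for n z
    using that
  proof (induction n arbitrary: z)
    case 0 then show ?case using A B by (auto simp: U_def f_def \<rho>_def intro!: add_nonneg_nonneg mult_nonneg_nonneg sum_nonneg p_ge_0)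
  next
    case (Suc n)
    have "Q (e n) z \<le> Q U z" using Suc.IH lU by (intro Q_mono) auto
    with step[OF Suc.prems] show ?case by (simp add: e_Suc)
  qed
  have U_le: "U z \<le> (A * R powr s + B * N + 1) * (1 + z) powr s" if z: "z \<ge> 0" for z
  proof -
    have "f z \<le> (R * (1 + z)) powr s" unfolding f_def using z R1 s mult_right_mono[of 1 R z]
      by (intro powr_mono2) (auto simp: algebra_simps)
    then have "f z \<le> R powr s * (1 + z) powr s" using z R1 by (simp add: powr_mult)
    then have 1: "A * f z \<le> A * (R powr s * (1 + z) powr s)" using A by (intro mult_left_mono)
    have "\<rho> z \<le> (\<Sum>j<N. 1)" unfolding \<rho>_def by (intro sum_mono p_le_1)
    then have "\<rho> z \<le> real N * 1" by simp
    also have "\<dots> \<le> real N * (1 + z) powr s" using z s by (intro mult_left_mono ge_one_powr_ge_zero) auto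
    finally have "B * \<rho> z \<le> B * (N * (1 + z) powr s)" using B by (intro mult_left_mono)
    with 1 have "U z \<le> (A * R powr s + B * N) * (1 + z) powr s + 0" by (simp add: U_def algebra_simps)
    also have "\<dots> \<le> (A * R powr s + B * N) * (1 + z) powr s + (1 + z) powr s" by (intro add_left_mono) simp
    finally show ?thesis by (simp add: algebra_simps)
  qed
  have "A * R powr s + B * N + 1 > 0" using A B by (intro add_nonneg_pos add_nonneg_nonneg mult_nonneg_nonneg) auto
  then show ?thesis using eU U_le order_trans unfolding s_def by blast
qed

end

subsection \<open>Concentration and the renewal function\<close>

context walk_law
begin

lemma Tn_mono: "lin_growth f \<Longrightarrow> lin_growth g \<Longrightarrow> (\<And>z. f z \<le> g z) \<Longrightarrow> (T ^^ n) f x \<le> (T ^^ n) g x"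
  by (induction n arbitrary: x) (auto intro!: T_mono)

lemma Tn_add: "lin_growth f \<Longrightarrow> lin_growth g \<Longrightarrow> (T ^^ n) (\<lambda>z. f z + g z) = (\<lambda>x. (T ^^ n) f x + (T ^^ n) g x)"
proof (induction n)
  case (Suc n)
  show ?case using Suc.prems by (intro ext) (simp add: Suc.IH T_add)
qed simp

lemma Tn_cmult: "(T ^^ n) (\<lambda>z. c * f z) = (\<lambda>x. c * (T ^^ n) f x)"
  by (induction n) (simp_all add: T_cmult[abs_def])

lemma Tn_const: "(T ^^ n) (\<lambda>_. c) = (\<lambda>_. c)"
  by (induction n) (simp_all add: T_const[abs_def])

lemma Tn_id: "(T ^^ n) (\<lambda>z. z) = (\<lambda>z. z)"
  by (induction n) (simp_all add: T_id[abs_def])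

lemma Qn_le_Tn: assumes "lin_growth f" "\<And>z. 0 \<le> f z" shows "(Q ^^ n) f x \<le> (T ^^ n) f x"
proof (induction n arbitrary: x)
  case (Suc n)
  have Q0: "0 \<le> (Q ^^ n) f z" for z using assms by (cases n) (auto intro!: Q_nonneg Qn_nonneg)
  have "Q ((Q ^^ n) f) x \<le> T ((Q ^^ n) f) x" using assms Q0 by (intro Q_le_T) auto
  also have "\<dots> \<le> T ((T ^^ n) f) x" using assms Suc by (intro T_mono) auto
  finally show ?case by simp
qed simp

text \<open>The minimum of a quadratic and a cubic expression in \<open>char_approx3\<close> is
  interpolated to the moment of order \<open>2 + bet\<close>. Then \<open>s0\<close> is small enough
  for the remainder to use at most half of \<open>s^2 / 2\<close>.\<close>

lemma char_decay: obtains s0 where "s0 > 0" "\<And>s. \<bar>s\<bar> \<le> s0 \<Longrightarrow> cmod (char M s) \<le> exp (- s\<^sup>2 / 4)"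
proof -
  define s0 where "s0 = min 1 ((1 / (4 * (mbet + 1))) powr (1 / bet))"
  have s0: "s0 > 0" "s0 \<le> 1" using mbet_nonneg by (auto simp: s0_def)
  have "cmod (char M s) \<le> exp (- s\<^sup>2 / 4)" if s: "\<bar>s\<bar> \<le> s0" for s
  proof -
    have sb: "\<bar>s\<bar> powr bet * mbet \<le> 1 / 4"
    proof -
      have "\<bar>s\<bar> powr bet \<le> ((1 / (4 * (mbet + 1))) powr (1 / bet)) powr bet"
        using s bet_pos by (intro powr_mono2) (auto simp: s0_def)
      also have "\<dots> = 1 / (4 * (mbet + 1))" using bet_pos mbet_nonneg by (simp add: powr_powr)
      finally have "\<bar>s\<bar> powr bet * mbet \<le> 1 / (4 * (mbet + 1)) * mbet" using mbet_nonneg by (intro mult_right_mono)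
      also have "\<dots> \<le> 1 / 4" using mbet_nonneg by (simp add: field_simps)
      finally show ?thesis .
    qed
    have m: "min (6 * x\<^sup>2) (\<bar>s\<bar> * \<bar>x\<bar> ^ 3) \<le> 6 * \<bar>s\<bar> powr bet * \<bar>x\<bar> powr (2 + bet)" for x :: real
    proof (cases "x = 0 \<or> s = 0")
      case False
      define y where "y = \<bar>s\<bar> * \<bar>x\<bar>"
      have y: "y > 0" using False by (simp add: y_def)
      have "min 6 y \<le> 6 * y powr bet"
      proof (cases "y \<le> 1")
        case True
        then have "y powr 1 \<le> y powr bet" using y bet_lt_1 by (intro powr_mono') auto
        then show ?thesis using y by (simp add: min_def)
      next
        case False
        then have "1 \<le> y powr bet" using bet_pos by (intro ge_one_powr_ge_zero) auto
        then show ?thesis by simp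
      qed
      then have "x\<^sup>2 * min 6 y \<le> x\<^sup>2 * (6 * y powr bet)" by (intro mult_left_mono) auto
      moreover have "x\<^sup>2 * min 6 y = min (6 * x\<^sup>2) (\<bar>s\<bar> * \<bar>x\<bar> ^ 3)"
        by (simp add: y_def min_mult_distrib_left power2_eq_square power3_eq_cube ac_simps flip: power2_abs[of x])
      moreover have "x\<^sup>2 * (6 * y powr bet) = 6 * \<bar>s\<bar> powr bet * \<bar>x\<bar> powr (2 + bet)"
        using False by (simp add: y_def powr_mult powr_add powr_numeral)
      ultimately show ?thesis by simp
    qed (auto simp: powr_ge_zero)
    have "cmod (char M s - (1 - s\<^sup>2 * 1 / 2)) \<le> (s\<^sup>2 / 6) * expectation (\<lambda>x. min (6 * x\<^sup>2) (\<bar>s\<bar> * \<bar>x\<bar> ^ 3))"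
      by (rule char_approx3) (use int1 int2 mean0 var1 in auto)
    also have "expectation (\<lambda>x. min (6 * x\<^sup>2) (\<bar>s\<bar> * \<bar>x\<bar> ^ 3)) \<le> expectation (\<lambda>x. 6 * \<bar>s\<bar> powr bet * \<bar>x\<bar> powr (2 + bet))"
    proof (rule integral_mono)
      show "integrable M (\<lambda>x. min (6 * x\<^sup>2) (\<bar>s\<bar> * \<bar>x\<bar> ^ 3))"
        by (rule Bochner_Integration.integrable_bound[of M "\<lambda>x. 6 * x\<^sup>2"]) (use int2 in auto)
    qed (use int_bet m in auto)
    also have "\<dots> = 6 * (\<bar>s\<bar> powr bet * mbet)" by (simp add: mbet_def)
    finally have "cmod (char M s - (1 - s\<^sup>2 / 2)) \<le> s\<^sup>2 * (\<bar>s\<bar> powr bet * mbet)"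
      by (simp add: mult_left_mono)
    also have "\<dots> \<le> s\<^sup>2 * (1/4)" using sb by (intro mult_left_mono) auto
    finally have 1: "cmod (char M s - (1 - s\<^sup>2 / 2)) \<le> s\<^sup>2 / 4" by simp
    have "s\<^sup>2 \<le> 1" using s s0 by (simp add: abs_square_le_1)
    then have "cmod (complex_of_real (1 - s\<^sup>2 / 2)) = 1 - s\<^sup>2 / 2"
      unfolding norm_of_real by linarith
    then have "cmod (char M s) \<le> 1 - s\<^sup>2 / 4"
      using 1 norm_triangle_sub[of "char M s" "complex_of_real (1 - s\<^sup>2 / 2)"] by linarith
    also have "\<dots> \<le> exp (- s\<^sup>2 / 4)" using exp_ge_add_one_self[of "- s\<^sup>2/4"] by simp
    finally show ?thesis .
  qed
  with s0 that show ?thesis by blast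
qed

text \<open>A smooth stand-in for the indicator of a window of width \<open>sqrt h\<close> around 0,
  with height 1 instead of mass 1.\<close>

definition gauss :: "real \<Rightarrow> real \<Rightarrow> real" where "gauss h z = exp (- z\<^sup>2 / (2 * h))"

lemma lin_gauss [simp, intro]: "h > 0 \<Longrightarrow> lin_growth (gauss h)"
  by (rule lin_bdd[where C=1]) (auto simp: gauss_def[abs_def])

text \<open>\<open>gauss h\<close> is the characteristic function of the centred normal law with
  variance \<open>1 / h\<close>. Fubini moves the \<open>k\<close> steps of the walk into the factor
  \<open>char M ^ k\<close>.\<close>

lemma Tn_gauss:
  assumes h: "h > 0"
  shows "complex_of_real ((T ^^ k) (gauss h) z)
    = (CLINT t|std_normal_distribution. iexp (t * z / sqrt h) * char M (t / sqrt h) ^ k)"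
proof (induction k arbitrary: z)
  case 0
  have "(CLINT t|std_normal_distribution. iexp (t * z / sqrt h)) = char std_normal_distribution (z / sqrt h)"
    by (simp add: char_def mult.commute)
  also have "\<dots> = complex_of_real (gauss h z)"
    using h by (simp add: char_std_normal_distribution gauss_def power_divide)
  finally show ?case by simp
next
  case (Suc k)
  interpret P: pair_prob_space M std_normal_distribution ..
  define F where "F y t = iexp (t * (z + y) / sqrt h) * char M (t / sqrt h) ^ k" for y t :: real
  have Fm[measurable]: "(\<lambda>(y, t). F y t) \<in> borel_measurable (M \<Otimes>\<^sub>M std_normal_distribution)"
    unfolding F_def by measurable
  have Fi: "integrable (M \<Otimes>\<^sub>M std_normal_distribution) (\<lambda>(y, t). F y t)"
  proof (rule P.integrable_const_bound[where B=1])
    have "cmod (F y t) \<le> 1" for y t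
      unfolding F_def norm_mult norm_power using cmod_char_le_1[of "t / sqrt h"] by (simp add: power_le_one)
    then show "AE x in M \<Otimes>\<^sub>M std_normal_distribution. cmod (case x of (y, t) \<Rightarrow> F y t) \<le> 1"
      by (auto intro!: AE_I2)
  qed (rule Fm)
  have "complex_of_real ((T ^^ Suc k) (gauss h) z) = (CLINT y|M. complex_of_real ((T ^^ k) (gauss h) (z + y)))"
    by (simp add: T_def)
  also have "\<dots> = (CLINT y|M. (CLINT t|std_normal_distribution. F y t))"
    unfolding Suc.IH F_def ..
  also have "\<dots> = (CLINT t|std_normal_distribution. (CLINT y|M. F y t))"
    by (rule P.Fubini_integral[symmetric]) (rule Fi)
  also have "\<dots> = (CLINT t|std_normal_distribution. iexp (t * z / sqrt h) * char M (t / sqrt h) ^ Suc k)"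
  proof (intro Bochner_Integration.integral_cong refl)
    fix t :: real
    have "F y t = iexp (t * z / sqrt h) * char M (t / sqrt h) ^ k * iexp (t / sqrt h * y)" for y
      unfolding F_def by (simp add: field_simps add_divide_distrib flip: exp_add)
    then have "(CLINT y|M. F y t) = iexp (t * z / sqrt h) * char M (t / sqrt h) ^ k * (CLINT y|M. iexp (t / sqrt h * y))"
      by simp
    then show "(CLINT y|M. F y t) = iexp (t * z / sqrt h) * char M (t / sqrt h) ^ Suc k"
      by (simp add: char_def)
  qed
  finally show ?case .
qed

lemma concentration: "\<exists>C>0. \<forall>k\<ge>1. \<forall>h>0. \<forall>z. (T ^^ k) (gauss h) z \<le> C * (sqrt (h / real k) + 1 / h)"
proof -
  obtain s0 where s0: "s0 > 0" "\<And>s. \<bar>s\<bar> \<le> s0 \<Longrightarrow> cmod (char M s) \<le> exp (- s\<^sup>2 / 4)"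
    using char_decay by blast
  have "(T ^^ k) (gauss h) z \<le> (2 + 1 / s0\<^sup>2) * (sqrt (h / real k) + 1 / h)" if k: "k \<ge> 1" and h: "h > 0" for k h z
  proof -
    \<comment> \<open>Chosen so that the \<open>k\<close>-th power of the bound from
      \<open>char_decay\<close> at \<open>t / sqrt h\<close> is an unnormalized Gaussian in
      \<open>t\<close> with variance \<open>\<tau>^2\<close>. Its integral against the bounded
      density \<open>phi\<close> is at most \<open>\<tau>\<close>.\<close>
    define \<tau> where "\<tau> = sqrt (2 * h / real k)"
    have \<tau>: "\<tau> > 0" "\<tau>\<^sup>2 = 2 * h / real k" using h k by (auto simp: \<tau>_def)
    let ?N = std_normal_distribution
    have m: "(\<lambda>t. cmod (char M (t / sqrt h)) ^ k) \<in> borel_measurable ?N" by measurable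
    have i2: "integrable ?N (\<lambda>t. t\<^sup>2 / (s0\<^sup>2 * h))"
      using integrable_std_normal_distribution_moment[of 2] by simp
    have i1: "integrable ?N (\<lambda>t. exp (- t\<^sup>2 / (2 * \<tau>\<^sup>2)))"
      by (rule std_normal.integrable_const_bound[where B=1]) auto
    have pt: "cmod (char M (t / sqrt h)) ^ k \<le> exp (- t\<^sup>2 / (2 * \<tau>\<^sup>2)) + t\<^sup>2 / (s0\<^sup>2 * h)" for t
    proof (cases "\<bar>t / sqrt h\<bar> \<le> s0")
      case True
      have "cmod (char M (t / sqrt h)) ^ k \<le> exp (- (t / sqrt h)\<^sup>2 / 4) ^ k"
        by (intro power_mono s0 True) auto
      also have "\<dots> = exp (- t\<^sup>2 / (2 * \<tau>\<^sup>2))"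
        using h k by (simp add: exp_of_nat_mult[symmetric] \<tau>(2) power_divide field_simps)
      finally show ?thesis using h by (simp add: add_increasing2)
    next
      case False
      then have "s0\<^sup>2 \<le> (t / sqrt h)\<^sup>2" using s0(1) by (metis abs_le_square_iff abs_of_pos less_imp_le not_le)
      then have "1 \<le> t\<^sup>2 / (s0\<^sup>2 * h)" using h s0(1) by (simp add: power_divide field_simps)
      moreover have "cmod (char M (t / sqrt h)) ^ k \<le> 1" using cmod_char_le_1 by (simp add: power_le_one)
      ultimately show ?thesis by (simp add: add_increasing)
    qed
    have "(T ^^ k) (gauss h) z \<le> cmod (complex_of_real ((T ^^ k) (gauss h) z))" by simp
    also have "\<dots> \<le> (\<integral>t. cmod (iexp (t * z / sqrt h) * char M (t / sqrt h) ^ k) \<partial>?N)"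
      unfolding Tn_gauss[OF h] by (rule integral_norm_bound)
    also have "\<dots> = (\<integral>t. cmod (char M (t / sqrt h)) ^ k \<partial>?N)" by (simp add: norm_mult norm_power)
    also have "\<dots> \<le> (\<integral>t. exp (- t\<^sup>2 / (2 * \<tau>\<^sup>2)) + t\<^sup>2 / (s0\<^sup>2 * h) \<partial>?N)"
    proof (rule integral_mono)
      show "integrable ?N (\<lambda>t. cmod (char M (t / sqrt h)) ^ k)"
        by (rule std_normal.integrable_const_bound[where B=1]) (use m cmod_char_le_1 in \<open>auto intro!: AE_I2 power_le_one\<close>)
    qed (use i1 i2 pt in auto)
    also have "\<dots> = (\<integral>t. exp (- t\<^sup>2 / (2 * \<tau>\<^sup>2)) \<partial>?N) + (\<integral>t. t\<^sup>2 / (s0\<^sup>2 * h) \<partial>?N)"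
      using i1 i2 by (rule Bochner_Integration.integral_add)
    also have "(\<integral>t. t\<^sup>2 / (s0\<^sup>2 * h) \<partial>?N) = 1 / (s0\<^sup>2 * h)"
      using std_normal_distribution_even_moments[of 1] by simp
    also have "(\<integral>t. exp (- t\<^sup>2 / (2 * \<tau>\<^sup>2)) \<partial>?N) = (LBINT t. phi t * exp (- t\<^sup>2 / (2 * \<tau>\<^sup>2)))"
      by (subst integral_density) auto
    also have "\<dots> \<le> (LBINT t. \<tau> * normal_density 0 \<tau> t)"
    proof (rule integral_mono)
      show "integrable lborel (\<lambda>t. phi t * exp (- t\<^sup>2 / (2 * \<tau>\<^sup>2)))"
        by (rule Bochner_Integration.integrable_bound[of lborel phi]) (auto simp: integrable_normal_density abs_mult mult_left_le)
      show "integrable lborel (\<lambda>t. \<tau> * normal_density 0 \<tau> t)" using \<tau> by simp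
      show "phi t * exp (- t\<^sup>2 / (2 * \<tau>\<^sup>2)) \<le> \<tau> * normal_density 0 \<tau> t" for t
      proof -
        have "\<tau> * normal_density 0 \<tau> t = 1 / sqrt (2 * pi) * exp (- t\<^sup>2 / (2 * \<tau>\<^sup>2))"
          using \<tau>(1) by (simp add: normal_density_def real_sqrt_mult)
        moreover have "phi t \<le> 1 / sqrt (2 * pi) * 1"
          unfolding std_normal_density_def by (intro mult_left_mono) auto
        moreover have "phi t * exp (- t\<^sup>2 / (2 * \<tau>\<^sup>2)) \<le> 1 / sqrt (2 * pi) * 1 * exp (- t\<^sup>2 / (2 * \<tau>\<^sup>2))"
          using calculation(2) by (rule mult_right_mono) simp
        ultimately show ?thesis by simp
      qed
    qed
    also have "\<dots> = \<tau>" using \<tau> by simp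
    finally have "(T ^^ k) (gauss h) z \<le> \<tau> + 1 / (s0\<^sup>2 * h)" by simp
    also have "\<tau> = sqrt 2 * sqrt (h / real k)" by (simp add: \<tau>_def flip: real_sqrt_mult)
    also have "sqrt 2 \<le> 2" by (rule real_le_lsqrt) auto
    finally have "(T ^^ k) (gauss h) z \<le> 2 * sqrt (h / real k) + 1 / s0\<^sup>2 * (1 / h)"
      using h k by (simp add: mult_right_mono)
    also have "\<dots> \<le> (2 + 1 / s0\<^sup>2) * (sqrt (h / real k) + 1 / h)"
      using h by (simp add: algebra_simps)
    finally show ?thesis .
  qed
  moreover have "2 + 1 / s0\<^sup>2 > 0" using s0 by (simp add: add_pos_nonneg)
  ultimately show ?thesis by blast
qed

lemma mean_pos_part_pos: "0 < (\<integral>y. max y 0 \<partial>M)"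
proof -
  have i: "integrable M (\<lambda>y. max y 0)" using lin_integrable[of "\<lambda>y. max y 0" 0] by simp
  have "0 \<le> (\<integral>y. max y 0 \<partial>M)" by (intro Bochner_Integration.integral_nonneg) auto
  moreover have "(\<integral>y. max y 0 \<partial>M) \<noteq> 0"
  proof
    assume "(\<integral>y. max y 0 \<partial>M) = 0"
    then have "AE y in M. max y 0 = 0" using integral_nonneg_eq_0_iff_AE[OF i] by simp
    then have "AE y in M. y \<le> 0" by eventually_elim (auto simp: max_def split: if_splits)
    with not_AE_nonpos show False by simp
  qed
  ultimately show ?thesis by (simp add: less_le)
qed

text \<open>By \<open>concentration\<close> the walk leaves a window of width of order
  \<open>sqrt n\<close> with substantial probability, so its mean modulus is at least of that order;
  the walk being centred, the positive part carries half of it. Small \<open>n\<close> are covered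
  by convexity, which makes the mean positive part nondecreasing in \<open>n\<close>.\<close>

lemma Tn_pos_part_lower: "\<exists>c>0. \<forall>n\<ge>1. c * sqrt (real n) \<le> (T ^^ n) (\<lambda>z. max z 0) 0"
proof -
  let ?f = "\<lambda>z::real. max z 0"
  define a where "a = (\<integral>y. max y 0 \<partial>M)"
  have a: "a > 0" unfolding a_def by (rule mean_pos_part_pos)
  obtain C where C: "C > 0" "\<And>k h z. k \<ge> 1 \<Longrightarrow> h > 0 \<Longrightarrow> (T ^^ k) (gauss h) z \<le> C * (sqrt (h / real k) + 1 / h)"
    using concentration by blast
  \<comment> \<open>This makes \<open>C * q = 1/4\<close>; \<open>n0\<close> does the same for the
    error \<open>C / l^2\<close> at the scale \<open>l = q * sqrt n\<close>. Together the window
    gets weight at most 1/2.\<close>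
  define q where "q = 1 / (4 * C)"
  have q: "q > 0" using C by (simp add: q_def)
  obtain n0 :: nat where n0: "4 * C / q\<^sup>2 < real n0" using reals_Archimedean2 by blast
  have n0p: "0 < real n0" using n0 C q by (meson divide_pos_pos less_trans mult_pos_pos zero_less_numeral zero_less_power)
  have small: "a \<le> (T ^^ n) ?f 0" if "n \<ge> 1" for n
  proof -
    have ge: "?f z \<le> (T ^^ m) ?f z" for m z
    proof (induction m arbitrary: z)
      case (Suc m)
      have "?f z \<le> T ?f z" using T_mono[of "\<lambda>z. z" ?f z] T_mono[of "\<lambda>z. 0" ?f z] by (auto simp: T_id T_const)
      also have "\<dots> \<le> T ((T ^^ m) ?f) z" using Suc by (intro T_mono) auto
      finally show ?case by simp
    qed simp
    obtain m where "n = Suc m" using \<open>n \<ge> 1\<close> by (cases n) simp_all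
    then have "(T ^^ n) ?f 0 \<ge> T ?f 0" using ge by (auto intro!: T_mono)
    then show ?thesis by (simp add: a_def T_def)
  qed
  have large: "q / 4 * sqrt (real n) \<le> (T ^^ n) ?f 0" if n: "n \<ge> n0" for n
  proof -
    have np: "real n > 0" "n \<ge> 1" using n n0p by auto
    define l where "l = q * sqrt (real n)"
    have l: "l > 0" using q np by (simp add: l_def)
    have l2: "l\<^sup>2 = q\<^sup>2 * real n" by (simp add: l_def power_mult_distrib)
    have "(T ^^ n) (gauss (l\<^sup>2)) 0 \<le> C * (sqrt (l\<^sup>2 / real n) + 1 / l\<^sup>2)" using C(2)[OF np(2)] l by simp
    also have "sqrt (l\<^sup>2 / real n) = q" using np q by (simp add: l2)
    also have "C * (q + 1 / l\<^sup>2) \<le> 1/4 + 1/4"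
    proof -
      have "4 * C / q\<^sup>2 \<le> real n" using n n0 by linarith
      then have "4 * C \<le> l\<^sup>2" using q by (simp add: l2 field_simps)
      then have "C / l\<^sup>2 \<le> 1/4" using C l by (simp add: field_simps)
      moreover have "C * (q + 1 / l\<^sup>2) = 1/4 + C / l\<^sup>2" using C(1) by (simp add: q_def distrib_left)
      ultimately show ?thesis by linarith
    qed
    finally have g: "(T ^^ n) (gauss (l\<^sup>2)) 0 \<le> 1/2" by simp
    have pt: "l * (1 - gauss (l\<^sup>2) z) \<le> \<bar>z\<bar>" for z
    proof -
      define u where "u = \<bar>z\<bar> / l"
      have u: "u \<ge> 0" using l by (simp add: u_def)
      have "gauss (l\<^sup>2) z = exp (- u\<^sup>2 / 2)" by (simp add: gauss_def u_def power_divide)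
      moreover have "1 - u\<^sup>2/2 \<le> exp (- u\<^sup>2 / 2)" using exp_ge_add_one_self[of "-u\<^sup>2/2"] by simp
      moreover have "min 1 (u\<^sup>2/2) \<le> u"
      proof (cases "u \<le> 1")
        case True
        then have "u * u \<le> u * 1" using u by (intro mult_left_mono) auto
        then have "u\<^sup>2/2 \<le> u" using u by (simp add: power2_eq_square)
        then show ?thesis by simp
      qed auto
      moreover have "0 \<le> exp (- u\<^sup>2 / 2)" by simp
      ultimately have "1 - gauss (l\<^sup>2) z \<le> u" unfolding min_le_iff_disj by (elim disjE) linarith+
      then have "l * (1 - gauss (l\<^sup>2) z) \<le> l * u" using l by (intro mult_left_mono) auto
      then show ?thesis using l by (simp add: u_def)
    qed
    have e1: "(T ^^ n) (\<lambda>z. \<bar>z\<bar>) 0 \<ge> (T ^^ n) (\<lambda>z. l + (-l) * gauss (l\<^sup>2) z) 0"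
      using pt l by (intro Tn_mono lin_add lin_cmult lin_gauss lin_abs lin_const lin_id) (auto simp: algebra_simps)
    have "(T ^^ n) (\<lambda>z. l + (-l) * gauss (l\<^sup>2) z) = (\<lambda>x. l + (-l) * (T ^^ n) (gauss (l\<^sup>2)) x)"
      using Tn_add[OF lin_const[of l] lin_cmult[OF lin_gauss, of "l\<^sup>2" "-l"], of n] l
      by (simp only: Tn_cmult Tn_const zero_less_power)
    with e1 have "(T ^^ n) (\<lambda>z. \<bar>z\<bar>) 0 \<ge> l * (1 - (T ^^ n) (gauss (l\<^sup>2)) 0)" by (simp add: algebra_simps)
    moreover have "l * (1 - (T ^^ n) (gauss (l\<^sup>2)) 0) \<ge> l * (1/2)" using g l by (intro mult_left_mono) auto
    moreover have "(T ^^ n) ?f = (\<lambda>x. 1/2 * x + 1/2 * (T ^^ n) (\<lambda>z. \<bar>z\<bar>) x)"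
    proof -
      have "?f = (\<lambda>z. 1/2 * z + 1/2 * \<bar>z\<bar>)" by (auto simp: fun_eq_iff max_def)
      moreover have "(T ^^ n) (\<lambda>z. 1/2 * z + 1/2 * \<bar>z\<bar>) = (\<lambda>x. (T ^^ n) (\<lambda>z. 1/2 * z) x + (T ^^ n) (\<lambda>z. 1/2 * \<bar>z\<bar>) x)"
        by (rule Tn_add) (intro lin_cmult lin_id lin_abs)+
      ultimately show ?thesis unfolding Tn_cmult Tn_id by simp
    qed
    ultimately show ?thesis by (simp add: l_def)
  qed
  define c where "c = min (q/4) (a / sqrt n0)"
  have "c * sqrt (real n) \<le> (T ^^ n) ?f 0" if "n \<ge> 1" for n
  proof (cases "n \<ge> n0")
    case True
    have "c * sqrt n \<le> q/4 * sqrt n" unfolding c_def by (intro mult_right_mono min.cobounded1) auto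
    then show ?thesis using large[OF True] by simp
  next
    case False
    have "c * sqrt n \<le> a / sqrt n0 * sqrt n" by (intro mult_right_mono) (auto simp: c_def)
    also have "\<dots> \<le> a / sqrt n0 * sqrt n0" using False a by (intro mult_left_mono) auto
    also have "\<dots> = a" using n0p by simp
    finally show ?thesis using small[OF that] by simp
  qed
  moreover have "c > 0" using q a n0p by (simp add: c_def)
  ultimately show ?thesis by blast
qed


section \<open>The renewal function and the survival bound\<close>

definition einf :: "real \<Rightarrow> real" where "einf x = lim (\<lambda>n. e n x)"

text \<open>Start plus total mean overshoot, that is the mean of minus the walk at exit. It is the
  analytic form of V; \<open>V_eq\<close> makes the identification.\<close>

definition renewal :: "real \<Rightarrow> real" where "renewal x = x + einf x"

text \<open>\<open>e_bound\<close> covers nonnegative starts; one more step extends a linear bound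
  to the whole line. It supplies the dominating function in \<open>einf_fixed\<close>.\<close>

lemma e_dominated: "\<exists>f. lin_growth f \<and> (\<forall>n x. e n x \<le> f x)"
proof -
  obtain C where C: "C > 0" "\<And>n x. x \<ge> 0 \<Longrightarrow> e n x \<le> C * (1 + x) powr (1 - bet)" using e_bound by blast
  define g where "g x = C * (1 + \<bar>x\<bar>)" for x :: real
  have lg: "lin_growth g" unfolding g_def[abs_def] by (intro lin_cmult lin_add lin_const lin_abs lin_id)
  have eg: "e n x \<le> g x" if "x \<ge> 0" for n x
  proof -
    have "(1 + x) powr (1 - bet) \<le> (1 + x) powr 1" using that bet_pos by (intro powr_mono) auto
    then have "C * (1 + x) powr (1 - bet) \<le> C * (1 + x)" using C(1) that by (intro mult_left_mono) auto
    with C(2)[OF that, of n] that show ?thesis by (simp add: g_def)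
  qed
  have "e n x \<le> Q g x + G x" for n x
  proof (cases n)
    case 0
    have "0 \<le> Q g x" using lg C(1) by (intro Q_nonneg) (auto simp: g_def)
    then show ?thesis using 0 G_nonneg[of x] by simp
  next
    case (Suc m)
    have "Q (e m) x \<le> Q g x" using eg lg by (intro Q_mono) auto
    then show ?thesis by (simp add: Suc e_Suc)
  qed
  then show ?thesis using lin_add[OF lin_Q[OF lg] lin_G] by blast
qed

lemma e_tendsto: "(\<lambda>n. e n x) \<longlonglongrightarrow> einf x"
proof -
  obtain f where "\<And>n x. e n x \<le> f x" using e_dominated by blast
  then have "convergent (\<lambda>n. e n x)"
    using e_mono e_nonneg by (intro Bseq_mono_convergent BseqI'[of _ "f x"]) auto
  then show ?thesis unfolding einf_def by (simp add: convergent_LIMSEQ_iff)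
qed

lemma e_le_einf: "e n x \<le> einf x"
  by (rule incseq_le[OF _ e_tendsto]) (auto simp: incseq_def e_mono)

lemma einf_nonneg: "0 \<le> einf x" using e_le_einf[of 0 x] by simp

lemma einf_bound: "\<exists>C>0. \<forall>x\<ge>0. einf x \<le> C * (1 + x) powr (1 - bet)"
  using e_bound LIMSEQ_le_const2[OF e_tendsto] by meson

lemma lin_einf [simp, intro]: "lin_growth einf"
proof -
  obtain f where f: "lin_growth f" "\<And>n x. e n x \<le> f x" using e_dominated by blast
  then have ef: "einf x \<le> f x" for x using LIMSEQ_le_const2[OF e_tendsto] by blast
  have "einf \<in> borel_measurable borel"
    by (rule borel_measurable_LIMSEQ_real[OF e_tendsto]) (rule lin_meas[OF lin_e])
  moreover have "\<bar>einf x\<bar> \<le> \<bar>f x\<bar>" for x using ef[of x] einf_nonneg[of x] by linarith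
  ultimately show ?thesis by (rule lin_dom[OF f(1)])
qed

lemma lin_renewal [simp, intro]: "lin_growth renewal"
  unfolding renewal_def[abs_def] by auto

lemma einf_fixed: "einf x = Q einf x + G x"
proof -
  obtain f where f: "lin_growth f" "\<And>n x. e n x \<le> f x" using e_dominated by blast
  have "(\<lambda>n. Q (e n) x) \<longlonglongrightarrow> Q einf x"
    unfolding Q_def T_def
  proof (rule integral_dominated_convergence[where w="\<lambda>y. indicator {0..} (x + y) * f (x + y)"])
    show "integrable M (\<lambda>y. indicator {0..} (x + y) * f (x + y))"
      using lin_integrable[OF lin_ind[OF f(1)], of "{0..}" x] by simp
    have "lin_growth (\<lambda>y. indicator {0..} y * einf y)" by (intro lin_ind) auto
    from borel_measurable_integrable[OF lin_integrable[OF this, of x]]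
    show "(\<lambda>y. indicator {0..} (x + y) * einf (x + y)) \<in> borel_measurable M" by simp
    show "(\<lambda>y. indicator {0..} (x + y) * e i (x + y)) \<in> borel_measurable M" for i
    proof -
      have "lin_growth (\<lambda>y. indicator {0..} y * e i y)" by (intro lin_ind) auto
      from borel_measurable_integrable[OF lin_integrable[OF this, of x]] show ?thesis by simp
    qed
    show "AE y in M. (\<lambda>i. indicator {0..} (x + y) * e i (x + y)) \<longlonglongrightarrow> indicator {0..} (x + y) * einf (x + y)"
      by (intro AE_I2 tendsto_intros e_tendsto)
    show "AE y in M. norm (indicator {0..} (x + y) * e i (x + y)) \<le> indicator {0..} (x + y) * f (x + y)" for i
      using f e_nonneg by (auto simp: indicator_def)
  qed
  then have "(\<lambda>n. Q (e n) x + G x) \<longlonglongrightarrow> Q einf x + G x" by (intro tendsto_intros)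
  then have "(\<lambda>n. e (Suc n) x) \<longlonglongrightarrow> Q einf x + G x" by (simp add: e_Suc)
  then show ?thesis using LIMSEQ_Suc[OF e_tendsto[of x]] LIMSEQ_unique by blast
qed

text \<open>Harmonicity for the killed walk, at negative \<open>x\<close> as well; this is what
  later carries estimates from the half-line to negative starting points.\<close>

lemma renewal_fixed: "Q renewal x = renewal x"
proof -
  have "Q renewal x = Q (\<lambda>z. z) x + Q einf x"
    unfolding renewal_def[abs_def] by (subst Q_add) auto
  then show ?thesis using einf_fixed[of x] by (simp add: Q_id renewal_def)
qed

lemma renewal_ge: "x \<le> renewal x" by (simp add: renewal_def einf_nonneg)

lemma renewal_nonneg: "0 \<le> renewal x"
proof -
  have "0 \<le> Q renewal x" using renewal_ge order_trans by (intro Q_nonneg) blast+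
  then show ?thesis by (simp add: renewal_fixed)
qed

text \<open>The bound by \<open>x\<close> degenerates at 0; there the first step alone contributes
  the positive mean of the positive part of a jump.\<close>

lemma renewal_lower: "\<exists>c>0. \<forall>x\<ge>0. c * (1 + x) \<le> renewal x"
proof -
  define a where "a = (\<integral>y. max y 0 \<partial>M)"
  have a: "a > 0" unfolding a_def by (rule mean_pos_part_pos)
  have "a \<le> renewal x" if x: "x \<ge> 0" for x
  proof -
    have "a \<le> (\<integral>y. max (x + y) 0 \<partial>M)"
      unfolding a_def using x lin_integrable[of "\<lambda>y. max y 0" 0] lin_integrable[of "\<lambda>y. max y 0" x]
      by (intro integral_mono) auto
    also have "\<dots> = Q (\<lambda>z. z) x"
      unfolding Q_def T_def by (intro Bochner_Integration.integral_cong) (auto simp: indicator_def max_def)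
    also have "\<dots> \<le> Q renewal x" using renewal_ge by (intro Q_mono) auto
    finally show ?thesis by (simp add: renewal_fixed)
  qed
  then have "min a 1 / 2 * (1 + x) \<le> renewal x" if "x \<ge> 0" for x
  proof -
    have "min a 1 * 1 \<le> a" "min a 1 * x \<le> 1 * x" using that a mult_right_mono[of "min a 1" 1 x] by auto
    with \<open>\<And>x. x \<ge> 0 \<Longrightarrow> a \<le> renewal x\<close>[OF that] renewal_ge[of x] show ?thesis by (simp add: algebra_simps)
  qed
  moreover have "min a 1 / 2 > 0" using a by simp
  ultimately show ?thesis by blast
qed

lemma renewal_upper: "\<exists>C>0. \<forall>x\<ge>0. renewal x \<le> C * (1 + x)"
proof -
  obtain C where C: "C > 0" "\<And>x. x \<ge> 0 \<Longrightarrow> einf x \<le> C * (1 + x) powr (1 - bet)" using einf_bound by blast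
  have "renewal x \<le> (1 + C) * (1 + x)" if x: "x \<ge> 0" for x
  proof -
    have "(1 + x) powr (1 - bet) \<le> (1 + x) powr 1" using x bet_pos by (intro powr_mono) auto
    then have "C * (1 + x) powr (1 - bet) \<le> C * (1 + x)" using C(1) x by (intro mult_left_mono) auto
    with C(2)[OF x] x show ?thesis by (simp add: renewal_def algebra_simps)
  qed
  then show ?thesis using C(1) by (intro exI[of _ "1 + C"]) auto
qed

lemma Qn_id_le_renewal: "(Q ^^ n) (\<lambda>z. z) x \<le> renewal x"
  by (simp add: Qn_id renewal_def e_le_einf)

text \<open>Apply \<open>Qn_association\<close> to the positive part: \<open>p n x\<close> times a
  quantity of order at least \<open>sqrt n\<close> is at most the mean of the surviving position,
  which \<open>renewal\<close> bounds. Writing \<open>Suc n\<close> includes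
  \<open>n = 0\<close>.\<close>

lemma p_upper: "\<exists>C>0. \<forall>n. \<forall>x\<ge>0. p n x \<le> C * renewal x / sqrt (real (Suc n))"
proof -
  obtain c where c: "c > 0" "\<And>n. n \<ge> 1 \<Longrightarrow> c * sqrt (real n) \<le> (T ^^ n) (\<lambda>z. max z 0) 0"
    using Tn_pos_part_lower by blast
  obtain d where d: "d > 0" "\<And>x. x \<ge> 0 \<Longrightarrow> d * (1 + x) \<le> renewal x" using renewal_lower by blast
  have "p n x \<le> (2 / c + 1 / d) * renewal x / sqrt (real (Suc n))" if x: "x \<ge> 0" for n x
  proof (cases "n = 0")
    case True
    have "1 * d \<le> d * (1 + x)" using d x by simp
    also have "\<dots> \<le> renewal x" using d x by blast
    finally have "1 \<le> 1 / d * renewal x" using d by (simp add: field_simps)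
    also have "\<dots> \<le> (2 / c + 1 / d) * renewal x" using c renewal_nonneg[of x] by (intro mult_right_mono) auto
    finally show ?thesis using True by simp
  next
    case False
    let ?f = "\<lambda>z::real. max z 0"
    have mf: "mono ?f" by (auto intro!: monoI)
    have "p n x * (c * sqrt (real n)) \<le> p n x * (T ^^ n) ?f x"
    proof (intro mult_left_mono p_ge_0)
      show "c * sqrt (real n) \<le> (T ^^ n) ?f x"
        using c(2)[of n] False monoD[OF mono_Tn[OF _ mf, of n] x] by force
    qed
    also have "\<dots> \<le> (Q ^^ n) ?f x" using Qn_association[of ?f n x] mf x by auto
    also have "\<dots> \<le> (Q ^^ n) (\<lambda>z. z) x" using x by (intro Qn_mono) auto
    also have "\<dots> \<le> renewal x" by (rule Qn_id_le_renewal)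
    finally have 1: "p n x * (c * sqrt (real n)) \<le> renewal x" .
    have "sqrt (real (Suc n)) \<le> sqrt (4 * real n)" using False by (intro real_sqrt_le_mono) auto
    also have "\<dots> = 2 * sqrt (real n)" by (simp add: real_sqrt_mult)
    finally have "p n x * c * sqrt (real (Suc n)) \<le> p n x * c * (2 * sqrt (real n))"
      using c p_ge_0[of n x] by (intro mult_left_mono) auto
    also have "\<dots> \<le> 2 * renewal x" using 1 by (simp add: algebra_simps)
    finally have "p n x \<le> 2 / c * renewal x / sqrt (real (Suc n))" using c by (simp add: field_simps)
    also have "\<dots> \<le> (2 / c + 1 / d) * renewal x / sqrt (real (Suc n))"
      using d renewal_nonneg[of x] by (intro divide_right_mono mult_right_mono) auto
    finally show ?thesis .
  qed
  moreover have "2 / c + 1 / d > 0" using c d by (simp add: add_pos_pos)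
  ultimately show ?thesis by blast
qed

text \<open>The majorant of the overshoot from \<open>e_bound\<close>, extended evenly so that it
  has linear growth on the whole line.\<close>

definition pw :: "real \<Rightarrow> real" where "pw z = (1 + \<bar>z\<bar>) powr (1 - bet)"

lemma lin_pw [simp, intro]: "lin_growth pw"
proof (rule lin_growthI[where C=1])
  fix z :: real
  have "(1 + \<bar>z\<bar>) powr (1 - bet) \<le> (1 + \<bar>z\<bar>) powr 1" using bet_pos by (intro powr_mono) auto
  then show "\<bar>pw z\<bar> \<le> 1 * (1 + \<bar>z\<bar>)" by (simp add: pw_def)
qed (simp add: pw_def[abs_def])

text \<open>Interpolating the concave power between \<open>P(\<tau> > k)\<close> and \<open>E(x + S\<^sub>k; \<tau> > k)\<close> at scale \<open>\<surd>k\<close>.\<close>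

lemma Qn_pw_upper: "\<exists>C>0. \<forall>k\<ge>1. \<forall>x\<ge>0. (Q ^^ k) pw x \<le> C * renewal x * real k powr (- bet / 2)"
proof -
  obtain C where C: "C > 0" "\<And>n x. x \<ge> 0 \<Longrightarrow> p n x \<le> C * renewal x / sqrt (real (Suc n))" using p_upper by blast
  have "(Q ^^ k) pw x \<le> (1 + 2 * C) * renewal x * real k powr (- bet / 2)" if k: "k \<ge> 1" and x: "x \<ge> 0" for k x
  proof -
    define l where "l = sqrt (real k)"
    have l: "l \<ge> 1" using k by (simp add: l_def)
    have pt: "pw z \<le> (l powr (1 - bet) + l powr (- bet)) * 1 + l powr (- bet) * z" if z: "z \<ge> 0" for z
    proof -
      have "pw z \<le> l powr (1 - bet) + l powr (- bet) * (1 + z)"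
      proof (cases "1 + z \<le> l")
        case True
        then have "pw z \<le> l powr (1 - bet)" unfolding pw_def using z bet_lt_1 by (intro powr_mono2) auto
        then show ?thesis using z by (simp add: add_increasing2)
      next
        case False
        have "pw z = (1 + z) powr (- bet) * (1 + z)" using z by (simp add: pw_def powr_diff powr_minus field_simps)
        also have "\<dots> \<le> l powr (- bet) * (1 + z)"
          using False z l bet_pos by (intro mult_right_mono powr_mono2') auto
        finally show ?thesis by (simp add: add_increasing)
      qed
      then show ?thesis by (simp add: algebra_simps)
    qed
    define a where "a = l powr (1 - bet) + l powr (- bet)"
    have "(Q ^^ k) pw x \<le> (Q ^^ k) (\<lambda>z. a * 1 + l powr (- bet) * z) x"
      using x pt unfolding a_def by (intro Qn_mono lin_add lin_cmult lin_id lin_const lin_pw) auto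
    also have "\<dots> = a * p k x + l powr (- bet) * (Q ^^ k) (\<lambda>z. z) x"
      using Qn_add[OF lin_cmult[OF lin_const[of 1], of a] lin_cmult[OF lin_id, of "l powr (- bet)"], of k]
      by (simp only: Qn_cmult)
    also have "\<dots> \<le> a * p k x + l powr (- bet) * renewal x"
      by (rule add_left_mono[OF mult_left_mono[OF Qn_id_le_renewal]]) (rule powr_ge_zero)
    finally have 1: "(Q ^^ k) pw x \<le> a * p k x + l powr (- bet) * renewal x" .
    have al: "a \<le> 2 * l powr (1 - bet)" using l unfolding a_def by (simp add: powr_mono)
    have "p k x \<le> C * renewal x / sqrt (real (Suc k))" using C(2) x by blast
    also have "\<dots> \<le> C * renewal x / l"
      using k C(1) renewal_nonneg[of x] by (intro divide_left_mono) (auto simp: l_def)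
    finally have pk: "p k x \<le> C * renewal x / l" .
    have "a * p k x \<le> 2 * l powr (1 - bet) * (C * renewal x / l)"
      using al pk p_ge_0[of k x] by (intro mult_mono) auto
    with 1 have "(Q ^^ k) pw x \<le> 2 * l powr (1 - bet) * (C * renewal x / l) + l powr (- bet) * renewal x"
      by linarith
    also have "\<dots> = (1 + 2 * C) * renewal x * l powr (- bet)"
    proof -
      have "l powr (1 - bet) = l * l powr (- bet)" using l powr_add[of l 1 "- bet"] by simp
      then have "2 * l powr (1 - bet) * (C * renewal x / l) = 2 * C * renewal x * l powr (- bet)" using l by simp
      then show ?thesis by (simp only: ring_distribs) simp
    qed
    also have "l powr (- bet) = real k powr (- bet / 2)"
      using k by (simp add: l_def powr_half_sqrt[symmetric] powr_powr)
    finally show ?thesis .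
  qed
  then show ?thesis using C(1) by (intro exI[of _ "1 + 2 * C"]) auto
qed

text \<open>The overshoot collected after time \<open>k\<close>: restart at \<open>k\<close>, bound
  the future by \<open>e_bound\<close>, average by \<open>Qn_pw_upper\<close>, and only then let the
  horizon tend to infinity.\<close>

lemma e_tail: "\<exists>C>0. \<forall>k\<ge>1. \<forall>x\<ge>0. einf x - e k x \<le> C * renewal x * real k powr (- bet / 2)"
proof -
  obtain C where C: "C > 0" "\<And>k x. k \<ge> 1 \<Longrightarrow> x \<ge> 0 \<Longrightarrow> (Q ^^ k) pw x \<le> C * renewal x * real k powr (- bet / 2)"
    using Qn_pw_upper by blast
  obtain D where D: "D > 0" "\<And>n x. x \<ge> 0 \<Longrightarrow> e n x \<le> D * (1 + x) powr (1 - bet)" using e_bound by blast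
  have "einf x - e k x \<le> D * C * renewal x * real k powr (- bet / 2)" if k: "k \<ge> 1" and x: "x \<ge> 0" for k x
  proof -
    have b: "e (k + n) x - e k x \<le> D * C * renewal x * real k powr (- bet / 2)" for n
    proof -
      have "e (k + n) x - e k x = (Q ^^ k) (e n) x" by (simp add: Qn_e)
      also have "\<dots> \<le> (Q ^^ k) (\<lambda>z. D * pw z) x"
        using D(2) x by (intro Qn_mono lin_cmult lin_e lin_pw) (auto simp: pw_def)
      also have "\<dots> = D * (Q ^^ k) pw x" by (simp add: Qn_cmult)
      also have "\<dots> \<le> D * (C * renewal x * real k powr (- bet / 2))" using C(2)[OF k x] D by (intro mult_left_mono) auto
      finally show ?thesis by (simp add: mult.assoc)
    qed
    have "(\<lambda>n. e (n + k) x - e k x) \<longlonglongrightarrow> einf x - e k x"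
      by (intro tendsto_intros LIMSEQ_ignore_initial_segment e_tendsto)
    then show ?thesis by (rule LIMSEQ_le_const2) (use b in \<open>auto simp: add.commute\<close>)
  qed
  then show ?thesis using C(1) D(1) by (intro exI[of _ "D * C"]) auto
qed

end

subsection \<open>Comparison with the heat kernel\<close>

definition bm_surv :: "real \<Rightarrow> real \<Rightarrow> real" where "bm_surv t z = H (z / sqrt t)"

text \<open>\<open>bm_surv t z / z\<close> with its singularity at 0 removed. For unit variance the
  main term of the theorem is \<open>renewal x * bm_ratio n x\<close>.\<close>

definition bm_ratio :: "real \<Rightarrow> real \<Rightarrow> real" where "bm_ratio t z = L (z / sqrt t) / sqrt t"

lemma bm_surv_eq_l: "t > 0 \<Longrightarrow> bm_surv t z = z * bm_ratio t z"
  using L_mult[of "z / sqrt t"] by (simp add: bm_surv_def bm_ratio_def mult.commute)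

lemma H_measurable [measurable]: "H \<in> borel_measurable borel"
  by (rule borel_measurable_mono) (auto intro!: monoI H_mono)

lemma lin_bm_surv [simp, intro]: "lin_growth (bm_surv t)"
proof (rule lin_bdd[where C=1])
  show "bm_surv t \<in> borel_measurable borel" unfolding bm_surv_def[abs_def] by measurable
  show "\<bar>bm_surv t z\<bar> \<le> 1" for z using H_bounds[of "z / sqrt t"] by (auto simp: bm_surv_def)
qed

lemma bm_ratio_nonneg: "0 \<le> t \<Longrightarrow> 0 \<le> bm_ratio t z" by (simp add: bm_ratio_def L_nonneg)

lemma bm_ratio_le: "0 \<le> t \<Longrightarrow> bm_ratio t z \<le> 1 / sqrt t"
  unfolding bm_ratio_def by (intro divide_right_mono L_le_1) auto

lemma bm_ratio_le_inverse: assumes "0 < t" "z > 0" shows "bm_ratio t z \<le> 1 / z"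
proof -
  have "bm_ratio t z * z = L (z / sqrt t) * \<bar>z / sqrt t\<bar>" using assms by (simp add: bm_ratio_def)
  also have "\<dots> \<le> 1" by (rule L_abs_mult_le_1)
  finally show ?thesis using assms by (simp add: field_simps)
qed

text \<open>Freezes the kernel at exit to its value at the start, passing through position 0 and
  then changing the time. Taking the minimum with 1 leaves a factor that can be multiplied by an
  overshoot of which only low moments are used.\<close>

lemma bm_ratio_diff:
  assumes N: "N > 0" and t: "t \<ge> N / 2"
  shows "\<bar>bm_ratio t z - bm_ratio N x\<bar> \<le> 4 / sqrt N * (min 1 (\<bar>z\<bar> / sqrt N) + \<bar>t - N\<bar> / N + \<bar>x\<bar> / sqrt N)"
proof -
  have t0: "t > 0" using assms by linarith
  have "sqrt (N / 2) \<le> sqrt t" using t by (rule real_sqrt_le_mono)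
  moreover have "sqrt N = sqrt 2 * sqrt (N / 2)" by (simp flip: real_sqrt_mult)
  ultimately have "sqrt N \<le> sqrt 2 * sqrt t" by simp
  then have it: "1 / sqrt t \<le> sqrt 2 / sqrt N" using N t0 by (simp add: field_simps)
  have s2: "sqrt 2 \<le> 2" by (rule real_le_lsqrt) auto
  have A: "\<bar>L (z / sqrt t) - L 0\<bar> / sqrt t \<le> 2 / sqrt N * min 1 (\<bar>z\<bar> / sqrt N)"
  proof -
    have "\<bar>z\<bar> / sqrt t \<le> sqrt 2 * (\<bar>z\<bar> / sqrt N)" using mult_left_mono[OF it, of "\<bar>z\<bar>"] by (simp add: ac_simps)
    then have 1: "\<bar>L (z / sqrt t) - L 0\<bar> \<le> sqrt 2 * (\<bar>z\<bar> / sqrt N)"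
      using L_Lipschitz_0[of "z / sqrt t"] t0 by simp
    have 2: "\<bar>L (z / sqrt t) - L 0\<bar> \<le> sqrt 2 * 1"
    proof -
      have "1 \<le> sqrt 2" by simp
      then show ?thesis
        using L_nonneg[of "z / sqrt t"] L_nonneg[of 0] L_le_1[of "z / sqrt t"] L_le_1[of 0] by linarith
    qed
    have "\<bar>L (z / sqrt t) - L 0\<bar> \<le> sqrt 2 * min 1 (\<bar>z\<bar> / sqrt N)"
      using 1 2 by (simp add: min_def)
    then have "\<bar>L (z / sqrt t) - L 0\<bar> * (1 / sqrt t) \<le> (sqrt 2 * min 1 (\<bar>z\<bar> / sqrt N)) * (sqrt 2 / sqrt N)"
      using t0 N by (intro mult_mono it) auto
    also have "\<dots> = (sqrt 2 * sqrt 2) / sqrt N * min 1 (\<bar>z\<bar> / sqrt N)" by (simp only: times_divide_eq_right times_divide_eq_left ac_simps)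
    finally show ?thesis by simp
  qed
  have B: "\<bar>1 / sqrt t - 1 / sqrt N\<bar> \<le> 2 / sqrt N * (\<bar>t - N\<bar> / N)"
  proof -
    have "1 / sqrt t - 1 / sqrt N = (sqrt N - sqrt t) / (sqrt t * sqrt N)" using t0 N by (simp add: field_simps)
    also have "\<dots> = (N - t) / (sqrt t * sqrt N * (sqrt N + sqrt t))"
    proof -
      have "N - t = (sqrt N - sqrt t) * (sqrt N + sqrt t)" using t0 N by (simp add: algebra_simps)
      moreover have "sqrt N + sqrt t > 0" using t0 N by (simp add: add_pos_pos)
      ultimately show ?thesis by simp
    qed
    finally have "\<bar>1 / sqrt t - 1 / sqrt N\<bar> = \<bar>t - N\<bar> / (sqrt t * (sqrt N * (sqrt N + sqrt t)))"
      using t0 N by (simp add: abs_mult abs_divide abs_minus_commute add_nonneg_nonneg mult.assoc)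
    also have "\<dots> \<le> \<bar>t - N\<bar> / (sqrt t * N)"
    proof (intro divide_left_mono mult_left_mono mult_pos_pos)
      show "N \<le> sqrt N * (sqrt N + sqrt t)" using t0 N by (simp add: distrib_left)
    qed (use t0 N in \<open>auto intro: add_pos_pos\<close>)
    also have "\<dots> = \<bar>t - N\<bar> / N * (1 / sqrt t)" by simp
    also have "\<dots> \<le> \<bar>t - N\<bar> / N * (2 / sqrt N)"
      using N order_trans[OF it divide_right_mono[OF s2, of "sqrt N"]] by (intro mult_left_mono) auto
    finally show ?thesis by (simp add: mult.commute)
  qed
  have C: "\<bar>L 0 - L (x / sqrt N)\<bar> / sqrt N \<le> 1 / sqrt N * (\<bar>x\<bar> / sqrt N)"
  proof -
    have "\<bar>L 0 - L (x / sqrt N)\<bar> \<le> \<bar>x\<bar> / sqrt N" using L_Lipschitz_0[of "x / sqrt N"] N by (simp add: abs_minus_commute)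
    then have "\<bar>L 0 - L (x / sqrt N)\<bar> / sqrt N \<le> \<bar>x\<bar> / sqrt N / sqrt N" using N by (intro divide_right_mono) auto
    then show ?thesis by simp
  qed
  have "bm_ratio t z - bm_ratio N x = (L (z / sqrt t) - L 0) / sqrt t + L 0 * (1 / sqrt t - 1 / sqrt N) + (L 0 - L (x / sqrt N)) / sqrt N"
    by (simp add: bm_ratio_def diff_divide_distrib algebra_simps)
  also have "\<bar>\<dots>\<bar> \<le> \<bar>(L (z / sqrt t) - L 0) / sqrt t\<bar> + \<bar>L 0 * (1 / sqrt t - 1 / sqrt N)\<bar> + \<bar>(L 0 - L (x / sqrt N)) / sqrt N\<bar>"
    by linarith
  also have "\<dots> = \<bar>L (z / sqrt t) - L 0\<bar> / sqrt t + L 0 * \<bar>1 / sqrt t - 1 / sqrt N\<bar> + \<bar>L 0 - L (x / sqrt N)\<bar> / sqrt N"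
    using t0 N L_nonneg[of 0] by (simp add: abs_mult)
  finally have "\<bar>bm_ratio t z - bm_ratio N x\<bar> \<le> \<bar>L (z / sqrt t) - L 0\<bar> / sqrt t + L 0 * \<bar>1 / sqrt t - 1 / sqrt N\<bar> + \<bar>L 0 - L (x / sqrt N)\<bar> / sqrt N" .
  moreover have "L 0 * \<bar>1 / sqrt t - 1 / sqrt N\<bar> \<le> 1 * \<bar>1 / sqrt t - 1 / sqrt N\<bar>"
    using L_le_1[of 0] by (intro mult_right_mono) auto
  ultimately have "\<bar>bm_ratio t z - bm_ratio N x\<bar> \<le> 2 / sqrt N * min 1 (\<bar>z\<bar> / sqrt N) + 2 / sqrt N * (\<bar>t - N\<bar> / N) + 1 / sqrt N * (\<bar>x\<bar> / sqrt N)"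
    using A B C by linarith
  also have "\<dots> \<le> 4 / sqrt N * min 1 (\<bar>z\<bar> / sqrt N) + 4 / sqrt N * (\<bar>t - N\<bar> / N) + 4 / sqrt N * (\<bar>x\<bar> / sqrt N)"
    using N by (intro add_mono mult_right_mono divide_right_mono) auto
  finally show ?thesis by (simp only: distrib_left)
qed

lemma bm_surv_time_diff:
  assumes N: "N > 0" and h: "0 < h" "h \<le> N"
  shows "\<bar>bm_surv (h + N) x - bm_surv N x\<bar> \<le> 24 * (h / N)"
proof -
  define r where "r = h / N"
  have r: "0 < r" "r \<le> 1" using assms by (auto simp: r_def)
  define u where "u = x / sqrt N"
  have "h + N = N * (1 + r)" using N by (simp add: r_def field_simps)
  then have "sqrt (h + N) = sqrt N * sqrt (1 + r)" by (simp only: real_sqrt_mult)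
  then have e: "x / sqrt (h + N) = u / sqrt (1 + r)" by (simp add: u_def)
  have "\<bar>bm_surv (h + N) x - bm_surv N x + r * (u * phi u)\<bar> \<le> 16 * r\<^sup>2"
    unfolding bm_surv_def e u_def[symmetric] by (rule H_time_Taylor[OF r(1)])
  moreover have "\<bar>r * (u * phi u)\<bar> = r * (\<bar>u\<bar>^1 * phi u)" using r by (simp add: abs_mult)
  moreover have "r * (\<bar>u\<bar>^1 * phi u) \<le> r * 8" using r by (intro mult_left_mono power_phi_le) auto
  moreover have "r\<^sup>2 \<le> r * 1" using r unfolding power2_eq_square by (intro mult_left_mono) auto
  ultimately have "\<bar>bm_surv (h + N) x - bm_surv N x\<bar> \<le> 24 * r" by linarith
  then show ?thesis by (simp add: r_def)
qed

text \<open>Near 0 the error must be comparable with \<open>V(x) / sqrt N\<close>, so the factor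
  \<open>x / sqrt N\<close> has to survive. Hence the difference is taken for
  \<open>bm_ratio\<close>, using that \<open>L\<close> is Lipschitz.\<close>

lemma bm_surv_time_diff_near:
  assumes N: "N > 0" and h: "0 < h" and x: "0 \<le> x" "x \<le> sqrt N"
  shows "\<bar>bm_surv (h + N) x - bm_surv N x\<bar> \<le> 2 * x / sqrt N * (h / N)"
proof -
  define q where "q = sqrt (N / (h + N))"
  have q: "0 < q" "q \<le> 1" "q\<^sup>2 = N / (h + N)" using N h by (auto simp: q_def)
  have "1 - q \<le> 1 - q\<^sup>2" using q mult_left_mono[of q 1 q] by (simp add: power2_eq_square)
  also have "\<dots> = h / (h + N)" using N h q by (simp add: field_simps)
  also have "\<dots> \<le> h / N" using N h by (intro divide_left_mono) auto
  finally have q1: "1 - q \<le> h / N" .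
  define u where "u = x / sqrt N"
  have u: "0 \<le> u" "u \<le> 1" using x N by (auto simp: u_def)
  have e: "x / sqrt (h + N) = u * q" "1 / sqrt (h + N) = q / sqrt N"
    using N h by (auto simp: u_def q_def real_sqrt_divide)
  have "bm_ratio (h + N) x - bm_ratio N x = (L (u * q) * q - L u) / sqrt N"
  proof -
    have "bm_ratio (h + N) x = L (u * q) * (1 / sqrt (h + N))" by (simp add: bm_ratio_def e(1))
    then show ?thesis unfolding e(2) by (simp add: bm_ratio_def u_def diff_divide_distrib)
  qed
  also have "L (u * q) * q - L u = (L (u * q) - L u) * q - L u * (1 - q)" by (simp add: algebra_simps)
  finally have d: "bm_ratio (h + N) x - bm_ratio N x = ((L (u * q) - L u) * q - L u * (1 - q)) / sqrt N" .
  have "\<bar>L (u * q) - L u\<bar> \<le> u * (1 - q)"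
  proof -
    have "u * q \<le> u * 1" using u q by (intro mult_left_mono) auto
    then have "\<bar>u * q - u\<bar> = u * (1 - q)" by (simp add: algebra_simps)
    then show ?thesis using L_Lipschitz[of "u * q" u] by simp
  qed
  also have "\<dots> \<le> 1 * (h / N)" using u q q1 by (intro mult_mono) auto
  finally have "\<bar>L (u * q) - L u\<bar> * q \<le> (h / N) * 1" using q N h by (intro mult_mono) auto
  moreover have "L u * (1 - q) \<le> 1 * (h / N)" using L_le_1[of u] q q1 by (intro mult_mono) auto
  ultimately have "\<bar>(L (u * q) - L u) * q - L u * (1 - q)\<bar> \<le> 2 * (h / N)"
    using q L_nonneg[of u] by (intro order_trans[OF abs_triangle_ineq4]) (simp add: abs_mult)
  then have "\<bar>bm_ratio (h + N) x - bm_ratio N x\<bar> \<le> 2 * (h / N) / sqrt N"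
    unfolding d abs_divide using N by (simp only: real_sqrt_abs2 abs_of_pos real_sqrt_gt_zero) (rule divide_right_mono, auto)
  then have "x * \<bar>bm_ratio (h + N) x - bm_ratio N x\<bar> \<le> x * (2 * (h / N) / sqrt N)" using x by (intro mult_left_mono)
  moreover have "\<bar>bm_surv (h + N) x - bm_surv N x\<bar> = x * \<bar>bm_ratio (h + N) x - bm_ratio N x\<bar>"
    using N h x by (simp add: bm_surv_eq_l right_diff_distrib[symmetric] abs_mult del: right_diff_distrib)
  ultimately show ?thesis by (simp add: field_simps)
qed


text \<open>Mean value theorem and telescoping. The factor 4 bounds \<open>2 powr (1 + b)\<close>:
  over a unit interval the argument at most doubles, as \<open>h >= 1\<close>.\<close>

lemma sum_powr_tail:
  fixes b h :: real
  assumes b: "0 < b" "b \<le> 1" and h: "h \<ge> 1"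
  shows "(\<Sum>j<n. (h + real j) powr (- 1 - b)) \<le> 4 / b * h powr (- b)"
proof -
  have step: "(h + real j) powr (- 1 - b) \<le> 4 / b * ((h + real j) powr (- b) - (h + real (Suc j)) powr (- b))" for j
  proof -
    define a where "a = h + real j"
    have a: "a \<ge> 1" using h by (simp add: a_def)
    have "\<exists>z>a. z < a + 1 \<and> (a + 1) powr (- b) - a powr (- b) = (a + 1 - a) * (- b * z powr (- b - 1))"
      using a by (intro MVT2) (auto intro!: derivative_eq_intros simp: field_simps)
    then obtain z where z: "a < z" "z < a + 1" "a powr (- b) - (a + 1) powr (- b) = b * z powr (- b - 1)" by auto
    have "a powr (- 1 - b) = 2 powr (1 + b) * (2 * a) powr (- 1 - b)" using a by (simp add: powr_mult powr_add[symmetric] mult.assoc[symmetric])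
    also have "\<dots> \<le> 4 * z powr (- b - 1)"
    proof (intro mult_mono)
      have "(2::real) powr (1 + b) \<le> 2 powr 2" using b by (intro powr_mono) auto
      then show "(2::real) powr (1 + b) \<le> 4" by simp
      have "(2 * a) powr (- 1 - b) \<le> z powr (- 1 - b)" using a z b by (intro powr_mono2') auto
      moreover have "- 1 - b = - b - 1" by simp
      ultimately show "(2 * a) powr (- 1 - b) \<le> z powr (- b - 1)" by metis
    qed auto
    also have "\<dots> = 4 / b * (a powr (- b) - (a + 1) powr (- b))" using z b by simp
    finally show ?thesis by (simp add: a_def ac_simps)
  qed
  have "(\<Sum>j<n. (h + real j) powr (- 1 - b)) \<le> (\<Sum>j<n. 4 / b * ((h + real j) powr (- b) - (h + real (Suc j)) powr (- b)))"
    by (intro sum_mono step)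
  also have "\<dots> = 4 / b * (h powr (- b) - (h + real n) powr (- b))"
    unfolding sum_distrib_left[symmetric] using sum_lessThan_telescope'[of "\<lambda>j. (h + real j) powr (- b)" n] by simp
  also have "\<dots> \<le> 4 / b * h powr (- b)" using b by (intro mult_left_mono) auto
  finally show ?thesis .
qed

lemma sum_inverse_sqrt: "(\<Sum>k<n. 1 / sqrt (real (Suc k))) \<le> 2 * sqrt (real n)"
proof (induction n)
  case (Suc n)
  define a b where "a = sqrt (real n)" and "b = sqrt (real (Suc n))"
  have ab: "0 \<le> a" "a \<le> b" "0 < b" "b * b - a * a = 1" by (auto simp: a_def b_def)
  have "1 = (b - a) * (b + a)" using ab by (simp add: algebra_simps)
  also have "\<dots> \<le> (b - a) * (2 * b)" using ab by (intro mult_left_mono) auto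
  finally have "1 / b \<le> 2 * b - 2 * a" using ab by (simp add: field_simps)
  then show ?case using Suc by (simp add: a_def b_def)
qed simp

section \<open>One-step errors and the telescoped expansion\<close>

context walk_law
begin

lemma one_minus_bm_surv_le_gauss: "h > 0 \<Longrightarrow> z \<ge> 0 \<Longrightarrow> 1 - bm_surv h z \<le> gauss h z"
  using H_tail[of "z / sqrt h"] by (simp add: bm_surv_def gauss_def power_divide mult.commute)

text \<open>Mean of minus the odd extension over positions reached by exiting in the next
  step.\<close>

definition Ov :: "real \<Rightarrow> real \<Rightarrow> real" where
  "Ov t = T (\<lambda>z. indicator {..<0} z * - bm_surv t z)"

text \<open>Lindeberg's replacement error: one unit of heat flow against one step of the
  walk.\<close>

definition lerr :: "real \<Rightarrow> real \<Rightarrow> real" where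
  "lerr t z = bm_surv (t + 1) z - T (bm_surv t) z"

lemma lin_Ov [simp, intro]: "lin_growth (Ov t)"
  unfolding Ov_def by (intro lin_T lin_ind lin_minus lin_bm_surv) auto

lemma lin_lerr [simp, intro]: "lin_growth (lerr t)"
  unfolding lerr_def[abs_def] by (intro lin_diff lin_T lin_bm_surv)

lemma T_eq_Q_Ov: "T (bm_surv t) z = Q (bm_surv t) z - Ov t z"
proof -
  have "T (bm_surv t) z = T (\<lambda>y. indicator {0..} y * bm_surv t y + -1 * (indicator {..<0} y * - bm_surv t y)) z"
    by (intro arg_cong2[where f=T] refl ext) (auto simp: indicator_def)
  also have "\<dots> = Q (bm_surv t) z + -1 * Ov t z"
    unfolding Q_def Ov_def
    by (subst T_add) (auto intro!: lin_ind lin_minus lin_bm_surv lin_cmult simp: T_cmult[of "-1", simplified])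
  finally show ?thesis by simp
qed

text \<open>Duhamel's formula: \<open>bm_surv (t + 1)\<close> is \<open>T (bm_surv t)\<close> plus
  \<open>lerr t\<close>, and \<open>T_eq_Q_Ov\<close> splits off the exits; iterate. The step made
  after \<open>k\<close> survived ones leaves the time \<open>h + (n - 1 - k)\<close>.\<close>

lemma decomposition:
  "bm_surv (h + real n) x = (Q ^^ n) (bm_surv h) x - (\<Sum>k<n. (Q ^^ k) (Ov (h + real (n - 1 - k))) x)
     + (\<Sum>k<n. (Q ^^ k) (lerr (h + real (n - 1 - k))) x)"
proof (induction n arbitrary: x)
  case (Suc n)
  let ?A = "\<lambda>z. \<Sum>k<n. (Q ^^ k) (Ov (h + real (n - 1 - k))) z"
  let ?B = "\<lambda>z. \<Sum>k<n. (Q ^^ k) (lerr (h + real (n - 1 - k))) z"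
  have e1: "bm_surv (h + real n) = (\<lambda>z. (Q ^^ n) (bm_surv h) z - ?A z + ?B z)" using Suc.IH by blast
  have "Q (bm_surv (h + real n)) x = (Q ^^ 1) (\<lambda>z. (Q ^^ n) (bm_surv h) z - ?A z + ?B z) x" using e1 by simp
  also have "\<dots> = (Q ^^ 1) ((Q ^^ n) (bm_surv h)) x - (Q ^^ 1) ?A x + (Q ^^ 1) ?B x"
    by (subst Qn_add, (intro lin_diff lin_sum lin_Qn lin_bm_surv lin_Ov lin_lerr)+, subst Qn_diff)
       (intro lin_diff lin_sum lin_Qn lin_bm_surv lin_Ov lin_lerr refl)+
  also have "(Q ^^ 1) ?A x = (\<Sum>k<n. (Q ^^ Suc k) (Ov (h + real (Suc n - 1 - Suc k))) x)"
    by (subst Qn_sum) (auto simp: diff_diff_left)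
  also have "(Q ^^ 1) ?B x = (\<Sum>k<n. (Q ^^ Suc k) (lerr (h + real (Suc n - 1 - Suc k))) x)"
    by (subst Qn_sum) (auto simp: diff_diff_left)
  finally have "Q (bm_surv (h + real n)) x = (Q ^^ Suc n) (bm_surv h) x
     - (\<Sum>k<n. (Q ^^ Suc k) (Ov (h + real (Suc n - 1 - Suc k))) x)
     + (\<Sum>k<n. (Q ^^ Suc k) (lerr (h + real (Suc n - 1 - Suc k))) x)" by simp
  moreover have "bm_surv (h + real (Suc n)) x = T (bm_surv (h + real n)) x + lerr (h + real n) x"
    by (simp add: lerr_def ac_simps)
  ultimately show ?case
    unfolding T_eq_Q_Ov sum.lessThan_Suc_shift by simp
qed simp

lemma p_decomposition:
  "p n x - bm_surv (h + real n) x = (Q ^^ n) (\<lambda>z. 1 - bm_surv h z) x + (\<Sum>k<n. (Q ^^ k) (Ov (h + real (n - 1 - k))) x)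
     - (\<Sum>k<n. (Q ^^ k) (lerr (h + real (n - 1 - k))) x)"
  using decomposition[of h n x] by (simp add: Qn_diff)

lemma neg_part_integrand:
  "t > 0 \<Longrightarrow> indicator {..<0} z * - bm_surv t z = max 0 (- z) * bm_ratio t z"
  by (auto simp: indicator_def bm_surv_eq_l max_def)

lemma Ov_nonneg: "t > 0 \<Longrightarrow> 0 \<le> Ov t z"
  unfolding Ov_def T_def
  by (intro Bochner_Integration.integral_nonneg) (simp only: neg_part_integrand, simp add: bm_ratio_nonneg)

lemma Ov_le: assumes "t > 0" shows "Ov t z \<le> 1 / sqrt t * G z"
proof -
  have "Ov t z \<le> T (\<lambda>z. 1 / sqrt t * max 0 (- z)) z"
    unfolding Ov_def
  proof (rule T_mono)
    show "indicator {..<0} z * - bm_surv t z \<le> 1 / sqrt t * max 0 (- z)" for z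
      using mult_left_mono[OF bm_ratio_le, of t "max 0 (- z)" z] assms
      by (simp only: neg_part_integrand) (simp add: mult.commute)
  qed (use lin_cmult[OF lin_max_id(2), of "1 / sqrt t"] in \<open>auto intro!: lin_ind lin_minus lin_bm_surv\<close>)
  also have "\<dots> = 1 / sqrt t * G z" unfolding G_def by (rule T_cmult)
  finally show ?thesis .
qed

text \<open>Centring removes the linear term, and unit variance turns the quadratic one into
  \<open>u * phi u / t\<close>, which cancels against the time derivative. The moment remainder
  gives the exponent; the time remainder \<open>t powr (-2)\<close> is smaller since
  \<open>bet < 1\<close>.\<close>

lemma lerr_bound:
  assumes t: "t \<ge> 1"
  shows "\<bar>lerr t z\<bar> \<le> (32 * mbet + 16) * t powr (- 1 - bet / 2)"
proof -
  define u where "u = z / sqrt t"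
  have st: "sqrt t > 0" using t by simp
  have f: "bm_surv t (z + y) = H (u + y / sqrt t)" for y by (simp add: bm_surv_def u_def add_divide_distrib)
  have pt: "\<bar>H (u + y / sqrt t) - H u - 2 * phi u / sqrt t * y + u * phi u / t * y\<^sup>2\<bar>
      \<le> 32 * t powr (- 1 - bet / 2) * \<bar>y\<bar> powr (2 + bet)" for y
  proof -
    have "\<bar>H (u + y / sqrt t) - H u - 2 * phi u * (y / sqrt t) + u * phi u * (y / sqrt t)\<^sup>2\<bar> \<le> 32 * \<bar>y / sqrt t\<bar> powr (2 + bet)"
      using bet_pos bet_lt_1 by (intro H_Taylor_powr) auto
    also have "\<bar>y / sqrt t\<bar> powr (2 + bet) = \<bar>y\<bar> powr (2 + bet) * (t powr (1/2)) powr (- (2 + bet))"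
    proof -
      have "\<bar>y / sqrt t\<bar> powr (2 + bet) = \<bar>y\<bar> powr (2 + bet) / (sqrt t) powr (2 + bet)"
        using t by (simp add: powr_divide)
      moreover have "sqrt t = t powr (1/2)" using t by (simp add: powr_half_sqrt)
      ultimately show ?thesis unfolding powr_minus by (simp only: divide_inverse)
    qed
    also have "(t powr (1/2)) powr (- (2 + bet)) = t powr (- 1 - bet / 2)"
      unfolding powr_powr by (rule arg_cong[where f="\<lambda>a. t powr a"]) (simp add: field_simps)
    finally show ?thesis using t by (simp add: power_divide ac_simps)
  qed
  have i0: "integrable M (\<lambda>y. H (u + y / sqrt t))" using lin_integrable[OF lin_bm_surv[of t], of z] by (simp add: f)
  have "T (bm_surv t) z - H u + u * phi u / t = (\<integral>y. H (u + y / sqrt t) - H u - 2 * phi u / sqrt t * y + u * phi u / t * y\<^sup>2 \<partial>M)"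
    unfolding T_def f using i0 int1 int2 mean0 var1 by simp
  moreover have "\<bar>\<integral>y. H (u + y / sqrt t) - H u - 2 * phi u / sqrt t * y + u * phi u / t * y\<^sup>2 \<partial>M\<bar>
      \<le> (\<integral>y. 32 * t powr (- 1 - bet / 2) * \<bar>y\<bar> powr (2 + bet) \<partial>M)"
    unfolding real_norm_def[symmetric]
  proof (rule order_trans[OF integral_norm_bound], rule integral_mono)
    show "norm (H (u + y / sqrt t) - H u - 2 * phi u / sqrt t * y + u * phi u / t * y\<^sup>2)
      \<le> 32 * t powr (- 1 - bet / 2) * norm y powr (2 + bet)" for y using pt[of y] by simp
  qed (use i0 int1 int2 int_bet in auto)
  moreover have "(\<integral>y. 32 * t powr (- 1 - bet / 2) * \<bar>y\<bar> powr (2 + bet) \<partial>M) = 32 * mbet * t powr (- 1 - bet / 2)"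
    by (simp add: mbet_def)
  ultimately have 1: "\<bar>T (bm_surv t) z - H u + u * phi u / t\<bar> \<le> 32 * mbet * t powr (- 1 - bet / 2)" by (simp only:)
  have "t + 1 = t * (1 + 1 / t)" using t by (simp add: field_simps)
  then have e: "z / sqrt (t + 1) = u / sqrt (1 + 1 / t)" by (simp only: real_sqrt_mult u_def) simp
  have 2: "\<bar>bm_surv (t + 1) z - H u + u * phi u / t\<bar> \<le> 16 * (1 / t)\<^sup>2"
    using H_time_Taylor[of "1 / t" u] t by (simp add: bm_surv_def e)
  have "(1 / t)\<^sup>2 = t powr (- 2)" using t by (simp add: powr_minus powr_numeral power_inverse divide_inverse)
  also have "\<dots> \<le> t powr (- 1 - bet / 2)" using t bet_lt_1 by (intro powr_mono) auto
  finally have "\<bar>bm_surv (t + 1) z - H u + u * phi u / t\<bar> \<le> 16 * t powr (- 1 - bet / 2)" using 2 by linarith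
  then have "\<bar>(bm_surv (t + 1) z - H u + u * phi u / t) - (T (bm_surv t) z - H u + u * phi u / t)\<bar>
      \<le> 16 * t powr (- 1 - bet / 2) + 32 * mbet * t powr (- 1 - bet / 2)"
    by (intro order_trans[OF abs_triangle_ineq4] add_mono 1)
  then show ?thesis by (simp add: lerr_def algebra_simps)
qed

text \<open>Killing is kept for the first half of the time, which retains a survival factor. Over
  the second half the walk is freed and \<open>concentration\<close> makes it unlikely to end within
  \<open>sqrt h\<close> of 0.\<close>

lemma endpoint_bound: "\<exists>C>0. \<forall>n\<ge>1. \<forall>h>0. \<forall>x\<ge>0.
  0 \<le> (Q ^^ n) (\<lambda>z. 1 - bm_surv h z) x \<and>
  (Q ^^ n) (\<lambda>z. 1 - bm_surv h z) x \<le> C * (sqrt (h / real n) + 1 / h) * p (n div 2) x"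
proof -
  obtain C where C: "C > 0" "\<And>k h z. k \<ge> 1 \<Longrightarrow> h > 0 \<Longrightarrow> (T ^^ k) (gauss h) z \<le> C * (sqrt (h / real k) + 1 / h)"
    using concentration by blast
  have "0 \<le> (Q ^^ n) (\<lambda>z. 1 - bm_surv h z) x \<and>
     (Q ^^ n) (\<lambda>z. 1 - bm_surv h z) x \<le> 2 * C * (sqrt (h / real n) + 1 / h) * p (n div 2) x"
    if n: "n \<ge> 1" and h: "h > 0" and x: "x \<ge> 0" for n h x
  proof
    have lg: "lin_growth (\<lambda>z. 1 - bm_surv h z)" by (intro lin_diff lin_const lin_bm_surv)
    show "0 \<le> (Q ^^ n) (\<lambda>z. 1 - bm_surv h z) x"
      using H_bounds(1) by (intro Qn_nonneg x lg) (auto simp: bm_surv_def)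
    define m where "m = n - n div 2"
    have m: "m \<ge> 1" "2 * m \<ge> n" "n = n div 2 + m" using n by (auto simp: m_def)
    have "(Q ^^ n) (\<lambda>z. 1 - bm_surv h z) x \<le> (Q ^^ n) (gauss h) x"
      using one_minus_bm_surv_le_gauss[OF h] h by (intro Qn_mono x lg) auto
    also have "\<dots> = (Q ^^ (n div 2)) ((Q ^^ m) (gauss h)) x" by (subst m(3), subst Qn_plus) simp
    also have "\<dots> \<le> (Q ^^ (n div 2)) (\<lambda>_. C * (sqrt (h / real m) + 1 / h)) x"
    proof (intro Qn_mono x lin_Qn lin_gauss h lin_const)
      fix z :: real
      have "(Q ^^ m) (gauss h) z \<le> (T ^^ m) (gauss h) z"
        using h by (intro Qn_le_Tn) (auto simp: gauss_def)
      also have "\<dots> \<le> C * (sqrt (h / real m) + 1 / h)" by (rule C(2)[OF m(1) h])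
      finally show "(Q ^^ m) (gauss h) z \<le> C * (sqrt (h / real m) + 1 / h)" .
    qed
    also have "\<dots> = C * (sqrt (h / real m) + 1 / h) * p (n div 2) x" by (rule Qn_const)
    also have "\<dots> \<le> C * (2 * (sqrt (h / real n) + 1 / h)) * p (n div 2) x"
    proof (intro mult_right_mono mult_left_mono p_ge_0)
      have "sqrt (h / real m) \<le> sqrt (4 * (h / real n))"
      proof (rule real_sqrt_le_mono)
        have "h / real m \<le> 2 * h / real n" using m n h by (simp add: field_simps)
        also have "\<dots> \<le> 4 * (h / real n)" using h n by (simp add: divide_right_mono)
        finally show "h / real m \<le> 4 * (h / real n)" .
      qed
      also have "\<dots> = 2 * sqrt (h / real n)" by (simp add: real_sqrt_mult real_sqrt_divide)
      finally show "sqrt (h / real m) + 1 / h \<le> 2 * (sqrt (h / real n) + 1 / h)"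
        using h zero_le_divide_iff[of 1 h] by (simp only: distrib_left) linarith
    qed (use C in auto)
    finally show "(Q ^^ n) (\<lambda>z. 1 - bm_surv h z) x \<le> 2 * C * (sqrt (h / real n) + 1 / h) * p (n div 2) x" by (simp add: mult.assoc mult.left_commute)
  qed
  then show ?thesis using C(1) by (intro exI[of _ "2 * C"]) auto
qed

end

subsection \<open>Starting points in the half-line\<close>

context walk_law
begin

text \<open>The smoothing time for which the endpoint error \<open>sqrt (hh n / n)\<close> is
  exactly \<open>n powr (- eps)\<close>; the summed Lindeberg error
  \<open>hh n powr (- bet / 2)\<close> is then no larger.\<close>

definition hh :: "nat \<Rightarrow> real" where "hh n = real n powr (1 - 2 * eps)"

lemma hh_facts:
  assumes n: "n \<ge> 1"
  shows "1 \<le> hh n" "hh n \<le> real n" "hh n / real n \<le> real n powr (- eps)" "sqrt (hh n / real n) = real n powr (- eps)"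
    "1 / hh n \<le> real n powr (- eps)" "hh n powr (- bet / 2) \<le> real n powr (- eps)"
    "1 / sqrt (hh n) = real n powr (eps - 1/2)"
proof -
  have N: "real n \<ge> 1" using n by simp
  show 1: "1 \<le> hh n" unfolding hh_def using N eps_lt by (intro ge_one_powr_ge_zero) auto
  have "hh n \<le> real n powr 1" unfolding hh_def using N eps_pos by (intro powr_mono) auto
  then show "hh n \<le> real n" using N by simp
  have q: "hh n / real n = real n powr (- 2 * eps)" using N by (simp add: hh_def powr_diff powr_minus field_simps)
  show "hh n / real n \<le> real n powr (- eps)" unfolding q using N eps_pos by (intro powr_mono) auto
  have "sqrt (hh n / real n) = (real n powr (- 2 * eps)) powr (1/2)" unfolding q by (simp add: powr_half_sqrt)
  then show "sqrt (hh n / real n) = real n powr (- eps)" by (simp add: powr_powr)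
  have "1 / hh n = real n powr (- (1 - 2 * eps))" unfolding hh_def powr_minus by (simp add: field_simps)
  also have "\<dots> \<le> real n powr (- eps)" using N eps_lt eps_pos by (intro powr_mono) auto
  finally show "1 / hh n \<le> real n powr (- eps)" .
  have "hh n powr (- bet / 2) = real n powr ((1 - 2 * eps) * (- bet / 2))" by (simp add: hh_def powr_powr)
  also have "\<dots> \<le> real n powr (- eps)"
  proof (rule powr_mono)
    have "1/2 * (2 * eps) \<le> (1 - 2 * eps) * (bet / 2)" using eps_pos eps_lt bet_ge by (intro mult_mono) auto
    then show "(1 - 2 * eps) * (- bet / 2) \<le> - eps" by simp
  qed (rule N)
  finally show "hh n powr (- bet / 2) \<le> real n powr (- eps)" .
  have "1 / sqrt (hh n) = 1 / (hh n powr (1/2))" using 1 by (simp add: powr_half_sqrt)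
  also have "\<dots> = real n powr (- ((1 - 2 * eps) * (1/2)))" unfolding hh_def powr_powr powr_minus by (simp add: field_simps)
  also have "- ((1 - 2 * eps) * (1/2)) = eps - 1/2" by (simp add: field_simps)
  finally show "1 / sqrt (hh n) = real n powr (eps - 1/2)" .
qed

text \<open>For \<open>k < n\<close>, the time left once step \<open>k + 1\<close> has been made,
  smoothing included.\<close>

abbreviation rem :: "nat \<Rightarrow> nat \<Rightarrow> real" where "rem n k \<equiv> hh n + real (n - 1 - k)"
abbreviation rate :: "nat \<Rightarrow> real" where "rate n \<equiv> real n powr (- eps)"

lemma lerr_sum:
  assumes "h \<ge> 1" "x \<ge> 0"
  shows "\<bar>\<Sum>k<n. (Q ^^ k) (lerr (h + real (n - 1 - k))) x\<bar>
    \<le> (32 * mbet + 16) * (\<Sum>k<n. (h + real (n - 1 - k)) powr (- 1 - bet / 2) * p k x)"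
proof -
  have "\<bar>\<Sum>k<n. (Q ^^ k) (lerr (h + real (n - 1 - k))) x\<bar> \<le> (\<Sum>k<n. \<bar>(Q ^^ k) (lerr (h + real (n - 1 - k))) x\<bar>)"
    by (rule sum_abs)
  also have "\<dots> \<le> (\<Sum>k<n. (Q ^^ k) (\<lambda>_. (32 * mbet + 16) * (h + real (n - 1 - k)) powr (- 1 - bet / 2)) x)"
    using assms by (intro sum_mono Qn_abs lerr_bound lin_lerr lin_const) auto
  also have "\<dots> = (32 * mbet + 16) * (\<Sum>k<n. (h + real (n - 1 - k)) powr (- 1 - bet / 2) * p k x)"
    unfolding Qn_const[of _ "(32 * mbet + 16) * _"] sum_distrib_left by (simp add: mult.assoc)
  finally show ?thesis .
qed

lemma sum_t: assumes "h \<ge> 1"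
  shows "(\<Sum>k<n. (h + real (n - 1 - k)) powr (- 1 - bet / 2)) \<le> 8 / bet * h powr (- bet / 2)"
proof -
  have "(\<Sum>k<n. (h + real (n - 1 - k)) powr (- 1 - bet / 2)) = (\<Sum>k<n. (h + real (n - Suc k)) powr (- 1 - bet / 2))"
    by (intro sum.cong) (auto simp: diff_diff_left)
  also have "\<dots> = (\<Sum>j<n. (h + real j) powr (- 1 - bet / 2))" by (rule sum.nat_diff_reindex)
  also have "\<dots> \<le> 4 / (bet / 2) * h powr (- (bet / 2))"
    using assms bet_pos bet_lt_1 by (intro sum_powr_tail) auto
  finally show ?thesis by simp
qed

lemma lerr_far: "\<exists>C>0. \<forall>n\<ge>1. \<forall>x\<ge>0.
  \<bar>\<Sum>k<n. (Q ^^ k) (lerr (rem n k)) x\<bar> \<le> C * rate n"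
proof -
  have "\<bar>\<Sum>k<n. (Q ^^ k) (lerr (rem n k)) x\<bar> \<le> (32 * mbet + 16) * (8 / bet) * rate n"
    if n: "n \<ge> 1" and x: "x \<ge> 0" for n x
  proof -
    have "(\<Sum>k<n. (rem n k) powr (- 1 - bet / 2) * p k x) \<le> (\<Sum>k<n. (rem n k) powr (- 1 - bet / 2))"
      using p_le_1 by (intro sum_mono) (auto intro!: mult_left_le)
    also have "\<dots> \<le> 8 / bet * hh n powr (- bet / 2)" by (rule sum_t) (rule hh_facts[OF n])
    also have "\<dots> \<le> 8 / bet * rate n" using hh_facts(6)[OF n] bet_pos by (intro mult_left_mono) auto
    finally have "(32 * mbet + 16) * (\<Sum>k<n. (rem n k) powr (- 1 - bet / 2) * p k x)
        \<le> (32 * mbet + 16) * (8 / bet * rate n)"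
      using mbet_nonneg by (intro mult_left_mono) auto
    with lerr_sum[OF hh_facts(1)[OF n] x, of n] show ?thesis by (simp only: mult.assoc)
  qed
  moreover have "(32 * mbet + 16) * (8 / bet) > 0" using mbet_nonneg bet_pos by (intro mult_pos_pos) auto
  ultimately show ?thesis by blast
qed

text \<open>Weighted by \<open>p_upper\<close>: in the first half the remaining time is at least
  \<open>n / 2\<close>, in the second the survival probability is of order
  \<open>V(x) / sqrt n\<close>. In each half the other factor is summed.\<close>

lemma lerr_near: "\<exists>C>0. \<forall>n\<ge>1. \<forall>x\<ge>0.
  \<bar>\<Sum>k<n. (Q ^^ k) (lerr (rem n k)) x\<bar> \<le> C * renewal x * (rate n / sqrt (real n))"
proof -
  obtain C where C: "C > 0" "\<And>n x. x \<ge> 0 \<Longrightarrow> p n x \<le> C * renewal x / sqrt (real (Suc n))" using p_upper by blast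
  define K where "K = (32 * mbet + 16) * C * (8 + 2 * (8 / bet))"
  have K: "K > 0" unfolding K_def using mbet_nonneg C bet_pos by (intro mult_pos_pos) (auto intro: add_pos_pos add_nonneg_pos)
  have "\<bar>\<Sum>k<n. (Q ^^ k) (lerr (rem n k)) x\<bar> \<le> K * renewal x * (rate n / sqrt (real n))"
    if n: "n \<ge> 1" and x: "x \<ge> 0" for n x
  proof -
    define N where "N = real n"
    have N: "N \<ge> 1" using n by (simp add: N_def)
    define t where "t k = rem n k" for k
    define b where "b = bet / 2"
    have b: "0 < b" "b \<le> 1" using bet_pos bet_lt_1 by (auto simp: b_def)
    note h = hh_facts[OF n]
    have t1: "t k \<ge> 1" for k using h(1) by (simp add: t_def)
    have tm: "t k powr (- 1 - b) * p k x \<le> C * renewal x * ((N / 2) powr (- 1 - b) * (1 / sqrt (real (Suc k))) + 2 / sqrt N * t k powr (- 1 - b))"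
      if k: "k < n" for k
    proof -
      have "t k powr (- 1 - b) * (1 / sqrt (real (Suc k))) \<le> (N / 2) powr (- 1 - b) * (1 / sqrt (real (Suc k))) + 2 / sqrt N * t k powr (- 1 - b)"
      proof (cases "N / 2 \<le> real (Suc k)")
        case True
        have "sqrt N \<le> sqrt (4 * real (Suc k))" using True by (intro real_sqrt_le_mono) auto
        then have "sqrt N \<le> 2 * sqrt (real (Suc k))" unfolding real_sqrt_mult by (simp only: real_sqrt_four)
        then have "1 / sqrt (real (Suc k)) \<le> 2 / sqrt N" using N by (simp add: field_simps)
        then have "t k powr (- 1 - b) * (1 / sqrt (real (Suc k))) \<le> t k powr (- 1 - b) * (2 / sqrt N)" by (intro mult_left_mono) auto
        moreover have "0 \<le> (N / 2) powr (- 1 - b) * (1 / sqrt (real (Suc k)))" by simp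
        ultimately show ?thesis by (simp only: mult.commute)
      next
        case False
        then have "N / 2 \<le> t k" using k h(1) by (simp add: t_def N_def)
        then have "t k powr (- 1 - b) \<le> (N / 2) powr (- 1 - b)" using N b by (intro powr_mono2') auto
        then have "t k powr (- 1 - b) * (1 / sqrt (real (Suc k))) \<le> (N / 2) powr (- 1 - b) * (1 / sqrt (real (Suc k)))"
          by (intro mult_right_mono) auto
        moreover have "0 \<le> 2 / sqrt N * t k powr (- 1 - b)" using N by simp
        ultimately show ?thesis by linarith
      qed
      then have "C * renewal x * (t k powr (- 1 - b) * (1 / sqrt (real (Suc k)))) \<le> C * renewal x * ((N / 2) powr (- 1 - b) * (1 / sqrt (real (Suc k))) + 2 / sqrt N * t k powr (- 1 - b))"
        using C(1) renewal_nonneg by (intro mult_left_mono) auto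
      moreover have "t k powr (- 1 - b) * p k x \<le> t k powr (- 1 - b) * (C * renewal x / sqrt (real (Suc k)))"
        using C(2)[OF x] by (intro mult_left_mono) auto
      moreover have "t k powr (- 1 - b) * (C * renewal x / sqrt (real (Suc k))) = C * renewal x * (t k powr (- 1 - b) * (1 / sqrt (real (Suc k))))" by simp
      ultimately show ?thesis by linarith
    qed
    have "(\<Sum>k<n. t k powr (- 1 - b) * p k x)
       \<le> (\<Sum>k<n. C * renewal x * ((N / 2) powr (- 1 - b) * (1 / sqrt (real (Suc k))) + 2 / sqrt N * t k powr (- 1 - b)))"
      using tm by (intro sum_mono) auto
    also have "\<dots> = C * renewal x * ((N / 2) powr (- 1 - b) * (\<Sum>k<n. 1 / sqrt (real (Suc k))) + 2 / sqrt N * (\<Sum>k<n. t k powr (- 1 - b)))"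
      by (simp only: sum_distrib_left[symmetric] sum.distrib)
    also have "\<dots> \<le> C * renewal x * ((N / 2) powr (- 1 - b) * (2 * sqrt N) + 2 / sqrt N * (8 / bet * N powr (- eps)))"
    proof (intro mult_left_mono add_mono)
      show "(\<Sum>k<n. 1 / sqrt (real (Suc k))) \<le> 2 * sqrt N" unfolding N_def by (rule sum_inverse_sqrt)
      have "(\<Sum>k<n. t k powr (- 1 - b)) \<le> 8 / bet * hh n powr (- bet / 2)" unfolding t_def b_def by (rule sum_t[OF h(1)])
      also have "\<dots> \<le> 8 / bet * N powr (- eps)" unfolding N_def using h(6) bet_pos by (intro mult_left_mono) auto
      finally show "(\<Sum>k<n. t k powr (- 1 - b)) \<le> 8 / bet * N powr (- eps)" .
    qed (use N C renewal_nonneg in auto)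
    also have "\<dots> \<le> C * renewal x * ((8 + 2 * (8 / bet)) * (N powr (- eps) / sqrt N))"
    proof (intro mult_left_mono)
      have "(N / 2) powr (- 1 - b) = 2 powr (1 + b) * N powr (- 1 - b)"
        using N by (simp add: powr_divide powr_minus[of 2 "1 + b", simplified] field_simps)
      also have "\<dots> \<le> 4 * (N powr (- eps) / N)"
      proof (intro mult_mono)
        have "(2::real) powr (1 + b) \<le> 2 powr 2" using b by (intro powr_mono) auto
        then show "(2::real) powr (1 + b) \<le> 4" by simp
        have "N powr (- 1 - b) \<le> N powr (- eps - 1)" using N bet_ge eps_pos by (intro powr_mono) (auto simp: b_def)
        also have "\<dots> = N powr (- eps) / N" using N by (simp add: powr_diff)
        finally show "N powr (- 1 - b) \<le> N powr (- eps) / N" .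
      qed auto
      finally have "(N / 2) powr (- 1 - b) * (2 * sqrt N) \<le> 4 * (N powr (- eps) / N) * (2 * sqrt N)"
        using N by (intro mult_right_mono) auto
      also have "\<dots> = 8 * N powr (- eps) * (sqrt N / N)" by simp
      also have "sqrt N / N = 1 / sqrt N" using N by (simp add: real_div_sqrt field_simps)
      finally have "(N / 2) powr (- 1 - b) * (2 * sqrt N) \<le> 8 * (N powr (- eps) / sqrt N)" by simp
      moreover have "2 / sqrt N * (8 / bet * N powr (- eps)) = 2 * (8 / bet) * (N powr (- eps) / sqrt N)" by simp
      ultimately show "(N / 2) powr (- 1 - b) * (2 * sqrt N) + 2 / sqrt N * (8 / bet * N powr (- eps)) \<le> (8 + 2 * (8 / bet)) * (N powr (- eps) / sqrt N)"
        unfolding distrib_right by linarith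
    qed (use C renewal_nonneg in auto)
    finally have "(32 * mbet + 16) * (\<Sum>k<n. t k powr (- 1 - b) * p k x)
        \<le> (32 * mbet + 16) * (C * renewal x * ((8 + 2 * (8 / bet)) * (N powr (- eps) / sqrt N)))"
      using mbet_nonneg by (intro mult_left_mono) auto
    also have "\<dots> = K * renewal x * (N powr (- eps) / sqrt N)" by (simp add: K_def)
    finally show ?thesis using lerr_sum[OF h(1) x, of n] by (simp add: t_def b_def N_def)
  qed
  then show ?thesis using K by blast
qed

section \<open>Large jumps and the overshoot sum\<close>

definition mdel :: real where "mdel = (\<integral>x. \<bar>x\<bar> powr (2 + \<delta>) \<partial>M)"

lemma mdel_nonneg: "0 \<le> mdel" unfolding mdel_def by (intro Bochner_Integration.integral_nonneg) auto

text \<open>Mean modulus of the jumps exceeding \<open>a\<close>. It is estimated with the full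
  moment of order \<open>2 + \<delta>\<close>, not with the smaller exponent
  \<open>bet\<close>.\<close>

definition kap :: "real \<Rightarrow> real" where "kap a = (\<integral>y. indicator {a<..} \<bar>y\<bar> * \<bar>y\<bar> \<partial>M)"

lemma kap_int: "integrable M (\<lambda>y. indicator {a<..} \<bar>y\<bar> * \<bar>y\<bar>)"
  by (rule Bochner_Integration.integrable_bound[OF int_abs]) (auto simp: indicator_def)

lemma kap_nonneg: "0 \<le> kap a" unfolding kap_def by (intro Bochner_Integration.integral_nonneg) auto

lemma kap_le: assumes "a > 0" shows "kap a \<le> mdel * a powr (- (1 + \<delta>))"
proof -
  have "indicator {a<..} \<bar>y\<bar> * \<bar>y\<bar> \<le> \<bar>y\<bar> powr (2 + \<delta>) * a powr (- (1 + \<delta>))" for y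
  proof (cases "\<bar>y\<bar> > a")
    case True
    have "1 \<le> (\<bar>y\<bar> / a) powr (1 + \<delta>)" using True assms delta_pos by (intro ge_one_powr_ge_zero) auto
    then have "\<bar>y\<bar> * 1 \<le> \<bar>y\<bar> * (\<bar>y\<bar> / a) powr (1 + \<delta>)" by (intro mult_left_mono) auto
    also have "(\<bar>y\<bar> / a) powr (1 + \<delta>) = \<bar>y\<bar> powr (1 + \<delta>) * a powr (- (1 + \<delta>))"
      unfolding powr_minus_divide using assms True by (simp add: powr_divide)
    also have "\<bar>y\<bar> * (\<bar>y\<bar> powr (1 + \<delta>) * a powr (- (1 + \<delta>))) = \<bar>y\<bar> powr (2 + \<delta>) * a powr (- (1 + \<delta>))"
      using powr_add[of "\<bar>y\<bar>" 1 "1 + \<delta>"] True assms by simp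
    finally show ?thesis using True by simp
  qed simp
  then have "kap a \<le> (\<integral>y. \<bar>y\<bar> powr (2 + \<delta>) * a powr (- (1 + \<delta>)) \<partial>M)"
    unfolding kap_def using int_delta by (intro integral_mono kap_int) auto
  then show ?thesis by (simp add: mdel_def)
qed

text \<open>Jumps below the cut-off \<open>n powr (1/2 - eps)\<close> move the rescaled position by
  at most \<open>n powr (- eps)\<close>. The second bound is the source of
  \<open>n^(-\<delta>/4)\<close> in the theorem; it uses \<open>eps < 1/4\<close>.\<close>

lemma kap_near: assumes n: "n \<ge> 1"
  shows "kap (real n powr (1/2 - eps)) * sqrt (real n) \<le> mdel * rate n"
    "kap (real n powr (1/2 - eps)) \<le> mdel * real n powr (- \<delta> / 4)"
proof -
  have N: "real n \<ge> 1" using n by simp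
  define E where "E = (1/2 - eps) * (1 + \<delta>)"
  have e: "eps * (4 * (3 + \<delta>)) = \<delta>" using delta_pos by (simp add: eps_def)
  have k: "kap (real n powr (1/2 - eps)) \<le> mdel * real n powr (- E)"
  proof -
    have "(1/2 - eps) * (- (1 + \<delta>)) = - E" by (simp add: E_def field_simps)
    then show ?thesis using kap_le[of "real n powr (1/2 - eps)"] N by (simp only: powr_powr) simp
  qed
  have "eps * (2 + \<delta>) \<le> eps * (3 + \<delta>)" using eps_pos by (intro mult_left_mono) auto
  then have E1: "1/2 - E \<le> - eps" using e delta_pos by (simp add: E_def algebra_simps)
  have "1/4 * (1 + \<delta>) \<le> E" unfolding E_def using eps_lt delta_pos by (intro mult_right_mono) auto
  then have E2: "- E \<le> - \<delta> / 4" by simp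
  have "kap (real n powr (1/2 - eps)) * sqrt (real n) \<le> mdel * real n powr (- E) * real n powr (1/2)"
    using k N by (simp add: powr_half_sqrt mult_right_mono)
  also have "\<dots> = mdel * real n powr (1/2 - E)"
    using powr_add[of "real n" "- E" "1/2"] by (simp add: mult.assoc)
  also have "\<dots> \<le> mdel * rate n" using E1 N mdel_nonneg by (intro mult_left_mono powr_mono) auto
  finally show "kap (real n powr (1/2 - eps)) * sqrt (real n) \<le> mdel * rate n" .
  have "mdel * real n powr (- E) \<le> mdel * real n powr (- \<delta> / 4)" using E2 N mdel_nonneg by (intro mult_left_mono powr_mono) auto
  with k show "kap (real n powr (1/2 - eps)) \<le> mdel * real n powr (- \<delta> / 4)" by linarith
qed

text \<open>An exit by a jump up to \<open>N powr (1/2 - eps)\<close> ends within that distance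
  below 0, where \<open>L\<close> is close to \<open>L 0\<close>. Larger jumps are charged to
  \<open>kap\<close>.\<close>

lemma Ov_compare:
  assumes N: "N \<ge> 1" and t: "t \<ge> N / 2" and z: "z \<ge> 0" and x: "x \<ge> 0"
  shows "\<bar>Ov t z - bm_ratio N x * G z\<bar> \<le> 4 / sqrt N * (N powr (- eps) + \<bar>t - N\<bar> / N + x / sqrt N) * G z
     + 4 / sqrt N * kap (N powr (1/2 - eps))"
proof -
  define o' where "o' y = max 0 (- (z + y))" for y
  define a where "a = N powr (1/2 - eps)"
  have t0: "t > 0" using N t by simp
  have io: "integrable M o'" unfolding o'_def[abs_def] using lin_integrable[OF lin_max_id(2), of z] by simp
  have iol: "integrable M (\<lambda>y. o' y * bm_ratio t (z + y))"
  proof -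
    have "lin_growth (\<lambda>z. indicator {..<0} z * - bm_surv t z)" by (intro lin_ind lin_minus lin_bm_surv) auto
    from lin_integrable[OF this, of z] show ?thesis unfolding neg_part_integrand[OF t0] o'_def .
  qed
  have GG: "G z = (\<integral>y. o' y \<partial>M)" by (simp add: G_def T_def o'_def)
  have OO: "Ov t z = (\<integral>y. o' y * bm_ratio t (z + y) \<partial>M)"
    unfolding Ov_def T_def neg_part_integrand[OF t0] o'_def ..
  have "Ov t z - bm_ratio N x * G z = (\<integral>y. o' y * (bm_ratio t (z + y) - bm_ratio N x) \<partial>M)"
    unfolding OO GG using io iol by (simp add: right_diff_distrib mult.commute)
  moreover have "\<bar>\<integral>y. o' y * (bm_ratio t (z + y) - bm_ratio N x) \<partial>M\<bar> \<le> (\<integral>y. 4 / sqrt N * (N powr (- eps) + \<bar>t - N\<bar> / N + x / sqrt N) * o' y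
       + 4 / sqrt N * (indicator {a<..} \<bar>y\<bar> * \<bar>y\<bar>) \<partial>M)"
  proof (rule order_trans[OF integral_abs_bound], rule integral_mono)
    show "integrable M (\<lambda>y. \<bar>o' y * (bm_ratio t (z + y) - bm_ratio N x)\<bar>)"
      using io iol by (simp add: right_diff_distrib)
    show "integrable M (\<lambda>y. 4 / sqrt N * (N powr (- eps) + \<bar>t - N\<bar> / N + x / sqrt N) * o' y
       + 4 / sqrt N * (indicator {a<..} \<bar>y\<bar> * \<bar>y\<bar>))" using io kap_int by auto
    fix y
    have o0: "o' y \<ge> 0" by (simp add: o'_def)
    have oy: "o' y \<le> \<bar>y\<bar>" using z by (auto simp: o'_def)
    have m: "o' y * min 1 (\<bar>z + y\<bar> / sqrt N) \<le> N powr (- eps) * o' y + indicator {a<..} \<bar>y\<bar> * \<bar>y\<bar>"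
    proof (cases "\<bar>y\<bar> > a")
      case True
      have "o' y * min 1 (\<bar>z + y\<bar> / sqrt N) \<le> o' y * 1" using o0 by (intro mult_left_mono) auto
      also have "\<dots> \<le> \<bar>y\<bar>" using oy by simp
      finally show ?thesis using True o0 by (simp add: add_increasing)
    next
      case False
      show ?thesis
      proof (cases "z + y < 0")
        case True
        then have "\<bar>z + y\<bar> \<le> a" using False z by linarith
        then have "\<bar>z + y\<bar> / sqrt N \<le> a / sqrt N" using N by (intro divide_right_mono) auto
        also have "\<dots> = N powr (- eps)" using powr_add[of N "1/2" "- eps"] N by (simp add: a_def powr_half_sqrt)
        finally have "o' y * min 1 (\<bar>z + y\<bar> / sqrt N) \<le> o' y * N powr (- eps)" using o0 by (intro mult_left_mono) auto
        then show ?thesis using False by (simp add: mult.commute)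
      qed (simp add: o'_def)
    qed
    have "\<bar>o' y * (bm_ratio t (z + y) - bm_ratio N x)\<bar> = o' y * \<bar>bm_ratio t (z + y) - bm_ratio N x\<bar>" using o0 by (simp add: abs_mult)
    also have "\<dots> \<le> o' y * (4 / sqrt N * (min 1 (\<bar>z + y\<bar> / sqrt N) + \<bar>t - N\<bar> / N + \<bar>x\<bar> / sqrt N))"
      using N t o0 by (intro mult_left_mono bm_ratio_diff) auto
    also have "\<dots> = 4 / sqrt N * (o' y * min 1 (\<bar>z + y\<bar> / sqrt N)) + 4 / sqrt N * (\<bar>t - N\<bar> / N + x / sqrt N) * o' y"
      using x by (simp add: algebra_simps)
    also have "\<dots> \<le> 4 / sqrt N * (N powr (- eps) * o' y + indicator {a<..} \<bar>y\<bar> * \<bar>y\<bar>) + 4 / sqrt N * (\<bar>t - N\<bar> / N + x / sqrt N) * o' y"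
      using m N by (intro add_right_mono mult_left_mono) auto
    also have "\<dots> = 4 / sqrt N * (N powr (- eps) + \<bar>t - N\<bar> / N + x / sqrt N) * o' y
       + 4 / sqrt N * (indicator {a<..} \<bar>y\<bar> * \<bar>y\<bar>)" by (simp add: algebra_simps)
    finally show "\<bar>o' y * (bm_ratio t (z + y) - bm_ratio N x)\<bar> \<le> 4 / sqrt N * (N powr (- eps) + \<bar>t - N\<bar> / N + x / sqrt N) * o' y
       + 4 / sqrt N * (indicator {a<..} \<bar>y\<bar> * \<bar>y\<bar>)" .
  qed
  moreover have "(\<integral>y. 4 / sqrt N * (N powr (- eps) + \<bar>t - N\<bar> / N + x / sqrt N) * o' y
       + 4 / sqrt N * (indicator {a<..} \<bar>y\<bar> * \<bar>y\<bar>) \<partial>M)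
     = 4 / sqrt N * (N powr (- eps) + \<bar>t - N\<bar> / N + x / sqrt N) * G z + 4 / sqrt N * kap a"
    unfolding GG kap_def using io kap_int by simp
  ultimately show ?thesis unfolding a_def by simp
qed


text \<open>In the first half of the time all remaining times are comparable with \<open>n\<close>,
  so the kernel can be frozen at \<open>(n, x)\<close>. The freezing cost \<open>x / sqrt n\<close>
  need not be small by itself; it is compensated by the sublinear growth of the overshoot.\<close>

lemma early_overshoot: "\<exists>C>0. \<forall>n\<ge>1. \<forall>x\<ge>0. x \<le> sqrt (real n) \<longrightarrow>
  \<bar>(\<Sum>k<(n + 1) div 2. (Q ^^ k) (Ov (rem n k)) x) - bm_ratio (real n) x * e ((n + 1) div 2) x\<bar>
    \<le> C * renewal x * (rate n / sqrt (real n))"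
proof -
  obtain C1 where C1: "C1 > 0" "\<And>n x. x \<ge> 0 \<Longrightarrow> p n x \<le> C1 * renewal x / sqrt (real (Suc n))" using p_upper by blast
  obtain C2 where C2: "C2 > 0" "\<And>k x. k \<ge> 1 \<Longrightarrow> x \<ge> 0 \<Longrightarrow> einf x - e k x \<le> C2 * renewal x * real k powr (- bet / 2)"
    using e_tail by blast
  obtain C3 where C3: "C3 > 0" "\<And>x. x \<ge> 0 \<Longrightarrow> einf x \<le> C3 * (1 + x) powr (1 - bet)" using einf_bound by blast
  obtain c4 where c4: "c4 > 0" "\<And>x. x \<ge> 0 \<Longrightarrow> c4 * (1 + x) \<le> renewal x" using renewal_lower by blast
  define C where "C = 4 * (4 + C2 + 2 * C3 / c4 + 2 * mdel * C1)"
  have C: "C > 0" using C1(1) C2(1) C3(1) c4(1) mdel_nonneg unfolding C_def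
    by (intro mult_pos_pos add_pos_nonneg add_pos_pos divide_pos_pos mult_nonneg_nonneg) auto
  have "\<bar>(\<Sum>k<(n + 1) div 2. (Q ^^ k) (Ov (rem n k)) x) - bm_ratio (real n) x * e ((n + 1) div 2) x\<bar>
    \<le> C * renewal x * (rate n / sqrt (real n))" if n: "n \<ge> 1" and x: "x \<ge> 0" and xn: "x \<le> sqrt (real n)" for n x
  proof -
    define N where "N = real n"
    \<comment> \<open>Rounded up: \<open>k < m\<close> gives \<open>2 * k < n\<close>, and still
      \<open>m >= n / 2\<close> for the late half.\<close>
    define m where "m = (n + 1) div 2"
    \<comment> \<open>Exits before \<open>K\<close> shift the time by at most the fraction
      \<open>N powr (- eps)\<close> of \<open>N\<close>; those after \<open>K\<close> carry little
      overshoot by \<open>e_tail\<close>.\<close>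
    define K where "K = nat \<lceil>N powr (1 - eps)\<rceil>"
    define t where "t k = rem n k" for k
    define P where "P = N powr (- eps)"
    define \<kappa> where "\<kappa> = kap (N powr (1/2 - eps))"
    define a where "a k = (Q ^^ k) G x" for k
    have N: "N \<ge> 1" using n by (simp add: N_def)
    have P: "P > 0" using N by (simp add: P_def)
    note h = hh_facts[OF n, folded N_def, folded P_def]
    have a0: "a k \<ge> 0" for k by (simp add: a_def QnG_nonneg)
    have em: "e m x = (\<Sum>k<m. a k)" by (simp add: e_def a_def)
    have m: "m \<le> n" using n by (auto simp: m_def)
    have V0: "renewal x \<ge> 0" by (rule renewal_nonneg)
    have emV: "e m x \<le> renewal x" using e_le_einf[of m x] x by (simp add: renewal_def)
    have tk: "t k \<ge> N / 2" "\<bar>t k - N\<bar> \<le> 2 * hh n + real k" if "k < m" for k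
    proof -
      have "2 * k < n" using that unfolding m_def by linarith
      then have "k \<le> n - 1" and r: "real (n - 1 - k) = N - 1 - real k" by (auto simp: N_def of_nat_diff)
      show "t k \<ge> N / 2" using \<open>2 * k < n\<close> h(1) unfolding t_def r by (simp add: N_def)
      show "\<bar>t k - N\<bar> \<le> 2 * hh n + real k" using h(1) unfolding t_def r by simp
    qed
    have "\<bar>(\<Sum>k<m. (Q ^^ k) (Ov (t k)) x) - bm_ratio N x * e m x\<bar> = \<bar>\<Sum>k<m. (Q ^^ k) (\<lambda>z. Ov (t k) z - bm_ratio N x * G z) x\<bar>"
      by (simp add: em a_def Qn_diff lin_cmult Qn_cmult sum_subtractf sum_distrib_left)
    also have "\<dots> \<le> (\<Sum>k<m. \<bar>(Q ^^ k) (\<lambda>z. Ov (t k) z - bm_ratio N x * G z) x\<bar>)" by (rule sum_abs)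
    also have "\<dots> \<le> (\<Sum>k<m. 4 / sqrt N * (P + (2 * hh n + real k) / N + x / sqrt N) * a k + 4 / sqrt N * \<kappa> * p k x)"
    proof (rule sum_mono)
      fix k assume "k \<in> {..<m}"
      then have k: "k < m" by simp
      define A where "A = 4 / sqrt N * (P + (2 * hh n + real k) / N + x / sqrt N)"
      have "\<bar>(Q ^^ k) (\<lambda>z. Ov (t k) z - bm_ratio N x * G z) x\<bar> \<le> (Q ^^ k) (\<lambda>z. A * G z + 4 / sqrt N * \<kappa>) x"
      proof (rule Qn_abs)
        fix z :: real assume z: "z \<ge> 0"
        have "\<bar>Ov (t k) z - bm_ratio N x * G z\<bar> \<le> 4 / sqrt N * (P + \<bar>t k - N\<bar> / N + x / sqrt N) * G z + 4 / sqrt N * \<kappa>"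
          unfolding P_def \<kappa>_def by (rule Ov_compare[OF N tk(1)[OF k] z x])
        also have "4 / sqrt N * (P + \<bar>t k - N\<bar> / N + x / sqrt N) * G z \<le> A * G z"
          unfolding A_def using N tk(2)[OF k] G_nonneg
          by (intro mult_right_mono mult_left_mono add_right_mono add_left_mono divide_right_mono) auto
        finally show "\<bar>Ov (t k) z - bm_ratio N x * G z\<bar> \<le> A * G z + 4 / sqrt N * \<kappa>" by simp
      qed (intro lin_diff lin_add lin_cmult lin_Ov lin_G lin_const x)+
      also have "\<dots> = A * a k + 4 / sqrt N * \<kappa> * p k x"
        using Qn_add[OF lin_cmult[OF lin_G, of A] lin_const[of "4 / sqrt N * \<kappa>"], of k]
        unfolding a_def Qn_const[of k "4 / sqrt N * \<kappa>", symmetric] Qn_cmult[of k A G, THEN fun_cong, symmetric] by (rule fun_cong)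
      finally show "\<bar>(Q ^^ k) (\<lambda>z. Ov (t k) z - bm_ratio N x * G z) x\<bar> \<le> A * a k + 4 / sqrt N * \<kappa> * p k x" .
    qed
    also have "\<dots> = 4 / sqrt N * ((P + 2 * hh n / N + x / sqrt N) * e m x + (\<Sum>k<m. real k / N * a k) + \<kappa> * (\<Sum>k<m. p k x))"
      unfolding em sum_distrib_left sum.distrib[symmetric] by (intro sum.cong refl) (simp add: algebra_simps add_divide_distrib)
    also have "\<dots> \<le> 4 / sqrt N * ((3 * P * renewal x + 2 * C3 / c4 * renewal x * P) + (P * renewal x + C2 * renewal x * P) + 2 * mdel * C1 * renewal x * P)"
    proof (intro mult_left_mono add_mono)
      have "(P + 2 * hh n / N) * e m x \<le> (3 * P) * renewal x"
        using h(3) P N emV e_nonneg by (intro mult_mono) auto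
      moreover have "x / sqrt N * e m x \<le> 2 * C3 / c4 * renewal x * P"
      proof -
        have s: "sqrt N \<ge> 1" using N by simp
        \<comment> \<open>One factor \<open>1 + x\<close> is absorbed by \<open>renewal x\<close>;
          the other, of power \<open>1 - bet\<close>, loses against \<open>sqrt N\<close> since
          \<open>x <= sqrt N\<close>.\<close>
        have "x / sqrt N * e m x \<le> (1 + x) / sqrt N * (C3 * (1 + x) powr (1 - bet))"
          using x N e_nonneg order_trans[OF e_le_einf C3(2)[OF x]] by (intro mult_mono divide_right_mono) auto
        also have "(1 + x) powr (1 - bet) \<le> (2 * sqrt N) powr (1 - bet)"
          using x xn s bet_lt_1 unfolding N_def[symmetric] by (intro powr_mono2) linarith+
        also have "(2 * sqrt N) powr (1 - bet) \<le> 2 * (sqrt N * P)"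
        proof -
          have "(2 * sqrt N) powr (1 - bet) = 2 powr (1 - bet) * (sqrt N) powr (1 - bet)" using s by (simp add: powr_mult)
          also have "\<dots> \<le> 2 powr 1 * (sqrt N * P)"
          proof (intro mult_mono)
            show "(2::real) powr (1 - bet) \<le> 2 powr 1" using bet_pos by (intro powr_mono) auto
            have "(sqrt N) powr (1 - bet) = N powr (1/2 * (1 - bet))" using N by (simp add: powr_half_sqrt[symmetric] powr_powr)
            also have "\<dots> \<le> N powr (1/2 + - eps)" using N bet_ge eps_pos by (intro powr_mono) auto
            also have "\<dots> = sqrt N * P" unfolding powr_add P_def using N by (simp add: powr_half_sqrt)
            finally show "(sqrt N) powr (1 - bet) \<le> sqrt N * P" .
          qed auto
          finally show ?thesis by simp
        qed
        finally have "x / sqrt N * e m x \<le> (1 + x) / sqrt N * (C3 * (2 * (sqrt N * P)))"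
          using x N C3(1) by (simp add: mult_left_mono divide_right_mono)
        also have "\<dots> = 2 * C3 / c4 * (c4 * (1 + x)) * P" using s c4(1) by simp
        also have "\<dots> \<le> 2 * C3 / c4 * renewal x * P"
          using c4 x C3(1) P by (intro mult_right_mono mult_left_mono) auto
        finally show ?thesis .
      qed
      ultimately show "(P + 2 * hh n / N + x / sqrt N) * e m x \<le> 3 * P * renewal x + 2 * C3 / c4 * renewal x * P"
        unfolding distrib_right[of _ "x / sqrt N"] by linarith
    next
      have NK: "N powr (1 - eps) \<le> real K" unfolding K_def by linarith
      moreover have "1 \<le> N powr (1 - eps)" using N eps_lt by (intro ge_one_powr_ge_zero) auto
      ultimately have K1: "1 \<le> K" by linarith
      have "(\<Sum>k<m. real k / N * a k) \<le> (\<Sum>k<m. P * a k + (if k < K then 0 else a k))"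
      proof (rule sum_mono)
        fix k assume "k \<in> {..<m}"
        show "real k / N * a k \<le> P * a k + (if k < K then 0 else a k)"
        proof (cases "k < K")
          case True
          then have "real k \<le> N powr (1 - eps)" unfolding K_def by linarith
          then have "real k / N \<le> N powr (1 - eps) / N" using N by (intro divide_right_mono) auto
          also have "\<dots> = P" using N powr_add[of N 1 "- eps"] by (simp add: P_def)
          finally show ?thesis using mult_right_mono[OF _ a0[of k], of "real k / N" P] True by simp
        next
          case False
          have "real k / N \<le> 1" using \<open>k \<in> {..<m}\<close> m N by (simp add: N_def)
          then have "real k / N * a k \<le> 1 * a k" using a0 by (intro mult_right_mono) auto
          then show ?thesis using False a0[of k] P by (simp add: add_increasing)
        qed
      qed
      also have "\<dots> = P * e m x + (\<Sum>k<m. if k < K then 0 else a k)" by (simp add: em sum.distrib sum_distrib_left)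
      also have "P * e m x \<le> P * renewal x" using P emV by (intro mult_left_mono) auto
      also have "(\<Sum>k<m. if k < K then 0 else a k) \<le> C2 * renewal x * P"
      proof -
        have "(\<Sum>k<m. if k < K then 0 else a k) \<le> (\<Sum>k<m + K. if k < K then 0 else a k)"
          using a0 by (intro sum_mono2) auto
        also have "\<dots> = (\<Sum>k<m + K. a k) - (\<Sum>k<m + K. if k < K then a k else 0)"
          unfolding sum_subtractf[symmetric] by (intro sum.cong) auto
        also have "(\<Sum>k<m + K. if k < K then a k else 0) = (\<Sum>k<K. a k)"
          by (rule sum.mono_neutral_cong_right) auto
        also have "(\<Sum>k<m + K. a k) - (\<Sum>k<K. a k) \<le> einf x - e K x"
          using e_le_einf[of "m + K" x] by (simp add: e_def a_def)
        also have "\<dots> \<le> C2 * renewal x * real K powr (- bet / 2)" by (rule C2(2)[OF K1 x])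
        also have "\<dots> \<le> C2 * renewal x * P"
        proof (intro mult_left_mono)
          have "real K powr (- bet / 2) \<le> (N powr (1 - eps)) powr (- bet / 2)"
            using NK N bet_pos by (intro powr_mono2') auto
          also have "\<dots> = N powr ((1 - eps) * (- bet / 2))" by (simp add: powr_powr)
          also have "\<dots> \<le> P" unfolding P_def
          proof (rule powr_mono)
            have "1/2 * (2 * eps) \<le> (1 - eps) * (bet / 2)" using eps_pos eps_lt bet_ge by (intro mult_mono) auto
            then show "(1 - eps) * (- bet / 2) \<le> - eps" by simp
          qed (rule N)
          finally show "real K powr (- bet / 2) \<le> P" .
        qed (use C2 V0 in auto)
        finally show ?thesis .
      qed
      finally show "(\<Sum>k<m. real k / N * a k) \<le> P * renewal x + C2 * renewal x * P" by simp
    next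
      have "(\<Sum>k<m. p k x) \<le> (\<Sum>k<n. p k x)" using m p_ge_0 by (intro sum_mono2) auto
      also have "\<dots> \<le> (\<Sum>k<n. C1 * renewal x * (1 / sqrt (real (Suc k))))" using C1(2)[OF x] by (intro sum_mono) auto
      also have "\<dots> = C1 * renewal x * (\<Sum>k<n. 1 / sqrt (real (Suc k)))" by (simp only: sum_distrib_left)
      also have "\<dots> \<le> C1 * renewal x * (2 * sqrt N)" unfolding N_def using C1(1) V0 by (intro mult_left_mono sum_inverse_sqrt) auto
      finally have "\<kappa> * (\<Sum>k<m. p k x) \<le> \<kappa> * (C1 * renewal x * (2 * sqrt N))"
        using kap_nonneg by (intro mult_left_mono) (auto simp: \<kappa>_def)
      also have "\<dots> = 2 * C1 * renewal x * (\<kappa> * sqrt N)" by simp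
      also have "\<dots> \<le> 2 * C1 * renewal x * (mdel * P)"
        using kap_near(1)[OF n] C1(1) V0 unfolding \<kappa>_def P_def N_def by (intro mult_left_mono) auto
      finally show "\<kappa> * (\<Sum>k<m. p k x) \<le> 2 * mdel * C1 * renewal x * P" by (simp add: ac_simps)
    qed (use N in auto)
    also have "\<dots> = C * renewal x * (P / sqrt N)" unfolding C_def by (simp add: algebra_simps add_divide_distrib)
    finally show ?thesis by (simp only: m_def N_def P_def t_def)
  qed
  then show ?thesis using C by blast
qed

lemma Qn_Ov_le:
  assumes n: "n \<ge> 1" and x: "x \<ge> 0"
  shows "(Q ^^ k) (Ov (hh n + real j)) x \<le> 1 / sqrt (hh n) * (Q ^^ k) G x"
proof -
  have tp: "hh n + real j > 0" using hh_facts(1)[OF n] by linarith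
  have "(Q ^^ k) (Ov (hh n + real j)) x \<le> (Q ^^ k) (\<lambda>z. 1 / sqrt (hh n) * G z) x"
  proof (intro Qn_mono lin_Ov lin_cmult lin_G x)
    fix z :: real
    have "Ov (hh n + real j) z \<le> 1 / sqrt (hh n + real j) * G z" by (rule Ov_le[OF tp])
    also have "\<dots> \<le> 1 / sqrt (hh n) * G z"
      using hh_facts(1)[OF n] G_nonneg by (intro mult_right_mono divide_left_mono) (auto intro!: mult_pos_pos)
    finally show "Ov (hh n + real j) z \<le> 1 / sqrt (hh n) * G z" .
  qed
  then show ?thesis unfolding Qn_cmult .
qed

text \<open>Freezing fails close to the terminal time, so the kernel is bounded by
  \<open>1 / sqrt (hh n) = n powr (eps - 1/2)\<close>. The excess \<open>n^eps\<close> is paid by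
  the overshoot tail after \<open>n / 2\<close>, which is of order
  \<open>V(x) * n powr (- 2 * eps)\<close> because \<open>4 * eps <= bet\<close>.\<close>

lemma late_overshoot: "\<exists>C>0. \<forall>n\<ge>1. \<forall>x\<ge>0.
  0 \<le> (\<Sum>k\<in>{(n + 1) div 2..<n}. (Q ^^ k) (Ov (rem n k)) x) \<and>
  (\<Sum>k\<in>{(n + 1) div 2..<n}. (Q ^^ k) (Ov (rem n k)) x)
    \<le> C * renewal x * (rate n / sqrt (real n)) \<and>
  bm_ratio (real n) x * (einf x - e ((n + 1) div 2) x) \<le> C * renewal x * (rate n / sqrt (real n))"
proof -
  obtain C2 where C2: "C2 > 0" "\<And>k x. k \<ge> 1 \<Longrightarrow> x \<ge> 0 \<Longrightarrow> einf x - e k x \<le> C2 * renewal x * real k powr (- bet / 2)"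
    using e_tail by blast
  have "0 \<le> (\<Sum>k\<in>{(n + 1) div 2..<n}. (Q ^^ k) (Ov (rem n k)) x) \<and>
  (\<Sum>k\<in>{(n + 1) div 2..<n}. (Q ^^ k) (Ov (rem n k)) x)
    \<le> 2 * C2 * renewal x * (rate n / sqrt (real n)) \<and>
  bm_ratio (real n) x * (einf x - e ((n + 1) div 2) x) \<le> 2 * C2 * renewal x * (rate n / sqrt (real n))"
    if n: "n \<ge> 1" and x: "x \<ge> 0" for n x
  proof (intro conjI)
    define N where "N = real n"
    define m where "m = (n + 1) div 2"
    have N: "N \<ge> 1" using n by (simp add: N_def)
    note h = hh_facts[OF n, folded N_def]
    have m: "m \<ge> 1" "m \<le> n" "N / 2 \<le> real m" using n by (auto simp: m_def N_def)
    have V0: "renewal x \<ge> 0" by (rule renewal_nonneg)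
    have tail: "einf x - e m x \<le> 2 * C2 * renewal x * N powr (- 2 * eps)"
    proof -
      have "einf x - e m x \<le> C2 * renewal x * real m powr (- bet / 2)" by (rule C2(2)[OF m(1) x])
      also have "\<dots> \<le> C2 * renewal x * (2 * N powr (- 2 * eps))"
      proof (intro mult_left_mono)
        have "real m powr (- bet / 2) \<le> (N / 2) powr (- bet / 2)" using m N bet_pos by (intro powr_mono2') auto
        also have "\<dots> = 2 powr (bet / 2) * N powr (- bet / 2)" using N by (simp add: powr_divide powr_minus_divide)
        also have "\<dots> \<le> 2 powr 1 * N powr (- 2 * eps)" using bet_lt_1 bet_ge N by (intro mult_mono powr_mono) auto
        finally show "real m powr (- bet / 2) \<le> 2 * N powr (- 2 * eps)" by simp
      qed (use C2 V0 in auto)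
      finally show ?thesis by simp
    qed
    have t1: "rem n k \<ge> hh n" for k by simp
    have tp: "rem n k > 0" for k using t1[of k] h(1) by linarith
    show "0 \<le> (\<Sum>k\<in>{m..<n}. (Q ^^ k) (Ov (rem n k)) x)"
      by (intro sum_nonneg Qn_nonneg Ov_nonneg tp lin_Ov x)
    have "(\<Sum>k\<in>{m..<n}. (Q ^^ k) (Ov (rem n k)) x) \<le> (\<Sum>k\<in>{m..<n}. 1 / sqrt (hh n) * (Q ^^ k) G x)"
      by (intro sum_mono Qn_Ov_le n x)
    also have "\<dots> = 1 / sqrt (hh n) * (e n x - e m x)"
      unfolding e_def using sum.atLeastLessThan_concat[of 0 m n "\<lambda>k. (Q ^^ k) G x"] m
      by (simp only: sum_distrib_left[symmetric] atLeast0LessThan) simp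
    also have "\<dots> \<le> 1 / sqrt (hh n) * (2 * C2 * renewal x * N powr (- 2 * eps))"
      using tail e_le_einf[of n x] h(1) by (intro mult_left_mono) auto
    also have "\<dots> = 2 * C2 * renewal x * (N powr (eps - 1/2) * N powr (- 2 * eps))" unfolding h(7) by simp
    also have "N powr (eps - 1/2) * N powr (- 2 * eps) = N powr (- eps) / sqrt N"
    proof -
      have "N powr (eps - 1/2) * N powr (- 2 * eps) = N powr (- eps + - 1/2)" by (simp flip: powr_add)
      also have "\<dots> = N powr (- eps) * N powr (- (1/2))" by (simp only: powr_add) simp
      also have "N powr (- (1/2)) = 1 / sqrt N" using N by (simp add: powr_minus_divide powr_half_sqrt)
      finally show ?thesis by simp
    qed
    finally show "(\<Sum>k\<in>{m..<n}. (Q ^^ k) (Ov (rem n k)) x) \<le> 2 * C2 * renewal x * (N powr (- eps) / sqrt N)" .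
    have "bm_ratio N x * (einf x - e m x) \<le> 1 / sqrt N * (2 * C2 * renewal x * N powr (- 2 * eps))"
      using N tail e_le_einf[of m x] bm_ratio_le[of N x] by (intro mult_mono) auto
    also have "\<dots> \<le> 1 / sqrt N * (2 * C2 * renewal x * N powr (- eps))"
      using N eps_pos V0 C2(1) by (intro mult_left_mono powr_mono) auto
    finally show "bm_ratio N x * (einf x - e m x) \<le> 2 * C2 * renewal x * (N powr (- eps) / sqrt N)" by simp
  qed
  then show ?thesis using C2(1) by (intro exI[of _ "2 * C2"]) auto
qed


section \<open>Three ranges of nonnegative starting points\<close>

lemma near_estimate: "\<exists>C>0. \<forall>n\<ge>1. \<forall>x\<ge>0. x \<le> sqrt (real n) \<longrightarrow>
  \<bar>p n x - renewal x * bm_ratio (real n) x\<bar> \<le> C * renewal x * (rate n / sqrt (real n))"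
proof -
  obtain C1 where C1: "C1 > 0" "\<And>n x. x \<ge> 0 \<Longrightarrow> p n x \<le> C1 * renewal x / sqrt (real (Suc n))" using p_upper by blast
  obtain C2 where C2: "C2 > 0" "\<And>n x. n \<ge> 1 \<Longrightarrow> x \<ge> 0 \<Longrightarrow>
    \<bar>\<Sum>k<n. (Q ^^ k) (lerr (rem n k)) x\<bar> \<le> C2 * renewal x * (rate n / sqrt (real n))"
    using lerr_near by blast
  obtain C3 where C3: "C3 > 0" "\<And>n x. n \<ge> 1 \<Longrightarrow> x \<ge> 0 \<Longrightarrow> x \<le> sqrt (real n) \<Longrightarrow>
    \<bar>(\<Sum>k<(n + 1) div 2. (Q ^^ k) (Ov (rem n k)) x) - bm_ratio (real n) x * e ((n + 1) div 2) x\<bar>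
    \<le> C3 * renewal x * (rate n / sqrt (real n))" using early_overshoot by blast
  obtain C4 where C4: "C4 > 0" "\<And>n x. n \<ge> 1 \<Longrightarrow> x \<ge> 0 \<Longrightarrow> 0 \<le> (\<Sum>k\<in>{(n + 1) div 2..<n}. (Q ^^ k) (Ov (rem n k)) x)"
    "\<And>n x. n \<ge> 1 \<Longrightarrow> x \<ge> 0 \<Longrightarrow> (\<Sum>k\<in>{(n + 1) div 2..<n}. (Q ^^ k) (Ov (rem n k)) x)
      \<le> C4 * renewal x * (rate n / sqrt (real n))"
    "\<And>n x. n \<ge> 1 \<Longrightarrow> x \<ge> 0 \<Longrightarrow> bm_ratio (real n) x * (einf x - e ((n + 1) div 2) x) \<le> C4 * renewal x * (rate n / sqrt (real n))"
    using late_overshoot by blast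
  obtain C5 where C5: "C5 > 0" "\<And>n h x. n \<ge> 1 \<Longrightarrow> h > 0 \<Longrightarrow> x \<ge> 0 \<Longrightarrow> 0 \<le> (Q ^^ n) (\<lambda>z. 1 - bm_surv h z) x"
    "\<And>n h x. n \<ge> 1 \<Longrightarrow> h > 0 \<Longrightarrow> x \<ge> 0 \<Longrightarrow> (Q ^^ n) (\<lambda>z. 1 - bm_surv h z) x \<le> C5 * (sqrt (h / real n) + 1 / h) * p (n div 2) x"
    using endpoint_bound by blast
  define C where "C = 2 + C2 + C3 + 2 * C4 + 4 * C5 * C1"
  have "\<bar>p n x - renewal x * bm_ratio (real n) x\<bar> \<le> C * renewal x * (rate n / sqrt (real n))"
    if n: "n \<ge> 1" and x: "x \<ge> 0" and xn: "x \<le> sqrt (real n)" for n x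
  proof -
    define N where "N = real n"
    define D where "D = renewal x * (N powr (- eps) / sqrt N)"
    define m where "m = (n + 1) div 2"
    have N: "N \<ge> 1" using n by (simp add: N_def)
    note h = hh_facts[OF n, folded N_def]
    have V0: "renewal x \<ge> 0" by (rule renewal_nonneg)
    have h0: "hh n > 0" using h(1) by linarith
    have 1: "\<bar>bm_surv (hh n + N) x - bm_surv N x\<bar> \<le> 2 * D"
    proof -
      have "\<bar>bm_surv (hh n + N) x - bm_surv N x\<bar> \<le> 2 * x / sqrt N * (hh n / N)"
        using N h0 x xn by (intro bm_surv_time_diff_near) (auto simp: N_def)
      also have "\<dots> \<le> 2 * renewal x / sqrt N * N powr (- eps)"
        using N h(3) h0 x renewal_ge[of x] by (intro mult_mono divide_right_mono) auto
      finally show ?thesis by (simp add: D_def)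
    qed
    have 2: "0 \<le> (Q ^^ n) (\<lambda>z. 1 - bm_surv (hh n) z) x" "(Q ^^ n) (\<lambda>z. 1 - bm_surv (hh n) z) x \<le> 4 * C5 * C1 * D"
    proof -
      show "0 \<le> (Q ^^ n) (\<lambda>z. 1 - bm_surv (hh n) z) x" by (rule C5(2)[OF n h0 x])
      have "(Q ^^ n) (\<lambda>z. 1 - bm_surv (hh n) z) x \<le> C5 * (sqrt (hh n / N) + 1 / hh n) * p (n div 2) x"
        unfolding N_def by (rule C5(3)[OF n h0 x])
      also have "\<dots> \<le> C5 * (2 * N powr (- eps)) * (C1 * renewal x * (2 / sqrt N))"
      proof (intro mult_mono mult_left_mono)
        show "sqrt (hh n / N) + 1 / hh n \<le> 2 * N powr (- eps)" using h(4,5) by simp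
        have "p (n div 2) x \<le> C1 * renewal x * (1 / sqrt (real (Suc (n div 2))))" using C1(2)[OF x, of "n div 2"] by simp
        also have "\<dots> \<le> C1 * renewal x * (2 / sqrt N)"
        proof (intro mult_left_mono)
          have "N \<le> 4 * real (Suc (n div 2))"
          proof -
            have "n \<le> 4 * Suc (n div 2)" by presburger
            then have "real n \<le> real (4 * Suc (n div 2))" by (rule of_nat_mono)
            then show ?thesis by (simp add: N_def)
          qed
          then have "sqrt N \<le> sqrt (4 * real (Suc (n div 2)))" by (intro real_sqrt_le_mono)
          then have "sqrt N \<le> 2 * sqrt (real (Suc (n div 2)))" unfolding real_sqrt_mult by (simp only: real_sqrt_four)
          then show "1 / sqrt (real (Suc (n div 2))) \<le> 2 / sqrt N" using N by (simp add: field_simps)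
        qed (use C1 V0 in auto)
        finally show "p (n div 2) x \<le> C1 * renewal x * (2 / sqrt N)" .
      qed (use C5(1) h0 N p_ge_0 in auto)
      finally show "(Q ^^ n) (\<lambda>z. 1 - bm_surv (hh n) z) x \<le> 4 * C5 * C1 * D" by (simp add: D_def ac_simps)
    qed
    define S1 where "S1 = (\<Sum>k<m. (Q ^^ k) (Ov (rem n k)) x)"
    define S2 where "S2 = (\<Sum>k\<in>{m..<n}. (Q ^^ k) (Ov (rem n k)) x)"
    define S3 where "S3 = (\<Sum>k<n. (Q ^^ k) (lerr (rem n k)) x)"
    have m: "m \<le> n" using n by (auto simp: m_def)
    have S12: "(\<Sum>k<n. (Q ^^ k) (Ov (rem n k)) x) = S1 + S2"
      unfolding S1_def S2_def
      using sum.atLeastLessThan_concat[of 0 m n "\<lambda>k. (Q ^^ k) (Ov (rem n k)) x"] m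
      by (simp only: atLeast0LessThan)
    have 3: "\<bar>S3\<bar> \<le> C2 * D" using C2(2)[OF n x] by (simp add: S3_def D_def N_def)
    have 4: "\<bar>S1 - bm_ratio N x * e m x\<bar> \<le> C3 * D" using C3(2)[OF n x xn] by (simp add: S1_def D_def N_def m_def)
    have 5: "0 \<le> S2" "S2 \<le> C4 * D" "bm_ratio N x * (einf x - e m x) \<le> C4 * D"
      using C4(2,3,4)[OF n x] by (simp_all add: S2_def D_def N_def m_def)
    have 6: "0 \<le> bm_ratio N x * (einf x - e m x)" using bm_ratio_nonneg[of N x] N e_le_einf[of m x] by (intro mult_nonneg_nonneg) auto
    have "p n x - bm_surv (hh n + N) x = (Q ^^ n) (\<lambda>z. 1 - bm_surv (hh n) z) x + (S1 + S2) - S3"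
      using p_decomposition[of n x "hh n"] unfolding S12 S3_def N_def .
    \<comment> \<open>\<open>renewal x\<close> is split as \<open>x\<close>, the overshoot up to
      time \<open>m\<close>, and the rest: the first matches the Brownian term, the second
      \<open>S1\<close>, and the third is negligible.\<close>
    moreover have "renewal x * bm_ratio N x = bm_surv N x + bm_ratio N x * e m x + bm_ratio N x * (einf x - e m x)"
      using N by (simp add: bm_surv_eq_l renewal_def algebra_simps)
    ultimately have "p n x - renewal x * bm_ratio N x = (bm_surv (hh n + N) x - bm_surv N x) + (Q ^^ n) (\<lambda>z. 1 - bm_surv (hh n) z) x
        + (S1 - bm_ratio N x * e m x) + S2 - S3 - bm_ratio N x * (einf x - e m x)" by linarith
    then have "\<bar>p n x - renewal x * bm_ratio N x\<bar> \<le> 2 * D + 4 * C5 * C1 * D + C3 * D + C4 * D + C2 * D + C4 * D"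
      using 1 2 3 4 5 6 by linarith
    also have "\<dots> = C * D" by (simp add: C_def algebra_simps)
    finally show ?thesis by (simp add: D_def N_def mult.assoc)
  qed
  moreover have "C > 0" unfolding C_def using C1(1) C2(1) C3(1) C4(1) C5(1) by (simp add: add_pos_pos)
  ultimately show ?thesis by blast
qed

text \<open>\<open>bm_ratio\<close> is at most \<open>1 / x\<close>, and the overshoot grows at most
  like \<open>x^(1 - bet)\<close>; so beyond \<open>sqrt n\<close> the main term is
  \<open>H (x / sqrt n)\<close> up to the target rate.\<close>

lemma einf_l_far: "\<exists>C>0. \<forall>n\<ge>1. \<forall>x. sqrt (real n) \<le> x \<longrightarrow> einf x * bm_ratio (real n) x \<le> C * rate n"
proof -
  obtain C3 where C3: "C3 > 0" "\<And>x. x \<ge> 0 \<Longrightarrow> einf x \<le> C3 * (1 + x) powr (1 - bet)" using einf_bound by blast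
  have "einf x * bm_ratio (real n) x \<le> 2 * C3 * rate n" if n: "n \<ge> 1" and x: "sqrt (real n) \<le> x" for n x
  proof -
    define N where "N = real n"
    have N: "N \<ge> 1" using n by (simp add: N_def)
    have "1 \<le> sqrt N" using N by simp
    then have x1: "x \<ge> 1" using x unfolding N_def by linarith
    have "(1 + x) powr (1 - bet) \<le> (2 * x) powr (1 - bet)" using x1 bet_lt_1 by (intro powr_mono2) auto
    also have "\<dots> = 2 powr (1 - bet) * x powr (1 - bet)" using x1 by (simp add: powr_mult)
    also have "\<dots> \<le> 2 powr 1 * x powr (1 - bet)" using bet_pos by (intro mult_right_mono powr_mono) auto
    also have "x powr (1 - bet) = x * x powr (- bet)" using powr_add[of x 1 "- bet"] x1 by simp
    finally have "C3 * (1 + x) powr (1 - bet) \<le> C3 * (2 * (x * x powr (- bet)))"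
      using C3(1) by (intro mult_left_mono) auto
    then have "einf x \<le> C3 * (2 * (x * x powr (- bet)))" using C3(2)[of x] x1 by linarith
    then have "einf x * bm_ratio N x \<le> C3 * (2 * (x * x powr (- bet))) * (1 / x)"
      using bm_ratio_le_inverse[of N x] N x1 C3(1) bm_ratio_nonneg[of N x] by (intro mult_mono) auto
    also have "\<dots> = 2 * C3 * x powr (- bet)" using x1 by simp
    also have "\<dots> \<le> 2 * C3 * N powr (- eps)"
    proof (intro mult_left_mono)
      have "x powr (- bet) \<le> (sqrt N) powr (- bet)" using x N bet_pos unfolding N_def by (intro powr_mono2') auto
      also have "\<dots> = N powr (1/2 * - bet)" using N by (simp add: powr_half_sqrt[symmetric] powr_powr)
      also have "\<dots> \<le> N powr (- eps)" using N bet_ge eps_pos by (intro powr_mono) auto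
      finally show "x powr (- bet) \<le> N powr (- eps)" .
    qed (use C3 in auto)
    finally show ?thesis by (simp add: N_def)
  qed
  then show ?thesis using C3(1) by (intro exI[of _ "2 * C3"]) auto
qed

text \<open>Here the main term is bounded below and errors need no survival weight. The growing one
  is the overshoot, bounded by \<open>e n x / sqrt (hh n)\<close>; the upper end of the range is
  where this bound reaches \<open>rate n\<close>.\<close>

lemma middle_estimate: "\<exists>C>0. \<forall>n\<ge>1. \<forall>x. sqrt (real n) \<le> x \<longrightarrow> x \<le> real n powr (1/2 + eps/2) \<longrightarrow>
  \<bar>p n x - bm_surv (real n) x\<bar> \<le> C * rate n"
proof -
  obtain C2 where C2: "C2 > 0" "\<And>n x. n \<ge> 1 \<Longrightarrow> x \<ge> 0 \<Longrightarrow>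
    \<bar>\<Sum>k<n. (Q ^^ k) (lerr (rem n k)) x\<bar> \<le> C2 * rate n"
    using lerr_far by blast
  obtain C3 where C3: "C3 > 0" "\<And>x. x \<ge> 0 \<Longrightarrow> einf x \<le> C3 * (1 + x) powr (1 - bet)" using einf_bound by blast
  obtain C5 where C5: "C5 > 0" "\<And>n h x. n \<ge> 1 \<Longrightarrow> h > 0 \<Longrightarrow> x \<ge> 0 \<Longrightarrow> 0 \<le> (Q ^^ n) (\<lambda>z. 1 - bm_surv h z) x"
    "\<And>n h x. n \<ge> 1 \<Longrightarrow> h > 0 \<Longrightarrow> x \<ge> 0 \<Longrightarrow> (Q ^^ n) (\<lambda>z. 1 - bm_surv h z) x \<le> C5 * (sqrt (h / real n) + 1 / h) * p (n div 2) x"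
    using endpoint_bound by blast
  define C where "C = 24 + C2 + 2 * C3 + 2 * C5"
  have "\<bar>p n x - bm_surv (real n) x\<bar> \<le> C * rate n"
    if n: "n \<ge> 1" and xl: "sqrt (real n) \<le> x" and xu: "x \<le> real n powr (1/2 + eps/2)" for n x
  proof -
    define N where "N = real n"
    define D where "D = N powr (- eps)"
    have N: "N \<ge> 1" using n by (simp add: N_def)
    note h = hh_facts[OF n, folded N_def]
    have h0: "hh n > 0" using h(1) by linarith
    have "1 \<le> sqrt N" using N by simp
    then have x1: "x \<ge> 1" using xl unfolding N_def by linarith
    then have x: "x \<ge> 0" by simp
    have D0: "D \<ge> 0" by (simp add: D_def)
    have 1: "\<bar>bm_surv (hh n + N) x - bm_surv N x\<bar> \<le> 24 * D"
      using bm_surv_time_diff[of N "hh n" x] N h0 h(2,3) unfolding D_def by linarith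
    have 2: "0 \<le> (Q ^^ n) (\<lambda>z. 1 - bm_surv (hh n) z) x" "(Q ^^ n) (\<lambda>z. 1 - bm_surv (hh n) z) x \<le> 2 * C5 * D"
    proof -
      show "0 \<le> (Q ^^ n) (\<lambda>z. 1 - bm_surv (hh n) z) x" by (rule C5(2)[OF n h0 x])
      have "(Q ^^ n) (\<lambda>z. 1 - bm_surv (hh n) z) x \<le> C5 * (sqrt (hh n / N) + 1 / hh n) * p (n div 2) x"
        unfolding N_def by (rule C5(3)[OF n h0 x])
      also have "\<dots> \<le> C5 * (2 * D) * 1"
        using h(4,5) C5(1) h0 N D0 p_ge_0 p_le_1 by (intro mult_mono) (auto simp: D_def)
      finally show "(Q ^^ n) (\<lambda>z. 1 - bm_surv (hh n) z) x \<le> 2 * C5 * D" by simp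
    qed
    define S where "S = (\<Sum>k<n. (Q ^^ k) (Ov (rem n k)) x)"
    define S3 where "S3 = (\<Sum>k<n. (Q ^^ k) (lerr (rem n k)) x)"
    have 3: "\<bar>S3\<bar> \<le> C2 * D" using C2(2)[OF n x] by (simp add: S3_def D_def N_def)
    have tp: "rem n k > 0" for k using h0 by linarith
    have S0: "0 \<le> S" unfolding S_def by (intro sum_nonneg Qn_nonneg Ov_nonneg tp lin_Ov x)
    have "S \<le> (\<Sum>k<n. 1 / sqrt (hh n) * (Q ^^ k) G x)"
      unfolding S_def by (intro sum_mono Qn_Ov_le n x)
    also have "\<dots> = 1 / sqrt (hh n) * e n x" by (simp only: e_def sum_distrib_left)
    also have "\<dots> \<le> 1 / sqrt (hh n) * (C3 * (2 * x powr (1 - bet)))"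
    proof (intro mult_left_mono)
      have "e n x \<le> C3 * (1 + x) powr (1 - bet)" using e_le_einf[of n x] C3(2)[OF x] by linarith
      also have "\<dots> \<le> C3 * (2 * x powr (1 - bet))"
      proof (intro mult_left_mono)
        have "(1 + x) powr (1 - bet) \<le> (2 * x) powr (1 - bet)" using x1 bet_lt_1 by (intro powr_mono2) auto
        also have "\<dots> = 2 powr (1 - bet) * x powr (1 - bet)" using x1 by (simp add: powr_mult)
        also have "\<dots> \<le> 2 powr 1 * x powr (1 - bet)" using bet_pos by (intro mult_right_mono powr_mono) auto
        finally show "(1 + x) powr (1 - bet) \<le> 2 * x powr (1 - bet)" by simp
      qed (use C3 in auto)
      finally show "e n x \<le> C3 * (2 * x powr (1 - bet))" .
    qed (use h0 in auto)
    also have "\<dots> = 2 * C3 * (N powr (eps - 1/2) * x powr (1 - bet))" unfolding h(7) by simp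
    also have "\<dots> \<le> 2 * C3 * D"
    proof (intro mult_left_mono)
      have "x powr (1 - bet) \<le> (N powr (1/2 + eps/2)) powr (1 - bet)"
        using x xu bet_lt_1 by (intro powr_mono2) (auto simp: N_def)
      also have "\<dots> = N powr ((1/2 + eps/2) * (1 - bet))" by (simp add: powr_powr)
      finally have "N powr (eps - 1/2) * x powr (1 - bet) \<le> N powr (eps - 1/2) * N powr ((1/2 + eps/2) * (1 - bet))"
        by (intro mult_left_mono) auto
      also have "\<dots> = N powr (eps - 1/2 + (1/2 + eps/2) * (1 - bet))" by (simp add: powr_add)
      also have "eps - 1/2 + (1/2 + eps/2) * (1 - bet) = - eps"
        using bet_eps by (simp add: field_simps)
      finally show "N powr (eps - 1/2) * x powr (1 - bet) \<le> D" by (simp add: D_def)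
    qed (use C3 in auto)
    finally have 4: "S \<le> 2 * C3 * D" .
    have "p n x - bm_surv (hh n + N) x = (Q ^^ n) (\<lambda>z. 1 - bm_surv (hh n) z) x + S - S3"
      using p_decomposition[of n x "hh n"] unfolding S_def S3_def N_def .
    then have "\<bar>p n x - bm_surv N x\<bar> \<le> 24 * D + 2 * C5 * D + 2 * C3 * D + C2 * D"
      using 1 2 3 4 S0 by linarith
    also have "\<dots> = C * D" by (simp add: C_def algebra_simps)
    finally show ?thesis by (simp add: D_def N_def)
  qed
  moreover have "C > 0" unfolding C_def using C2(1) C3(1) C5(1) by (simp add: add_pos_pos)
  ultimately show ?thesis by blast
qed

text \<open>Kolmogorov's maximal inequality, via the superharmonic function \<open>((x - z)\<^sup>2 + n) / x\<^sup>2\<close>.\<close>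

lemma exit_bound: assumes x: "x > 0" shows "1 - p n z \<le> ((x - z)\<^sup>2 + real n) / x\<^sup>2"
proof (induction n arbitrary: z)
  case 0 then show ?case by simp
next
  case (Suc n)
  have lp: "lin_growth (\<lambda>y. indicator {0..} y * p n y)" by (intro lin_ind lin_Qn lin_const) auto
  have "1 - p (Suc n) z = (\<integral>y. 1 - indicator {0..} (z + y) * p n (z + y) \<partial>M)"
    using lin_integrable[OF lp, of z] by (simp add: Q_def T_def)
  also have "\<dots> \<le> (\<integral>y. ((x - z)\<^sup>2 - 2 * (x - z) * y + y\<^sup>2 + real n) / x\<^sup>2 \<partial>M)"
  proof (rule integral_mono)
    show "integrable M (\<lambda>y. 1 - indicator {0..} (z + y) * p n (z + y))" using lin_integrable[OF lp, of z] by simp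
    show "integrable M (\<lambda>y. ((x - z)\<^sup>2 - 2 * (x - z) * y + y\<^sup>2 + real n) / x\<^sup>2)" using int1 int2 by simp
    fix y
    have eq: "(x - z)\<^sup>2 - 2 * (x - z) * y + y\<^sup>2 = (x - (z + y))\<^sup>2" by (simp add: power2_eq_square algebra_simps)
    show "1 - indicator {0..} (z + y) * p n (z + y) \<le> ((x - z)\<^sup>2 - 2 * (x - z) * y + y\<^sup>2 + real n) / x\<^sup>2"
    proof (cases "z + y \<ge> 0")
      case True
      then show ?thesis unfolding eq using Suc.IH[of "z + y"] by simp
    next
      case False
      then have "x\<^sup>2 \<le> (x - (z + y))\<^sup>2" using x by (intro power_mono) auto
      then have "x\<^sup>2 \<le> (x - (z + y))\<^sup>2 + real n" by simp
      then show ?thesis unfolding eq using False x by simp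
    qed
  qed
  also have "\<dots> = ((x - z)\<^sup>2 + real (Suc n)) / x\<^sup>2" using int1 int2 mean0 var1 by simp
  finally show ?case .
qed

text \<open>Both quantities differ from 1 by a multiple of \<open>n / x^2\<close>, by
  \<open>exit_bound\<close> and the Gaussian tail, and this is at most \<open>rate n\<close> in the
  stated range.\<close>

lemma far_estimate:
  assumes n: "n \<ge> 1" and x: "real n powr (1/2 + eps/2) \<le> x"
  shows "\<bar>p n x - bm_surv (real n) x\<bar> \<le> 3 * rate n"
proof -
  define N where "N = real n"
  have N: "N \<ge> 1" using n by (simp add: N_def)
  have np: "0 < N powr (1/2 + eps/2)" using N by simp
  have x0: "x > 0" using less_le_trans[OF np[unfolded N_def] x] .
  have "(N powr (1/2 + eps/2))\<^sup>2 \<le> x\<^sup>2" using x np by (intro power_mono) (auto simp: N_def)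
  moreover have "(N powr (1/2 + eps/2))\<^sup>2 = N powr (1 + eps)"
    using N by (simp add: power2_eq_square flip: powr_add)
  ultimately have "N / x\<^sup>2 \<le> N / N powr (1 + eps)" using N x0 by (intro divide_left_mono) auto
  also have "\<dots> = N powr (- eps)" using N by (simp add: powr_add powr_minus_divide)
  finally have q: "N / x\<^sup>2 \<le> N powr (- eps)" .
  have 1: "1 - p n x \<le> N powr (- eps)" using exit_bound[OF x0, of n x] q by (simp add: N_def)
  have "1 - bm_surv N x \<le> exp (- (x / sqrt N)\<^sup>2 / 2)" unfolding bm_surv_def using x0 N by (intro H_tail) auto
  also have "\<dots> \<le> 2 * (N / x\<^sup>2)"
  proof -
    define y where "y = x\<^sup>2 / (2 * N)"
    have y: "y > 0" using x0 N by (simp add: y_def)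
    have "1 + y \<le> exp y" by (rule exp_ge_add_one_self)
    then have "y \<le> exp y" by linarith
    then have "exp (- y) \<le> 1 / y" using y by (simp add: exp_minus field_simps)
    then show ?thesis using N by (simp add: y_def power_divide mult.commute)
  qed
  finally have 2: "1 - bm_surv N x \<le> 2 * N powr (- eps)" using q by linarith
  have "p n x \<le> 1" "bm_surv N x \<le> 1" using p_le_1 H_bounds by (auto simp: bm_surv_def)
  then show ?thesis using 1 2 unfolding N_def[symmetric] by (intro abs_leI) linarith+
qed

text \<open>Purely relative, with no additive term: \<open>H_slope\<close> bounds the main term
  below by a multiple of \<open>V(x) / sqrt n\<close> up to \<open>sqrt n\<close>, and by a constant
  beyond.\<close>

lemma nonneg_estimate: "\<exists>C>0. \<forall>n\<ge>1. \<forall>x\<ge>0.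
  \<bar>p n x - renewal x * bm_ratio (real n) x\<bar> \<le> C * (renewal x * bm_ratio (real n) x) * rate n"
proof -
  obtain C1 where C1: "C1 > 0" "\<And>n x. n \<ge> 1 \<Longrightarrow> x \<ge> 0 \<Longrightarrow> x \<le> sqrt (real n) \<Longrightarrow>
    \<bar>p n x - renewal x * bm_ratio (real n) x\<bar> \<le> C1 * renewal x * (rate n / sqrt (real n))" using near_estimate by blast
  obtain C2 where C2: "C2 > 0" "\<And>n x. n \<ge> 1 \<Longrightarrow> sqrt (real n) \<le> x \<Longrightarrow> x \<le> real n powr (1/2 + eps/2) \<Longrightarrow>
    \<bar>p n x - bm_surv (real n) x\<bar> \<le> C2 * rate n" using middle_estimate by blast
  obtain C3 where C3: "C3 > 0" "\<And>n x. n \<ge> 1 \<Longrightarrow> sqrt (real n) \<le> x \<Longrightarrow> einf x * bm_ratio (real n) x \<le> C3 * rate n"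
    using einf_l_far by blast
  define C where "C = (C1 + C2 + 3 + C3) / H_slope"
  have "\<bar>p n x - renewal x * bm_ratio (real n) x\<bar> \<le> C * (renewal x * bm_ratio (real n) x) * rate n"
    if n: "n \<ge> 1" and x: "x \<ge> 0" for n x
  proof -
    define N where "N = real n"
    define P where "P = N powr (- eps)"
    have N: "N \<ge> 1" using n by (simp add: N_def)
    have P: "P \<ge> 0" by (simp add: P_def)
    have V0: "renewal x \<ge> 0" by (rule renewal_nonneg)
    show ?thesis
    proof (cases "x \<le> sqrt N")
      case True
      have "\<bar>x / sqrt N\<bar> \<le> 1" using True x N by simp
      then have "H_slope / sqrt N \<le> bm_ratio N x" unfolding bm_ratio_def using N by (intro divide_right_mono L_lower) auto
      then have "renewal x * (H_slope / sqrt N) \<le> renewal x * bm_ratio N x" using V0 by (intro mult_left_mono)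
      then have q: "renewal x / sqrt N \<le> (renewal x * bm_ratio N x) / H_slope" using H_slope_pos by (simp add: field_simps)
      have "\<bar>p n x - renewal x * bm_ratio N x\<bar> \<le> C1 * P * (renewal x / sqrt N)"
        using C1(2)[OF n x] True by (simp add: N_def P_def ac_simps)
      also have "\<dots> \<le> (C1 + C2 + 3 + C3) * P * ((renewal x * bm_ratio N x) / H_slope)"
        using q C1(1) C2(1) C3(1) P V0 N bm_ratio_nonneg[of N x] by (intro mult_mono mult_right_mono) auto
      finally show ?thesis by (simp add: C_def N_def P_def ac_simps)
    next
      case False
      then have xl: "sqrt (real n) \<le> x" by (simp add: N_def)
      have "H_slope = H_slope * 1" by simp
      also have "\<dots> \<le> H 1" by (rule H_lower) auto
      also have "\<dots> \<le> bm_surv N x" unfolding bm_surv_def using False N by (intro H_mono) simp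
      also have "\<dots> \<le> renewal x * bm_ratio N x"
        using N renewal_ge[of x] bm_ratio_nonneg[of N x] by (simp add: bm_surv_eq_l mult_right_mono)
      finally have q: "1 \<le> (renewal x * bm_ratio N x) / H_slope" using H_slope_pos by (simp add: field_simps)
      have A: "\<bar>p n x - bm_surv N x\<bar> \<le> (C2 + 3) * P"
      proof (cases "x \<le> N powr (1/2 + eps/2)")
        case True
        then have "\<bar>p n x - bm_surv N x\<bar> \<le> C2 * P" using C2(2)[OF n xl] by (simp add: N_def P_def)
        also have "\<dots> \<le> (C2 + 3) * P" using P by (intro mult_right_mono) auto
        finally show ?thesis .
      next
        case False
        then have "\<bar>p n x - bm_surv N x\<bar> \<le> 3 * P" using far_estimate[OF n, of x] by (simp add: N_def P_def)
        also have "\<dots> \<le> (C2 + 3) * P" using P C2(1) by (intro mult_right_mono) auto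
        finally show ?thesis .
      qed
      have B: "einf x * bm_ratio N x \<le> C3 * P" using C3(2)[OF n xl] by (simp add: N_def P_def)
      have B0: "0 \<le> einf x * bm_ratio N x" using einf_nonneg[of x] bm_ratio_nonneg[of N x] N by simp
      have "renewal x * bm_ratio N x = bm_surv N x + einf x * bm_ratio N x" using N by (simp add: renewal_def bm_surv_eq_l algebra_simps)
      then have "\<bar>p n x - renewal x * bm_ratio N x\<bar> \<le> (C2 + 3) * P + C3 * P" using A B B0 by linarith
      also have "\<dots> = (C2 + 3 + C3) * P * 1" by (simp add: algebra_simps)
      also have "\<dots> \<le> (C1 + C2 + 3 + C3) * P * ((renewal x * bm_ratio N x) / H_slope)"
        using q C1(1) C2(1) C3(1) P by (intro mult_mono mult_right_mono) auto
      finally show ?thesis by (simp add: C_def N_def P_def ac_simps)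
    qed
  qed
  moreover have "C > 0" unfolding C_def using C1(1) C2(1) C3(1) H_slope_pos by (simp add: add_pos_pos)
  ultimately show ?thesis by blast
qed

end

subsection \<open>Arbitrary starting points\<close>

text \<open>Read off from \<open>bm_ratio_diff\<close> at \<open>z = x = 0\<close>, where
  \<open>L\<close> contributes only the factor \<open>L 0 >= H_slope\<close>.\<close>

lemma inverse_sqrt_diff:
  assumes N: "N > 0" and t: "t \<ge> N / 2"
  shows "\<bar>1 / sqrt t - 1 / sqrt N\<bar> \<le> 4 / H_slope / sqrt N * (\<bar>t - N\<bar> / N)"
proof -
  have "H_slope * \<bar>1 / sqrt t - 1 / sqrt N\<bar> \<le> L 0 * \<bar>1 / sqrt t - 1 / sqrt N\<bar>"
    by (intro mult_right_mono L_lower) auto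
  also have "\<dots> = \<bar>bm_ratio t 0 - bm_ratio N 0\<bar>"
  proof -
    have "bm_ratio t 0 - bm_ratio N 0 = L 0 * (1 / sqrt t - 1 / sqrt N)" by (simp add: bm_ratio_def right_diff_distrib)
    then show ?thesis using L_nonneg[of 0] by (simp only: abs_mult abs_of_nonneg)
  qed
  also have "\<dots> \<le> 4 / sqrt N * (\<bar>t - N\<bar> / N)" using bm_ratio_diff[OF N t, of 0 0] N by simp
  finally show ?thesis using H_slope_pos N by (simp add: field_simps)
qed

text \<open>Unlike \<open>bm_ratio_diff\<close>, this does not pass through position 0. For a
  negative start the first jump \<open>y\<close> lands at \<open>z = x + y\<close>, and it is the
  jump that is small compared with \<open>sqrt N\<close>, not \<open>x\<close>.\<close>

lemma bm_ratio_diff_local: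
  assumes N: "N > 0" and t: "t \<ge> N / 2" and x: "\<bar>x\<bar> \<le> sqrt N"
  shows "\<bar>bm_ratio t z - bm_ratio N x\<bar> \<le> (4 + 12 / H_slope) / sqrt N * (min 1 (\<bar>z - x\<bar> / sqrt N) + \<bar>t - N\<bar> / N)"
proof -
  have t0: "t > 0" using assms by linarith
  define r where "r = \<bar>t - N\<bar> / N"
  have r: "r \<ge> 0" using N by (simp add: r_def)
  define m where "m = min 1 (\<bar>z - x\<bar> / sqrt N)"
  have m: "m \<ge> 0" using N by (simp add: m_def)
  have d: "\<bar>1 / sqrt t - 1 / sqrt N\<bar> \<le> 4 / H_slope / sqrt N * r" unfolding r_def by (rule inverse_sqrt_diff[OF N t])
  have "sqrt N \<le> sqrt (4 * t)" using t t0 by (intro real_sqrt_le_mono) simp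
  then have "sqrt N \<le> 2 * sqrt t" by (simp add: real_sqrt_mult)
  then have it: "1 / sqrt t \<le> 2 / sqrt N" using N t0 by (simp add: field_simps)
  have "\<bar>L (z / sqrt t) - L (x / sqrt N)\<bar> \<le> \<bar>z / sqrt t - x / sqrt N\<bar>" by (rule L_Lipschitz)
  also have "z / sqrt t - x / sqrt N = (z - x) * (1 / sqrt t) + x * (1 / sqrt t - 1 / sqrt N)"
    by (simp add: algebra_simps diff_divide_distrib)
  also have "\<bar>\<dots>\<bar> \<le> \<bar>z - x\<bar> * (1 / sqrt t) + \<bar>x\<bar> * \<bar>1 / sqrt t - 1 / sqrt N\<bar>"
    using t0 by (intro order_trans[OF abs_triangle_ineq]) (simp add: abs_mult)
  also have "\<dots> \<le> \<bar>z - x\<bar> * (2 / sqrt N) + sqrt N * (4 / H_slope / sqrt N * r)"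
    using x d it N t0 by (intro add_mono mult_mono) auto
  also have "\<dots> = 2 * (\<bar>z - x\<bar> / sqrt N) + 4 / H_slope * r" using N by simp
  finally have 1: "\<bar>L (z / sqrt t) - L (x / sqrt N)\<bar> \<le> 2 * (\<bar>z - x\<bar> / sqrt N) + 4 / H_slope * r" .
  have 2: "\<bar>L (z / sqrt t) - L (x / sqrt N)\<bar> \<le> 1"
    using L_nonneg[of "z / sqrt t"] L_nonneg[of "x / sqrt N"] L_le_1[of "z / sqrt t"] L_le_1[of "x / sqrt N"] by linarith
  have "0 \<le> 4 / H_slope * r" using r H_slope_pos by simp
  then have 3: "\<bar>L (z / sqrt t) - L (x / sqrt N)\<bar> \<le> 2 * m + 4 / H_slope * r"
    using 1 2 unfolding m_def by (cases "1 \<le> \<bar>z - x\<bar> / sqrt N") auto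
  have "bm_ratio t z - bm_ratio N x = (L (z / sqrt t) - L (x / sqrt N)) * (1 / sqrt t) + L (x / sqrt N) * (1 / sqrt t - 1 / sqrt N)"
    by (simp add: bm_ratio_def algebra_simps diff_divide_distrib)
  also have "\<bar>\<dots>\<bar> \<le> \<bar>L (z / sqrt t) - L (x / sqrt N)\<bar> * (1 / sqrt t) + L (x / sqrt N) * \<bar>1 / sqrt t - 1 / sqrt N\<bar>"
    using t0 L_nonneg[of "x / sqrt N"] by (intro order_trans[OF abs_triangle_ineq]) (simp add: abs_mult)
  also have "\<dots> \<le> (2 * m + 4 / H_slope * r) * (2 / sqrt N) + 1 * (4 / H_slope / sqrt N * r)"
    using 3 it d N t0 m r H_slope_pos L_nonneg L_le_1 by (intro add_mono mult_mono) auto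
  also have "\<dots> = 4 / sqrt N * m + 12 / H_slope / sqrt N * r"
  proof -
    define D where "D = r / (H_slope * sqrt N)"
    have "(2 * m + 4 / H_slope * r) * (2 / sqrt N) = 4 / sqrt N * m + 8 * D" "1 * (4 / H_slope / sqrt N * r) = 4 * D"
      "12 / H_slope / sqrt N * r = 12 * D" by (simp_all add: D_def distrib_right add_divide_distrib)
    then show ?thesis by (simp only:)
  qed
  also have "\<dots> \<le> (4 + 12 / H_slope) / sqrt N * m + (4 + 12 / H_slope) / sqrt N * r"
    using N m r H_slope_pos by (intro add_mono mult_right_mono divide_right_mono) auto
  finally show ?thesis by (simp only: m_def r_def distrib_left)
qed

context walk_law
begin

lemma Q_integrable: "lin_growth f \<Longrightarrow> integrable M (\<lambda>y. indicator {0..} (x + y) * f (x + y))"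
  using lin_integrable[OF lin_ind[of f "{0..}"], of x] by simp

text \<open>The half-line is reached in the first step only by a jump above \<open>sqrt n\<close>,
  and \<open>renewal\<close> at the landing point is at most linear in that jump. So
  \<open>kap\<close> controls the harmonic mean value.\<close>

lemma renewal_left_far: "\<exists>C>0. \<forall>n\<ge>1. \<forall>x. x < - sqrt (real n) \<longrightarrow> renewal x \<le> C * real n powr (- \<delta> / 4)"
proof -
  obtain C where C: "C > 0" "\<And>x. x \<ge> 0 \<Longrightarrow> renewal x \<le> C * (1 + x)" using renewal_upper by blast
  have "renewal x \<le> 2 * C * mdel * real n powr (- \<delta> / 4)" if n: "n \<ge> 1" and x: "x < - sqrt (real n)" for n x
  proof -
    define a where "a = real n powr (1/2 - eps)"
    have s: "1 \<le> sqrt (real n)" using n by simp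
    have "a \<le> real n powr (1/2)" unfolding a_def using n eps_pos by (intro powr_mono) auto
    then have a: "a \<le> sqrt (real n)" by (simp add: powr_half_sqrt)
    have "renewal x = (\<integral>y. indicator {0..} (x + y) * renewal (x + y) \<partial>M)"
      using renewal_fixed[of x] by (simp add: Q_def T_def)
    also have "\<dots> \<le> (\<integral>y. 2 * C * (indicator {a<..} \<bar>y\<bar> * \<bar>y\<bar>) \<partial>M)"
    proof (rule integral_mono)
      show "indicator {0..} (x + y) * renewal (x + y) \<le> 2 * C * (indicator {a<..} \<bar>y\<bar> * \<bar>y\<bar>)" for y
      proof (cases "x + y \<ge> 0")
        case True
        then have y: "y > sqrt (real n)" using x by linarith
        then have y': "1 + (x + y) \<le> 2 * y" "y > 0" "a < \<bar>y\<bar>" using x s a by linarith+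
        have "renewal (x + y) \<le> C * (1 + (x + y))" by (rule C(2)[OF True])
        also have "\<dots> \<le> C * (2 * y)" using C(1) y' by (intro mult_left_mono) auto
        finally show ?thesis using True y' by simp
      qed (use C(1) in auto)
    qed (use Q_integrable[OF lin_renewal] kap_int in auto)
    also have "\<dots> = 2 * C * kap a" by (simp add: kap_def)
    also have "\<dots> \<le> 2 * C * (mdel * real n powr (- \<delta> / 4))"
      using kap_near(2)[OF n] C(1) unfolding a_def by (intro mult_left_mono) auto
    finally show ?thesis by simp
  qed
  then have "\<forall>n\<ge>1. \<forall>x. x < - sqrt (real n) \<longrightarrow> renewal x \<le> (2 * C * mdel + 1) * real n powr (- \<delta> / 4)"
    by (auto simp: distrib_right intro: add_increasing2)
  moreover have "2 * C * mdel + 1 > 0" using C(1) mdel_nonneg by (intro add_nonneg_pos) auto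
  ultimately show ?thesis by blast
qed

text \<open>Condition on the first step: only landing points \<open>x + y >= 0\<close> count, and
  from there \<open>nonneg_estimate\<close> applies with \<open>n - 1 >= 1\<close> steps. Moderate
  jumps give errors relative to V, large ones the additive term.\<close>

lemma neg_estimate: "\<exists>C>0. \<forall>n\<ge>2. \<forall>x<0.
  \<bar>p n x - renewal x * bm_ratio (real n) x\<bar> \<le> C / sqrt (real n) *
     (real n powr (- \<delta> / 4) + renewal x * L (x / sqrt (real n)) * rate n)"
proof -
  obtain C1 where C1: "C1 > 0" "\<And>n x. x \<ge> 0 \<Longrightarrow> p n x \<le> C1 * renewal x / sqrt (real (Suc n))" using p_upper by blast
  obtain C2 where C2: "C2 > 0" "\<And>n x. n \<ge> 1 \<Longrightarrow> x < - sqrt (real n) \<Longrightarrow> renewal x \<le> C2 * real n powr (- \<delta> / 4)"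
    using renewal_left_far by blast
  obtain C3 where C3: "C3 > 0" "\<And>n x. n \<ge> 1 \<Longrightarrow> x \<ge> 0 \<Longrightarrow>
    \<bar>p n x - renewal x * bm_ratio (real n) x\<bar> \<le> C3 * (renewal x * bm_ratio (real n) x) * rate n" using nonneg_estimate by blast
  obtain C4 where C4: "C4 > 0" "\<And>x. x \<ge> 0 \<Longrightarrow> renewal x \<le> C4 * (1 + x)" using renewal_upper by blast
  define K where "K = 4 + 12 / H_slope"
  have K: "K > 0" using H_slope_pos by (simp add: K_def add_pos_pos)
  define C where "C = (C1 + 1) * C2 + 2 * C3 + 2 * (1 + C3) * K / H_slope + (1 + C3) * K * 2 * C4 * mdel"
  have cs: "(C1 + 1) * C2 > 0" "2 * C3 > 0" "2 * (1 + C3) * K / H_slope > 0" "(1 + C3) * K * 2 * C4 * mdel \<ge> 0"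
    using C1(1) C2(1) C3(1) C4(1) K H_slope_pos mdel_nonneg by auto
  have "\<bar>p n x - renewal x * bm_ratio (real n) x\<bar> \<le> C / sqrt (real n) *
     (real n powr (- \<delta> / 4) + renewal x * L (x / sqrt (real n)) * rate n)"
    if n: "n \<ge> 2" and x: "x < 0" for n x
  proof -
    define N where "N = real n"
    have N: "N \<ge> 2" using n by (simp add: N_def)
    obtain m where nm: "n = Suc m" and m1: "m \<ge> 1" using n by (cases n) auto
    have V0: "renewal x \<ge> 0" by (rule renewal_nonneg)
    define P where "P = N powr (- eps)"
    have P: "0 \<le> P" by (simp add: P_def)
    define R where "R = N powr (- \<delta> / 4)"
    have R: "0 \<le> R" by (simp add: R_def)
    define W where "W = renewal x * L (x / sqrt N)"
    have W: "W \<ge> 0" using V0 L_nonneg by (simp add: W_def)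
    have lW: "renewal x * bm_ratio N x = W / sqrt N" by (simp add: bm_ratio_def W_def)
    have pn: "p n x = (\<integral>y. indicator {0..} (x + y) * p m (x + y) \<partial>M)" by (simp add: nm Q_def T_def)
    have hx: "renewal x = (\<integral>y. indicator {0..} (x + y) * renewal (x + y) \<partial>M)"
      using renewal_fixed[of x] by (simp add: Q_def T_def)
    note ip = Q_integrable[OF lin_Qn[OF lin_const[of 1], of m], of x]
    note ih = Q_integrable[OF lin_renewal, of x]
    show ?thesis
    proof (cases "x < - sqrt N")
      case True
      \<comment> \<open>This far left no comparison is made: both quantities are of order
        \<open>V(x) / sqrt n\<close>, and V(x) itself is of order
        \<open>n^(-\<delta>/4)\<close>.\<close>
      have "p n x \<le> (\<integral>y. C1 / sqrt N * (indicator {0..} (x + y) * renewal (x + y)) \<partial>M)"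
        unfolding pn
      proof (rule integral_mono)
        show "indicator {0..} (x + y) * p m (x + y) \<le> C1 / sqrt N * (indicator {0..} (x + y) * renewal (x + y))" for y
          using C1(2)[of "x + y" m] by (auto simp: indicator_def N_def nm)
      qed (use ip ih in auto)
      also have "\<dots> = C1 / sqrt N * renewal x" using hx by simp
      finally have "p n x \<le> C1 / sqrt N * renewal x" .
      moreover have "renewal x * bm_ratio N x \<le> renewal x * (1 / sqrt N)" using V0 N by (intro mult_left_mono bm_ratio_le) auto
      moreover have "0 \<le> renewal x * bm_ratio N x" using V0 N bm_ratio_nonneg by simp
      ultimately have "\<bar>p n x - renewal x * bm_ratio N x\<bar> \<le> C1 / sqrt N * renewal x + renewal x * (1 / sqrt N)"
        using p_ge_0[of n x] by linarith
      also have "\<dots> = (C1 + 1) / sqrt N * renewal x" by (simp add: algebra_simps add_divide_distrib)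
      also have "\<dots> \<le> (C1 + 1) / sqrt N * (C2 * R)"
        using C2(2)[of n x] True n C1(1) N by (intro mult_left_mono) (auto simp: N_def R_def)
      also have "\<dots> = ((C1 + 1) * C2) / sqrt N * R" by simp
      also have "\<dots> \<le> C / sqrt N * (R + W * P)"
        using cs N R W P by (intro mult_mono divide_right_mono) (auto simp: C_def)
      finally show ?thesis by (simp only: N_def R_def W_def P_def)
    next
      case False
      then have xa: "\<bar>x\<bar> \<le> sqrt N" using x by simp
      then have "\<bar>x / sqrt N\<bar> \<le> 1" using N by simp
      then have "renewal x * H_slope \<le> W" unfolding W_def using V0 by (intro mult_left_mono L_lower)
      then have hW: "renewal x \<le> W / H_slope" using H_slope_pos by (simp add: field_simps)
      define a where "a = N powr (1/2 - eps)"
      have a1: "1 \<le> a" unfolding a_def using N eps_lt by (intro ge_one_powr_ge_zero) auto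
      have mN: "real m = N - 1" by (simp add: N_def nm)
      have mN2: "real m \<ge> N / 2" using N mN by simp
      have mP: "real m powr (- eps) \<le> 2 * P"
      proof -
        have "real m powr (- eps) \<le> (N / 2) powr (- eps)" using mN2 N eps_pos by (intro powr_mono2') auto
        also have "\<dots> = 2 powr eps * P" using N by (simp add: P_def powr_divide powr_minus_divide)
        also have "\<dots> \<le> 2 powr 1 * P" using eps_lt P by (intro mult_right_mono powr_mono) auto
        finally show ?thesis by simp
      qed
      \<comment> \<open>\<open>E\<close> collects the errors proportional to \<open>renewal\<close>
        at the landing point, \<open>F\<close> those of large jumps. Integration turns the first
        into \<open>renewal x\<close> by harmonicity, the second into \<open>kap a\<close>.\<close>
      define E where "E = 2 * C3 * P * bm_ratio N x + (1 + C3) * (K / sqrt N) * (2 * P)"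
      define F where "F = (1 + C3) * (K / sqrt N) * (2 * C4)"
      have lN: "bm_ratio N x \<ge> 0" using N by (intro bm_ratio_nonneg) simp
      have pt: "\<bar>indicator {0..} (x + y) * p m (x + y) - indicator {0..} (x + y) * renewal (x + y) * bm_ratio N x\<bar>
        \<le> E * (indicator {0..} (x + y) * renewal (x + y)) + F * (indicator {a<..} \<bar>y\<bar> * \<bar>y\<bar>)" for y
      proof (cases "x + y \<ge> 0")
        case True
        define h where "h = renewal (x + y)"
        define d where "d = \<bar>bm_ratio (real m) (x + y) - bm_ratio N x\<bar>"
        have h0: "h \<ge> 0" by (simp add: h_def renewal_nonneg)
        have lm: "bm_ratio (real m) (x + y) \<le> bm_ratio N x + d" "0 \<le> bm_ratio (real m) (x + y)" by (auto simp: d_def intro: bm_ratio_nonneg)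
        have dK: "d \<le> K / sqrt N * (2 * P + indicator {a<..} \<bar>y\<bar>)"
        proof -
          have "d \<le> K / sqrt N * (min 1 (\<bar>x + y - x\<bar> / sqrt N) + \<bar>real m - N\<bar> / N)"
            unfolding d_def K_def using N mN2 xa by (intro bm_ratio_diff_local) auto
          also have "\<dots> \<le> K / sqrt N * ((P + indicator {a<..} \<bar>y\<bar>) + P)"
          proof (intro mult_left_mono add_mono)
            show "min 1 (\<bar>x + y - x\<bar> / sqrt N) \<le> P + indicator {a<..} \<bar>y\<bar>"
            proof (cases "\<bar>y\<bar> > a")
              case False
              then have "\<bar>y\<bar> / sqrt N \<le> a / sqrt N" using N by (intro divide_right_mono) auto
              also have "\<dots> = P" using powr_add[of N "1/2" "- eps"] N by (simp add: a_def P_def powr_half_sqrt)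
              finally show ?thesis using False by simp
            qed (use P in auto)
            have "\<bar>real m - N\<bar> / N = N powr (- 1)" using N by (simp add: mN powr_minus_divide)
            also have "\<dots> \<le> P" unfolding P_def using N eps_lt by (intro powr_mono) auto
            finally show "\<bar>real m - N\<bar> / N \<le> P" .
          qed (use K N in auto)
          finally show ?thesis by (simp add: algebra_simps)
        qed
        have hy: "h * indicator {a<..} \<bar>y\<bar> \<le> 2 * C4 * (indicator {a<..} \<bar>y\<bar> * \<bar>y\<bar>)"
        proof (cases "\<bar>y\<bar> > a")
          case big: True
          have "h \<le> C4 * (1 + (x + y))" unfolding h_def by (rule C4(2)[OF True])
          also have "\<dots> \<le> C4 * (2 * \<bar>y\<bar>)" using C4(1) x a1 big by (intro mult_left_mono) auto
          finally show ?thesis using big by simp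
        qed simp
        have "\<bar>p m (x + y) - h * bm_ratio (real m) (x + y)\<bar> \<le> C3 * (h * bm_ratio (real m) (x + y)) * real m powr (- eps)"
          unfolding h_def by (rule C3(2)[OF m1 True])
        also have "\<dots> \<le> C3 * (h * (bm_ratio N x + d)) * real m powr (- eps)"
          using C3(1) h0 lm by (intro mult_right_mono mult_left_mono) auto
        also have "\<dots> = C3 * (h * bm_ratio N x) * real m powr (- eps) + C3 * (h * d) * real m powr (- eps)"
          by (simp add: algebra_simps)
        also have "\<dots> \<le> C3 * (h * bm_ratio N x) * (2 * P) + C3 * (h * d) * 1"
        proof (intro add_mono mult_left_mono mP)
          have "real m powr (- eps) \<le> real m powr 0" using m1 eps_pos by (intro powr_mono) auto
          then show "real m powr (- eps) \<le> 1" using m1 by simp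
        qed (use C3(1) h0 lN in \<open>auto simp: d_def\<close>)
        finally have 1: "\<bar>p m (x + y) - h * bm_ratio (real m) (x + y)\<bar> \<le> 2 * C3 * P * bm_ratio N x * h + C3 * (h * d)" by (simp add: ac_simps)
        have 2: "\<bar>h * bm_ratio (real m) (x + y) - h * bm_ratio N x\<bar> = h * d"
          using h0 by (simp add: d_def abs_mult flip: right_diff_distrib)
        have "\<bar>p m (x + y) - h * bm_ratio N x\<bar> \<le> 2 * C3 * P * bm_ratio N x * h + (1 + C3) * (h * d)"
          using 1 2 by (simp only: distrib_right)
        also have "(1 + C3) * (h * d) \<le> (1 + C3) * (h * (K / sqrt N * (2 * P + indicator {a<..} \<bar>y\<bar>)))"
          using C3(1) h0 dK by (intro mult_left_mono) auto
        also have "\<dots> = (1 + C3) * (K / sqrt N) * (2 * P) * h + (1 + C3) * (K / sqrt N) * (h * indicator {a<..} \<bar>y\<bar>)"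
          by (simp add: algebra_simps)
        also have "(1 + C3) * (K / sqrt N) * (h * indicator {a<..} \<bar>y\<bar>) \<le> (1 + C3) * (K / sqrt N) * (2 * C4 * (indicator {a<..} \<bar>y\<bar> * \<bar>y\<bar>))"
          using C3(1) K N hy by (intro mult_left_mono) auto
        finally have "\<bar>p m (x + y) - h * bm_ratio N x\<bar> \<le> E * h + F * (indicator {a<..} \<bar>y\<bar> * \<bar>y\<bar>)"
          by (simp add: E_def F_def algebra_simps)
        then show ?thesis using True by (simp add: h_def)
      next
        case out: False
        have "0 \<le> F" unfolding F_def using C3(1) C4(1) K N by simp
        then show ?thesis using out by simp
      qed
      have "p n x - renewal x * bm_ratio N x = (\<integral>y. indicator {0..} (x + y) * p m (x + y) - indicator {0..} (x + y) * renewal (x + y) * bm_ratio N x \<partial>M)"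
        unfolding pn by (subst (1) hx) (use ip ih in simp)
      moreover have "\<bar>\<integral>y. indicator {0..} (x + y) * p m (x + y) - indicator {0..} (x + y) * renewal (x + y) * bm_ratio N x \<partial>M\<bar>
         \<le> (\<integral>y. E * (indicator {0..} (x + y) * renewal (x + y)) + F * (indicator {a<..} \<bar>y\<bar> * \<bar>y\<bar>) \<partial>M)"
        using ip ih kap_int by (intro order_trans[OF integral_abs_bound] integral_mono pt) auto
      moreover have "(\<integral>y. E * (indicator {0..} (x + y) * renewal (x + y)) + F * (indicator {a<..} \<bar>y\<bar> * \<bar>y\<bar>) \<partial>M) = E * renewal x + F * kap a"
        using ih kap_int by (simp add: hx[symmetric] kap_def)
      ultimately have "\<bar>p n x - renewal x * bm_ratio N x\<bar> \<le> E * renewal x + F * kap a" by simp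
      also have "F * kap a \<le> F * (mdel * R)"
        using kap_near(2)[of n] n C3(1) C4(1) K N unfolding F_def a_def N_def R_def by (intro mult_left_mono) auto
      also have "E * renewal x = 2 * C3 * P * (W / sqrt N) + (1 + C3) * (K / sqrt N) * (2 * P) * renewal x"
        unfolding lW[symmetric] E_def by (simp add: algebra_simps)
      also have "(1 + C3) * (K / sqrt N) * (2 * P) * renewal x \<le> (1 + C3) * (K / sqrt N) * (2 * P) * (W / H_slope)"
        using C3(1) K N P hW by (intro mult_left_mono) auto
      finally have "\<bar>p n x - renewal x * bm_ratio N x\<bar> \<le> 2 * C3 * P * (W / sqrt N) + (1 + C3) * (K / sqrt N) * (2 * P) * (W / H_slope) + F * (mdel * R)" by simp
      also have "\<dots> = ((2 * C3 + 2 * (1 + C3) * K / H_slope) * (W * P) + (1 + C3) * K * 2 * C4 * mdel * R) / sqrt N"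
        by (simp add: F_def algebra_simps add_divide_distrib)
      also have "\<dots> \<le> (C * (W * P) + C * R) / sqrt N"
        using cs N W P R by (intro divide_right_mono add_mono mult_right_mono) (auto simp: C_def)
      also have "\<dots> = C / sqrt N * (R + W * P)" by (simp add: algebra_simps add_divide_distrib)
      finally show ?thesis by (simp only: N_def R_def W_def P_def)
    qed
  qed
  moreover have "C > 0" using cs unfolding C_def by linarith
  ultimately show ?thesis by blast
qed

text \<open>Serves \<open>n = 1\<close>, where the logarithm vanishes and the additive term, equal
  to 1, has to absorb the whole error.\<close>

lemma renewal_l_bounded: "\<exists>C>0. \<forall>x. renewal x * bm_ratio 1 x \<le> C"
proof -
  obtain C where C: "C > 0" "\<And>x. x \<ge> 0 \<Longrightarrow> renewal x \<le> C * (1 + x)" using renewal_upper by blast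
  let ?f = "\<lambda>z. C * (1 + max z 0)"
  have lf: "lin_growth ?f" by (intro lin_cmult lin_add lin_const lin_max_id)
  have f0: "?f z \<ge> 0" for z using C(1) by simp
  define B where "B = T ?f 0"
  have "renewal x * bm_ratio 1 x \<le> 2 * C + B + 1" for x
  proof (cases "x \<ge> 0")
    case True
    have "(1 + x) * bm_ratio 1 x = bm_ratio 1 x + bm_surv 1 x" by (simp add: bm_surv_eq_l algebra_simps)
    also have "\<dots> \<le> 1 + 1" using bm_ratio_le[of 1 x] H_bounds(1)[of "x / sqrt 1"] by (intro add_mono) (auto simp: bm_surv_def)
    finally have q: "(1 + x) * bm_ratio 1 x \<le> 2" by simp
    have "renewal x * bm_ratio 1 x \<le> C * (1 + x) * bm_ratio 1 x" using C(2)[OF True] bm_ratio_nonneg[of 1 x] by (intro mult_right_mono) auto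
    also have "\<dots> = C * ((1 + x) * bm_ratio 1 x)" by simp
    also have "\<dots> \<le> C * 2" using q C(1) by (intro mult_left_mono) auto
    finally have "renewal x * bm_ratio 1 x \<le> 2 * C" by simp
    moreover have "B \<ge> 0" unfolding B_def T_def using f0 by (intro Bochner_Integration.integral_nonneg) auto
    ultimately show ?thesis by linarith
  next
    case False
    have "renewal x = Q renewal x" by (simp add: renewal_fixed)
    also have "\<dots> \<le> Q ?f x" using C(2) lf by (intro Q_mono) (auto simp: max_def)
    also have "\<dots> \<le> T ?f x" using lf f0 by (intro Q_le_T)
    also have "\<dots> \<le> B" unfolding B_def using C(1) False by (intro monoD[OF mono_T[OF lf]] monoI mult_left_mono) auto
    finally have "renewal x * bm_ratio 1 x \<le> B * 1" using bm_ratio_le[of 1 x] bm_ratio_nonneg[of 1 x] renewal_nonneg[of x] by (intro mult_mono) auto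
    then show ?thesis using C(1) by simp
  qed
  moreover have "B \<ge> 0" unfolding B_def T_def using f0 by (intro Bochner_Integration.integral_nonneg) auto
  then have "2 * C + B + 1 > 0" using C(1) by linarith
  ultimately show ?thesis by blast
qed

theorem survival_estimate: "\<exists>C>0. \<forall>n\<ge>1. \<forall>x.
  \<bar>p n x - renewal x * L (x / sqrt (real n)) / sqrt (real n)\<bar> \<le> C / sqrt (real n) *
     (1 / real n powr (\<delta> / 4) + renewal x * L (x / sqrt (real n)) / real n powr eps * ln (real n))"
proof -
  obtain C1 where C1: "C1 > 0" "\<And>n x. n \<ge> 1 \<Longrightarrow> x \<ge> 0 \<Longrightarrow>
    \<bar>p n x - renewal x * bm_ratio (real n) x\<bar> \<le> C1 * (renewal x * bm_ratio (real n) x) * rate n" using nonneg_estimate by blast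
  obtain C2 where C2: "C2 > 0" "\<And>n x. n \<ge> 2 \<Longrightarrow> x < 0 \<Longrightarrow>
    \<bar>p n x - renewal x * bm_ratio (real n) x\<bar> \<le> C2 / sqrt (real n) *
     (real n powr (- \<delta> / 4) + renewal x * L (x / sqrt (real n)) * rate n)" using neg_estimate by blast
  obtain C3 where C3: "C3 > 0" "\<And>x. renewal x * bm_ratio 1 x \<le> C3" using renewal_l_bounded by blast
  define C where "C = 2 * (C1 + C2) + 1 + C3"
  have "\<bar>p n x - renewal x * L (x / sqrt (real n)) / sqrt (real n)\<bar> \<le> C / sqrt (real n) *
     (1 / real n powr (\<delta> / 4) + renewal x * L (x / sqrt (real n)) / real n powr eps * ln (real n))" if n: "n \<ge> 1" for n x
  proof (cases "n = 1")
    case True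
    have "\<bar>p 1 x - renewal x * bm_ratio 1 x\<bar> \<le> 1 + C3"
      using p_ge_0[of 1 x] p_le_1[of 1 x] C3(2)[of x] renewal_nonneg[of x] bm_ratio_nonneg[of 1 x] mult_nonneg_nonneg[of "renewal x" "bm_ratio 1 x"] by linarith
    also have "\<dots> \<le> C" using C1(1) C2(1) by (simp add: C_def)
    finally show ?thesis using True by (simp add: bm_ratio_def)
  next
    case False
    then have n2: "n \<ge> 2" using n by simp
    define N where "N = real n"
    have N: "N \<ge> 2" using n2 by (simp add: N_def)
    define W where "W = renewal x * L (x / sqrt N)"
    have W: "W \<ge> 0" using renewal_nonneg L_nonneg by (simp add: W_def)
    define P where "P = N powr (- eps)"
    have P: "P \<ge> 0" by (simp add: P_def)
    define R where "R = N powr (- \<delta> / 4)"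
    have R: "R \<ge> 0" by (simp add: R_def)
    have lW: "renewal x * bm_ratio N x = W / sqrt N" by (simp add: bm_ratio_def W_def)
    have A: "\<bar>p n x - W / sqrt N\<bar> \<le> (C1 + C2) / sqrt N * (R + W * P)"
    proof (cases "x \<ge> 0")
      case True
      have "\<bar>p n x - W / sqrt N\<bar> \<le> C1 * (W / sqrt N) * P" using C1(2)[OF n True] by (simp only: lW N_def[symmetric] P_def)
      also have "\<dots> = C1 / sqrt N * (W * P)" by simp
      also have "\<dots> \<le> (C1 + C2) / sqrt N * (R + W * P)"
        using N C1(1) C2(1) W P R by (intro mult_mono divide_right_mono) auto
      finally show ?thesis .
    next
      case False
      then have "\<bar>p n x - W / sqrt N\<bar> \<le> C2 / sqrt N * (R + W * P)"
        unfolding lW[symmetric] using C2(2)[OF n2, of x] unfolding R_def W_def P_def N_def by simp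
      also have "\<dots> \<le> (C1 + C2) / sqrt N * (R + W * P)"
        using N C1(1) C2(1) W P R by (intro mult_right_mono divide_right_mono) auto
      finally show ?thesis .
    qed
    \<comment> \<open>The estimates so far carry no logarithm; inserting it costs a factor 2 for
      \<open>N >= 2\<close>.\<close>
    have "1 / 2 \<le> ln (2::real)" using ln_le_minus_one[of "1/2::real"] by (simp add: ln_div)
    also have "\<dots> \<le> ln N" using N by simp
    finally have ln: "1 \<le> 2 * ln N" by simp
    have "R + W * P \<le> 2 * (R + W * P * ln N)"
    proof -
      have "W * P * 1 \<le> W * P * (2 * ln N)" using ln W P by (intro mult_left_mono) auto
      then show ?thesis using R by simp
    qed
    then have "(C1 + C2) / sqrt N * (R + W * P) \<le> (C1 + C2) / sqrt N * (2 * (R + W * P * ln N))"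
      using C1(1) C2(1) N by (intro mult_left_mono) auto
    also have "\<dots> = 2 * (C1 + C2) / sqrt N * (R + W * P * ln N)" by (simp add: algebra_simps add_divide_distrib)
    also have "\<dots> \<le> C / sqrt N * (R + W * P * ln N)"
      using C3(1) N R W P by (intro mult_right_mono divide_right_mono) (auto simp: C_def)
    finally have "\<bar>p n x - W / sqrt N\<bar> \<le> C / sqrt N * (R + W * P * ln N)" using A by linarith
    moreover have "R = 1 / N powr (\<delta> / 4)" by (simp add: R_def powr_minus_divide)
    moreover have "P = 1 / N powr eps" by (simp add: P_def powr_minus_divide)
    ultimately show ?thesis by (simp add: W_def N_def)
  qed
  moreover have "C > 0" using C1(1) C2(1) C3(1) by (simp add: C_def)
  ultimately show ?thesis by blast
qed

end

subsection \<open>Transfer to the walk\<close>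

text \<open>Time 0 is not tested, so a negative start survives \<open>n = 0\<close>. This agrees
  with \<open>Q\<close>, which tests the position after each step only.\<close>

lemma enat_less_exit_time_iff:
  "enat n < exit_time Y x \<omega> \<longleftrightarrow> (\<forall>k\<in>{1..n}. 0 \<le> x + walk Y k \<omega>)"
proof -
  have "enat n < exit_time Y x \<omega> \<longleftrightarrow> enat (Suc n) \<le> exit_time Y x \<omega>" by (simp add: Suc_ile_eq)
  also have "\<dots> \<longleftrightarrow> (\<forall>k. 1 \<le> k \<and> x + walk Y k \<omega> < 0 \<longrightarrow> Suc n \<le> k)"
    by (auto simp: exit_time_def le_Inf_iff)
  also have "\<dots> \<longleftrightarrow> (\<forall>k\<in>{1..n}. 0 \<le> x + walk Y k \<omega>)"
    by (auto simp: not_less_eq_eq not_less[symmetric])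
  finally show ?thesis .
qed

lemma walk_Suc: "walk Y (Suc n) \<omega> = walk Y n \<omega> + Y (Suc n) \<omega>"
  by (simp add: walk_def)

locale iid_walk = prob_space M for M :: "'a measure" +
  fixes Y :: "nat \<Rightarrow> 'a \<Rightarrow> real" and \<mu> :: "real measure" and \<delta> :: real
  assumes indep: "indep_vars (\<lambda>_. borel) Y {1..}"
    and ident: "\<And>i. i \<ge> 1 \<Longrightarrow> distr M borel (Y i) = \<mu>"
    and law: "walk_law \<mu> \<delta>"
begin

sublocale W: walk_law \<mu> \<delta> by (rule law)

lemma Y_measurable [measurable]: "i \<ge> 1 \<Longrightarrow> random_variable borel (Y i)"
  using indep by (auto simp: indep_vars_def)

lemma walk_measurable [measurable]: "walk Y n \<in> borel_measurable M"
  unfolding walk_def[abs_def] by (intro borel_measurable_sum) auto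

lemma Y_integrable: assumes "i \<ge> 1" shows "integrable M (Y i)"
proof -
  have "integrable (distr M borel (Y i)) (\<lambda>x. x)" using W.int1 ident[OF assms] by simp
  then show ?thesis using assms by (subst (asm) integrable_distr_eq) auto
qed

lemma walk_integrable: "integrable M (walk Y n)"
  unfolding walk_def[abs_def] by (intro Bochner_Integration.integrable_sum Y_integrable) auto

definition alive :: "real \<Rightarrow> nat \<Rightarrow> 'a set" where
  "alive x n = {\<omega> \<in> space M. enat n < exit_time Y x \<omega>}"

lemma alive_eq: "alive x n = {\<omega> \<in> space M. \<forall>k\<in>{1..n}. 0 \<le> x + walk Y k \<omega>}"
  by (simp add: alive_def enat_less_exit_time_iff)

lemma alive_sets [measurable]: "alive x n \<in> events"
  unfolding alive_eq by measurable

lemma alive_0: "alive x 0 = space M" by (simp add: alive_eq)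

lemma indicator_alive_Suc:
  "\<omega> \<in> space M \<Longrightarrow> indicator (alive x (Suc n)) \<omega> = (indicator (alive x n) \<omega> * indicator {0..} (x + walk Y (Suc n) \<omega>) :: real)"
  by (auto simp: alive_eq indicator_def le_Suc_eq)

lemma lin_walk_integrable:
  assumes "lin_growth f" shows "integrable M (\<lambda>\<omega>. indicator (alive x n) \<omega> * f (x + walk Y m \<omega>))"
proof -
  obtain C where C: "C \<ge> 0" "\<And>z. \<bar>f z\<bar> \<le> C * (1 + \<bar>z\<bar>)" using lin_growthE assms by metis
  have [measurable]: "f \<in> borel_measurable borel" using assms by (rule lin_meas)
  show ?thesis
  proof (rule Bochner_Integration.integrable_bound)
    show "integrable M (\<lambda>\<omega>. C * (1 + \<bar>x + walk Y m \<omega>\<bar>))" using walk_integrable[of m] by auto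
    show "(\<lambda>\<omega>. indicator (alive x n) \<omega> * f (x + walk Y m \<omega>)) \<in> borel_measurable M" by measurable
    show "AE \<omega> in M. norm (indicator (alive x n) \<omega> * f (x + walk Y m \<omega>)) \<le> norm (C * (1 + \<bar>x + walk Y m \<omega>\<bar>))"
      using C by (auto intro!: AE_I2 simp: indicator_def abs_mult)
  qed
qed

text \<open>Markov property for one step: the event and the position at time \<open>n\<close> depend
  on the first \<open>n\<close> steps, and Fubini integrates out the next one. The sign of the new
  position is left untested, so that both survival and overshoot can be inserted as
  \<open>F\<close>.\<close>

lemma integral_step:
  assumes F: "lin_growth F"
  shows "(\<integral>\<omega>. indicator (alive x n) \<omega> * F (x + walk Y (Suc n) \<omega>) \<partial>M)
    = (\<integral>\<omega>. indicator (alive x n) \<omega> * W.T F (x + walk Y n \<omega>) \<partial>M)"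
proof -
  let ?S = "PiM {1..n} (\<lambda>_. borel) :: (nat \<Rightarrow> real) measure"
  define Z where "Z \<omega> = restrict (\<lambda>i. Y i \<omega>) {1..n}" for \<omega>
  define D where "D = distr M ?S Z"
  let ?S2 = "PiM {Suc n} (\<lambda>_. borel) :: (nat \<Rightarrow> real) measure"
  \<comment> \<open>The last step is kept as a function on a singleton index set because
    \<open>indep_var_restrict\<close> gives independence of restrictions to disjoint index
    sets.\<close>
  define Z2 where "Z2 \<omega> = restrict (\<lambda>i. Y i \<omega>) {Suc n}" for \<omega>
  define D2 where "D2 = distr M ?S2 Z2"
  define A where "A = {z :: nat \<Rightarrow> real. \<forall>k\<in>{1..n}. 0 \<le> x + (\<Sum>i=1..k. z i)}"
  define s where "s z = x + (\<Sum>i=1..n. z i)" for z :: "nat \<Rightarrow> real"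
  have [measurable]: "F \<in> borel_measurable borel" using F by (rule lin_meas)
  have Zm [measurable]: "Z \<in> measurable M ?S" unfolding Z_def by (intro measurable_restrict) auto
  have sm [measurable]: "s \<in> borel_measurable ?S" unfolding s_def by (intro borel_measurable_add borel_measurable_sum) auto
  have Am: "A \<inter> space ?S \<in> sets ?S"
  proof -
    have "A \<inter> space ?S = {z \<in> space ?S. \<forall>k\<in>{1..n}. 0 \<le> x + (\<Sum>i=1..k. z i)}" by (auto simp: A_def)
    also have "\<dots> \<in> sets ?S"
    proof (intro sets.sets_Collect_finite_All)
      fix k assume k: "k \<in> {1..n}"
      have "(\<lambda>z. x + (\<Sum>i=1..k. z i)) \<in> borel_measurable ?S"
        using k by (intro borel_measurable_add borel_measurable_sum) auto
      then show "{z \<in> space ?S. 0 \<le> x + (\<Sum>i=1..k. z i)} \<in> sets ?S" by measurable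
    qed auto
    finally show ?thesis .
  qed
  have Ai [measurable]: "(\<lambda>z. indicator A z :: real) \<in> borel_measurable ?S"
    using Am by (subst borel_measurable_indicator_iff) (auto simp: Int_commute)
  have AZ: "indicator (alive x n) \<omega> = (indicator A (Z \<omega>) :: real)" "s (Z \<omega>) = x + walk Y n \<omega>" if "\<omega> \<in> space M" for \<omega>
  proof -
    have "(\<Sum>i=1..k. Z \<omega> i) = walk Y k \<omega>" if "k \<le> n" for k
      unfolding walk_def Z_def using that by (intro sum.cong) auto
    then show "indicator (alive x n) \<omega> = (indicator A (Z \<omega>) :: real)" "s (Z \<omega>) = x + walk Y n \<omega>"
      using that by (auto simp: alive_eq A_def s_def indicator_def)
  qed
  have Z2m [measurable]: "Z2 \<in> measurable M ?S2" unfolding Z2_def by (intro measurable_restrict) auto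
  have iv: "indep_var ?S Z ?S2 Z2"
    unfolding Z_def Z2_def by (rule indep_var_restrict[OF indep]) auto
  have joint: "D \<Otimes>\<^sub>M D2 = distr M (?S \<Otimes>\<^sub>M ?S2) (\<lambda>\<omega>. (Z \<omega>, Z2 \<omega>))"
    unfolding D_def D2_def by (rule iv[unfolded indep_var_distribution_eq, THEN conjunct2, THEN conjunct2])
  have [measurable_cong]: "sets D = sets ?S" "sets D2 = sets ?S2" by (simp_all add: D_def D2_def)
  have em: "(\<lambda>w. w (Suc n)) \<in> measurable ?S2 borel" by (rule measurable_component_singleton) simp
  have D2: "distr D2 borel (\<lambda>w. w (Suc n)) = \<mu>"
    unfolding D2_def ident[of "Suc n", simplified, symmetric]
    by (subst distr_distr[OF em Z2m]) (simp add: comp_def Z2_def)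
  interpret D: prob_space D unfolding D_def by (rule prob_space_distr) (rule Zm)
  interpret D2: prob_space D2 unfolding D2_def by (rule prob_space_distr) (rule Z2m)
  interpret P: pair_prob_space D D2 ..
  define h where "h = (\<lambda>(z, w). indicator A z * F (s z + w (Suc n)))"
  have hm: "h \<in> borel_measurable (?S \<Otimes>\<^sub>M ?S2)" unfolding h_def using em by measurable
  have hZ: "h (Z \<omega>, Z2 \<omega>) = indicator (alive x n) \<omega> * F (x + walk Y (Suc n) \<omega>)" if "\<omega> \<in> space M" for \<omega>
    using AZ[OF that] by (simp add: h_def walk_Suc add.assoc Z2_def)
  have pm: "(\<lambda>\<omega>. (Z \<omega>, Z2 \<omega>)) \<in> measurable M (?S \<Otimes>\<^sub>M ?S2)" by measurable
  have hi: "integrable (D \<Otimes>\<^sub>M D2) h"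
    unfolding joint
  proof (subst integrable_distr_eq[OF pm hm])
    show "integrable M (\<lambda>\<omega>. h (Z \<omega>, Z2 \<omega>))"
      using lin_walk_integrable[OF F, of x n "Suc n"] by (subst Bochner_Integration.integrable_cong[OF refl hZ]) auto
  qed
  have inner: "(\<integral>w. h (z, w) \<partial>D2) = indicator A z * W.T F (s z)" for z
  proof -
    have "(\<lambda>w. w (Suc n)) \<in> measurable D2 borel" unfolding D2_def measurable_distr_eq1 by (rule em)
    then have "(\<integral>y. F (s z + y) \<partial>distr D2 borel (\<lambda>w. w (Suc n))) = (\<integral>w. F (s z + w (Suc n)) \<partial>D2)"
      by (rule integral_distr) measurable
    then have "W.T F (s z) = (\<integral>w. F (s z + w (Suc n)) \<partial>D2)" unfolding D2 W.T_def .
    then show ?thesis by (simp add: h_def)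
  qed
  have "(\<integral>\<omega>. indicator (alive x n) \<omega> * F (x + walk Y (Suc n) \<omega>) \<partial>M) = (\<integral>\<omega>. h (Z \<omega>, Z2 \<omega>) \<partial>M)"
    by (intro Bochner_Integration.integral_cong refl hZ[symmetric])
  also have "\<dots> = (\<integral>w. h w \<partial>(D \<Otimes>\<^sub>M D2))" unfolding joint by (rule integral_distr[OF pm hm, symmetric])
  also have "\<dots> = (\<integral>z. (\<integral>w. h (z, w) \<partial>D2) \<partial>D)" by (rule P.integral_fst'[OF hi, symmetric])
  also have "\<dots> = (\<integral>z. indicator A z * W.T F (s z) \<partial>D)" unfolding inner ..
  also have "\<dots> = (\<integral>\<omega>. indicator A (Z \<omega>) * W.T F (s (Z \<omega>)) \<partial>M)"
  proof -
    have [measurable]: "W.T F \<in> borel_measurable borel" using W.lin_T[OF F] by (rule lin_meas)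
    show ?thesis unfolding D_def by (rule integral_distr) measurable
  qed
  also have "\<dots> = (\<integral>\<omega>. indicator (alive x n) \<omega> * W.T F (x + walk Y n \<omega>) \<partial>M)"
    using AZ by (intro Bochner_Integration.integral_cong) auto
  finally show ?thesis .
qed

lemma integral_alive: "lin_growth f \<Longrightarrow> (\<integral>\<omega>. indicator (alive x n) \<omega> * f (x + walk Y n \<omega>) \<partial>M) = (W.Q ^^ n) f x"
proof (induction n arbitrary: f)
  case 0
  have "(\<integral>\<omega>. indicator (alive x 0) \<omega> * f (x + walk Y 0 \<omega>) \<partial>M) = (\<integral>\<omega>. f x \<partial>M)"
    by (intro Bochner_Integration.integral_cong) (auto simp: alive_0 walk_def)
  then show ?case by (simp add: prob_space)
next
  case (Suc n)
  define F where "F z = indicator {0..} z * f z" for z :: real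
  have F: "lin_growth F" unfolding F_def[abs_def] using Suc.prems by (intro lin_ind) auto
  have "(\<integral>\<omega>. indicator (alive x (Suc n)) \<omega> * f (x + walk Y (Suc n) \<omega>) \<partial>M)
      = (\<integral>\<omega>. indicator (alive x n) \<omega> * F (x + walk Y (Suc n) \<omega>) \<partial>M)"
    by (intro Bochner_Integration.integral_cong) (simp_all add: indicator_alive_Suc F_def mult.assoc)
  also have "\<dots> = (\<integral>\<omega>. indicator (alive x n) \<omega> * W.T F (x + walk Y n \<omega>) \<partial>M)" by (rule integral_step[OF F])
  also have "W.T F = W.Q f" by (simp add: W.Q_def F_def[abs_def])
  also have "(\<integral>\<omega>. indicator (alive x n) \<omega> * W.Q f (x + walk Y n \<omega>) \<partial>M) = (W.Q ^^ n) (W.Q f) x"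
    using Suc.prems by (intro Suc.IH) auto
  finally show ?case by (simp only: W.Qn_Suc)
qed

lemma prob_alive: "prob (alive x n) = W.p n x"
proof -
  have "prob (alive x n) = (\<integral>\<omega>. indicator (alive x n) \<omega> * 1 \<partial>M)" by simp
  also have "\<dots> = W.p n x" by (rule integral_alive) simp
  finally show ?thesis .
qed

section \<open>Almost sure exit and identification of V\<close>

lemma p_tendsto_0: "(\<lambda>n. W.p n x) \<longlonglongrightarrow> 0"
proof -
  obtain C where C: "C > 0" "\<And>n x. x \<ge> 0 \<Longrightarrow> W.p n x \<le> C * W.renewal x / sqrt (real (Suc n))" using W.p_upper by blast
  \<comment> \<open>\<open>p_upper\<close> is about nonnegative starts; by \<open>mono_p\<close> a
    negative start is no more likely to survive than 0.\<close>
  define B where "B = C * W.renewal (max x 0)"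
  have "W.p n x \<le> B / sqrt (real (Suc n))" for n
    using C(2)[of "max x 0" n] monoD[OF W.mono_p, of x "max x 0" n] by (simp add: B_def)
  then have b: "eventually (\<lambda>n. W.p n x \<le> B / sqrt (real (Suc n))) sequentially" by (intro always_eventually allI)
  have a: "eventually (\<lambda>n. 0 \<le> W.p n x) sequentially" by (intro always_eventually allI W.p_ge_0)
  have "filterlim (\<lambda>n. sqrt (real (Suc n))) at_top sequentially"
    by (rule filterlim_compose[OF sqrt_at_top]) (rule filterlim_compose[OF filterlim_real_sequentially filterlim_Suc])
  then have "(\<lambda>n. B / sqrt (real (Suc n))) \<longlonglongrightarrow> 0"
    by (rule real_tendsto_divide_at_top[OF tendsto_const])
  then show ?thesis by (rule tendsto_sandwich[OF a b tendsto_const])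
qed

definition dead :: "real \<Rightarrow> 'a set" where "dead x = {\<omega> \<in> space M. exit_time Y x \<omega> = \<infinity>}"

lemma dead_eq: "dead x = (\<Inter>n. alive x n)"
proof -
  have "t = \<infinity> \<longleftrightarrow> (\<forall>n. enat n < t)" for t by (cases t) auto
  then show ?thesis by (auto simp: dead_def alive_def)
qed

lemma prob_dead: "dead x \<in> events" "prob (dead x) = 0"
proof -
  show "dead x \<in> events" unfolding dead_eq by (intro sets.countable_INT) auto
  have "prob (dead x) \<le> W.p n x" for n
    unfolding prob_alive[symmetric] dead_eq by (intro finite_measure_mono) auto
  then have "prob (dead x) \<le> 0"
    by (intro tendsto_lowerbound[OF p_tendsto_0] always_eventually allI) auto
  then show "prob (dead x) = 0" using measure_nonneg[of M "dead x"] by linarith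
qed

text \<open>\<open>ov n\<close>, the overshoot if the exit happens by time \<open>n\<close>, has
  mean \<open>e n x\<close> and increases to the overshoot at exit. Monotone convergence identifies
  the mean of the limit as \<open>einf x\<close>.\<close>

lemma V_eq: "V M Y x = W.renewal x"
proof -
  define ov where "ov n \<omega> = (\<Sum>k<n. indicator (alive x k) \<omega> * max 0 (- (x + walk Y (Suc k) \<omega>)))" for n \<omega>
  \<comment> \<open>On \<open>dead x\<close> the default value of \<open>walk_at_exit\<close> and
    the corrected \<open>x\<close> term both vanish, so \<open>u\<close> is the pointwise limit of
    \<open>ov\<close> on the whole space.\<close>
  define u where "u \<omega> = - walk_at_exit Y x \<omega> - x * (1 - indicator (dead x) \<omega>)" for \<omega>
  have iov: "integrable M (ov n)" for n
    unfolding ov_def[abs_def] by (intro Bochner_Integration.integrable_sum lin_walk_integrable) simp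
  have Eov: "(\<integral>\<omega>. ov n \<omega> \<partial>M) = W.e n x" for n
  proof -
    have "(\<integral>\<omega>. ov n \<omega> \<partial>M) = (\<Sum>k<n. \<integral>\<omega>. indicator (alive x k) \<omega> * max 0 (- (x + walk Y (Suc k) \<omega>)) \<partial>M)"
      unfolding ov_def by (intro Bochner_Integration.integral_sum lin_walk_integrable) simp
    also have "\<dots> = (\<Sum>k<n. (W.Q ^^ k) W.G x)"
    proof (intro sum.cong refl)
      fix k
      have "(\<integral>\<omega>. indicator (alive x k) \<omega> * max 0 (- (x + walk Y (Suc k) \<omega>)) \<partial>M)
         = (\<integral>\<omega>. indicator (alive x k) \<omega> * W.T (\<lambda>z. max 0 (- z)) (x + walk Y k \<omega>) \<partial>M)"
        by (rule integral_step) simp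
      also have "\<dots> = (W.Q ^^ k) W.G x" unfolding W.G_def[symmetric] by (rule integral_alive) simp
      finally show "(\<integral>\<omega>. indicator (alive x k) \<omega> * max 0 (- (x + walk Y (Suc k) \<omega>)) \<partial>M) = (W.Q ^^ k) W.G x" .
    qed
    finally show ?thesis by (simp add: W.e_def)
  qed
  have lim: "(\<lambda>n. ov n \<omega>) \<longlonglongrightarrow> u \<omega>" if \<omega>: "\<omega> \<in> space M" for \<omega>
  proof (cases "exit_time Y x \<omega>")
    case infinity
    have "walk Y (Suc k) \<omega> + x \<ge> 0" for k
      using enat_less_exit_time_iff[of "Suc k" Y x \<omega>] infinity by (auto simp: add.commute)
    then have nn: "0 \<le> x + walk Y (Suc k) \<omega>" for k by (simp add: add.commute)
    have "max 0 (- (x + walk Y (Suc k) \<omega>)) = 0" for k using nn[of k] by (intro max_absorb1) linarith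
    then have "ov n \<omega> = 0" for n unfolding ov_def by (simp only: mult_zero_right sum.neutral_const)
    moreover have "u \<omega> = 0" using infinity \<omega> by (simp add: u_def walk_at_exit_def dead_def)
    ultimately show ?thesis by simp
  next
    case (enat t)
    have al: "\<omega> \<in> alive x k \<longleftrightarrow> k < t" for k using \<omega> by (simp add: alive_def enat)
    have "t \<noteq> 0"
    proof
      assume "t = 0"
      then have "\<omega> \<notin> alive x 0" using al by simp
      then show False using \<omega> by (simp add: alive_0)
    qed
    then obtain t' where t': "t = Suc t'" by (cases t) auto
    have nn: "0 \<le> x + walk Y k \<omega>" if "1 \<le> k" "k < t" for k
      using al[of k] that by (auto simp: alive_eq)
    have neg: "x + walk Y t \<omega> < 0"
    proof (rule ccontr)
      assume "\<not> ?thesis"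
      then have "0 \<le> x + walk Y k \<omega>" if "k \<in> {1..t}" for k using nn[of k] that by (cases "k = t") auto
      then have "\<omega> \<in> alive x t" using \<omega> by (simp add: alive_eq)
      then show False using al by simp
    qed
    \<comment> \<open>Only the step into the exit contributes: before it the new position is
      nonnegative, afterwards the walk is no longer alive.\<close>
    have tm: "indicator (alive x k) \<omega> * max 0 (- (x + walk Y (Suc k) \<omega>)) = (if k = t' then - (x + walk Y t \<omega>) else 0)" for k
    proof -
      consider "k < t'" | "k = t'" | "k > t'" by linarith
      then show ?thesis
      proof cases
        case 1 then show ?thesis using nn[of "Suc k"] t' by (simp add: max_def)
      next
        case 2 then show ?thesis using neg al[of k] t' by (simp add: max_def)
      next
        case 3 then show ?thesis using al[of k] t' by simp
      qed
    qed
    have "ov n \<omega> = - (x + walk Y t \<omega>)" if "n \<ge> t" for n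
      unfolding ov_def tm using that t' by (simp add: sum.delta)
    moreover have "u \<omega> = - (x + walk Y t \<omega>)" by (simp add: u_def walk_at_exit_def dead_def enat)
    ultimately show ?thesis
      by (intro tendsto_eventually eventually_sequentiallyI[of t]) simp
  qed
  have um: "u \<in> borel_measurable M"
    by (rule borel_measurable_LIMSEQ_real[OF lim]) (use iov in auto)
  have mc: "integrable M u" "(\<integral>\<omega>. u \<omega> \<partial>M) = W.einf x"
  proof -
    have mono: "AE \<omega> in M. mono (\<lambda>n. ov n \<omega>)"
      by (intro AE_I2 monoI) (auto simp: ov_def intro!: sum_mono2)
    have pos: "AE \<omega> in M. 0 \<le> ov i \<omega>" for i by (intro AE_I2) (auto simp: ov_def intro!: sum_nonneg)
    have li: "AE \<omega> in M. (\<lambda>i. ov i \<omega>) \<longlonglongrightarrow> u \<omega>" using lim by (intro AE_I2)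
    have il: "(\<lambda>i. \<integral>\<omega>. ov i \<omega> \<partial>M) \<longlonglongrightarrow> W.einf x" unfolding Eov by (rule W.e_tendsto)
    show "integrable M u" by (rule integral_monotone_convergence_nonneg(1)[OF iov mono pos li il um])
    show "(\<integral>\<omega>. u \<omega> \<partial>M) = W.einf x" by (rule integral_monotone_convergence_nonneg(2)[OF iov mono pos li il um])
  qed
  have id: "integrable M (indicator (dead x) :: 'a \<Rightarrow> real)"
    using prob_dead by (intro integrable_real_indicator) (auto simp: emeasure_eq_measure)
  have "(\<integral>\<omega>. walk_at_exit Y x \<omega> \<partial>M) = (\<integral>\<omega>. - u \<omega> - x * (1 - indicator (dead x) \<omega>) \<partial>M)"
    by (simp add: u_def)
  also have "\<dots> = - W.einf x - x * (1 - prob (dead x))"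
    using mc id prob_dead(1) by (simp add: prob_space Int_absorb2[OF sets.sets_into_space])
  finally show ?thesis by (simp add: V_def W.renewal_def prob_dead(2))
qed

end

section \<open>Rescaling to unit variance\<close>

lemma exit_time_scale: "c > 0 \<Longrightarrow> exit_time (\<lambda>i \<omega>. X i \<omega> / c) (x / c) \<omega> = exit_time X x \<omega>"
proof -
  assume c: "c > 0"
  have w: "walk (\<lambda>i \<omega>. X i \<omega> / c) k \<omega> = walk X k \<omega> / c" for k
    by (simp add: walk_def sum_divide_distrib)
  have "x / c + walk X k \<omega> / c < 0 \<longleftrightarrow> x + walk X k \<omega> < 0" for k
    using c by (simp add: add_divide_distrib[symmetric] divide_less_0_iff)
  then show ?thesis unfolding exit_time_def w by simp
qed

lemma V_scale: "c > 0 \<Longrightarrow> V M X x = c * V M (\<lambda>i \<omega>. X i \<omega> / c) (x / c)"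
proof -
  assume c: "c > 0"
  have w: "walk (\<lambda>i \<omega>. X i \<omega> / c) k \<omega> = walk X k \<omega> / c" for k \<omega>
    by (simp add: walk_def sum_divide_distrib)
  have "walk_at_exit (\<lambda>i \<omega>. X i \<omega> / c) (x / c) \<omega> = walk_at_exit X x \<omega> / c" for \<omega>
    unfolding walk_at_exit_def exit_time_scale[OF c] w by (simp split: enat.split)
  then show ?thesis using c by (simp add: V_def)
qed

theorem theorem1p1:
  fixes M :: "'a measure" and X :: "nat \<Rightarrow> 'a \<Rightarrow> real" and \<sigma> \<delta> :: real
  assumes "prob_space M"
    and "prob_space.indep_vars M (\<lambda>_. borel) X {1..}"
    and "\<forall>i\<ge>1. distr M borel (X i) = distr M borel (X 1)"
    and "integrable M (X 1)" and "(\<integral>\<omega>. X 1 \<omega> \<partial>M) = 0"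
    and "integrable M (\<lambda>\<omega>. (X 1 \<omega>)\<^sup>2)" and "(\<integral>\<omega>. (X 1 \<omega>)\<^sup>2 \<partial>M) = \<sigma>\<^sup>2" and "\<sigma> > 0"
    and "\<delta> > 0" and "integrable M (\<lambda>\<omega>. \<bar>X 1 \<omega>\<bar> powr (2 + \<delta>))"
  shows "\<exists>c::real. c > 0 \<and> (\<forall>n::nat. n \<ge> 1 \<longrightarrow> (\<forall>x::real.
    \<bar>measure M {\<omega> \<in> space M. exit_time X x \<omega> > enat n}
       - V M X x * L (x / (\<sigma> * sqrt (real n))) / (\<sigma> * sqrt (real n))\<bar>
    \<le> c / sqrt (real n) *
        (1 / real n powr (\<delta> / 4)
         + V M X x * L (x / (\<sigma> * sqrt (real n))) / real n powr (\<delta> / (4 * (3 + \<delta>))) * ln (real n))))"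
proof -
  interpret prob_space M by fact
  define Y where "Y i \<omega> = X i \<omega> / \<sigma>" for i \<omega>
  have Xm [measurable]: "i \<ge> 1 \<Longrightarrow> X i \<in> borel_measurable M" for i
    using assms(2) by (auto simp: indep_vars_def)
  define X1 where "X1 = X 1"
  define U where "U \<omega> = X1 \<omega> / \<sigma>" for \<omega>
  define \<mu> where "\<mu> = distr M borel U"
  have X1m [measurable]: "X1 \<in> borel_measurable M" unfolding X1_def by (rule Xm) simp
  have Um [measurable]: "U \<in> borel_measurable M" unfolding U_def[abs_def] by measurable
  note X1 = assms(4,5,6,7,10)[folded X1_def]
  have iY: "indep_vars (\<lambda>_. borel) Y {1..}"
    unfolding Y_def[abs_def] by (rule indep_vars_compose2[OF assms(2)]) auto
  have dY: "distr M borel (Y i) = \<mu>" if "i \<ge> 1" for i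
  proof -
    have "distr M borel (Y i) = distr (distr M borel (X i)) borel (\<lambda>x. x / \<sigma>)"
      using Xm[OF that] by (subst distr_distr) (auto simp: Y_def[abs_def] comp_def)
    also have "distr M borel (X i) = distr M borel X1" unfolding X1_def using assms(3) that by blast
    also have "distr (distr M borel X1) borel (\<lambda>x. x / \<sigma>) = \<mu>"
      by (subst distr_distr) (auto simp: \<mu>_def U_def[abs_def] comp_def)
    finally show ?thesis .
  qed
  have law: "walk_law \<mu> \<delta>"
  proof -
    interpret \<mu>: real_distribution \<mu> unfolding \<mu>_def by (rule real_distribution_distr) (rule Um)
    show ?thesis
    proof
      show "integrable \<mu> (\<lambda>x. x)"
        unfolding \<mu>_def by (subst integrable_distr_eq) (use X1 in \<open>auto simp: U_def[abs_def]\<close>)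
      show "(\<integral>x. x \<partial>\<mu>) = 0"
        unfolding \<mu>_def by (subst integral_distr) (use X1 in \<open>auto simp: U_def[abs_def]\<close>)
      show "integrable \<mu> (\<lambda>x. x\<^sup>2)"
        unfolding \<mu>_def by (subst integrable_distr_eq) (use X1 in \<open>auto simp: U_def power_divide\<close>)
      show "(\<integral>x. x\<^sup>2 \<partial>\<mu>) = 1"
        unfolding \<mu>_def by (subst integral_distr) (use X1 assms(8) in \<open>auto simp: U_def power_divide\<close>)
      show "\<delta> > 0" by fact
      show "integrable \<mu> (\<lambda>x. \<bar>x\<bar> powr (2 + \<delta>))"
        unfolding \<mu>_def by (subst integrable_distr_eq) (use X1 assms(8) in \<open>auto simp: U_def powr_divide\<close>)
    qed
  qed
  interpret I: iid_walk M Y \<mu> \<delta>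
    by (intro iid_walk.intro iid_walk_axioms.intro iY dY law prob_space_axioms)
  obtain C where C: "C > 0" "\<And>n x. n \<ge> 1 \<Longrightarrow>
    \<bar>I.W.p n x - I.W.renewal x * L (x / sqrt (real n)) / sqrt (real n)\<bar> \<le> C / sqrt (real n) *
     (1 / real n powr (\<delta> / 4) + I.W.renewal x * L (x / sqrt (real n)) / real n powr I.W.eps * ln (real n))"
    using I.W.survival_estimate by blast
  \<comment> \<open>V scales with \<open>\<sigma>\<close> but the additive term does not; this
    factor gives \<open>A + B <= (1 + 1 / \<sigma>) * (A + \<sigma> * B)\<close> whatever the size
    of \<open>\<sigma>\<close>.\<close>
  define c where "c = C * (1 + 1 / \<sigma>)"
  have "\<bar>measure M {\<omega> \<in> space M. exit_time X x \<omega> > enat n}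
       - V M X x * L (x / (\<sigma> * sqrt (real n))) / (\<sigma> * sqrt (real n))\<bar>
    \<le> c / sqrt (real n) *
        (1 / real n powr (\<delta> / 4)
         + V M X x * L (x / (\<sigma> * sqrt (real n))) / real n powr (\<delta> / (4 * (3 + \<delta>))) * ln (real n))"
    if n: "n \<ge> 1" for n x
  proof -
    have YX: "Y = (\<lambda>i \<omega>. X i \<omega> / \<sigma>)" by (simp add: Y_def[abs_def])
    have m: "measure M {\<omega> \<in> space M. exit_time X x \<omega> > enat n} = I.W.p n (x / \<sigma>)"
      unfolding I.prob_alive[symmetric] I.alive_def unfolding YX exit_time_scale[OF \<open>\<sigma> > 0\<close>] ..
    define h where "h = I.W.renewal (x / \<sigma>)"
    have V: "V M X x = \<sigma> * h"
      using V_scale[OF \<open>\<sigma> > 0\<close>, of M X x] I.V_eq[of "x / \<sigma>"] by (simp add: h_def YX)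
    define Lx where "Lx = L (x / (\<sigma> * sqrt (real n)))"
    have Lx: "L (x / \<sigma> / sqrt (real n)) = Lx" by (simp add: Lx_def)
    define A where "A = 1 / real n powr (\<delta> / 4)"
    define B where "B = h * Lx / real n powr (\<delta> / (4 * (3 + \<delta>))) * ln (real n)"
    have A: "A \<ge> 0" by (simp add: A_def)
    have h0: "h \<ge> 0" by (simp add: h_def I.W.renewal_nonneg)
    have B: "B \<ge> 0" unfolding B_def using h0 L_nonneg n by (simp add: Lx_def)
    have "\<bar>I.W.p n (x / \<sigma>) - h * Lx / sqrt (real n)\<bar> \<le> C / sqrt (real n) * (A + B)"
      using C(2)[OF n, of "x / \<sigma>"] unfolding h_def[symmetric] Lx A_def B_def I.W.eps_def .
    also have "\<dots> \<le> C / sqrt (real n) * ((1 + 1 / \<sigma>) * (A + \<sigma> * B))"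
    proof (intro mult_left_mono)
      have "(1 + 1 / \<sigma>) * (A + \<sigma> * B) = A + B + (A / \<sigma> + \<sigma> * B)" using assms(8) by (simp add: field_simps)
      moreover have "0 \<le> A / \<sigma> + \<sigma> * B" using A B assms(8) by simp
      ultimately show "A + B \<le> (1 + 1 / \<sigma>) * (A + \<sigma> * B)" by linarith
    qed (use C in auto)
    also have "\<dots> = c / sqrt (real n) * (A + \<sigma> * B)" by (simp add: c_def)
    finally show ?thesis
      using assms(8) unfolding m V Lx_def[symmetric] by (simp add: A_def B_def mult.assoc)
  qed
  moreover have "c > 0" using C(1) assms(8) by (simp add: c_def add_pos_pos)
  ultimately show ?thesis by blast
qed

end
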